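(* Let $U_N^n,\Phi_N^n,\Psi_N^n\in X_N^0(\Omega)$, $n=0,1,\dots,N_t$ ($U_N^n$ complex-valued, $\Phi_N^n,\Psi_N^n$ real-valued) be a solution of the CN-SGM scheme (defined in the context). Put $$\mathcal{M}^n=\|U_N^n\|^2$$ and $$\mathcal{E}^n=\|\Psi_N^n\|^2+\gamma|\Phi_N^n|_{\alpha/2}^2+\eta^2\|\Phi_N^n\|^2+\lambda|U_N^n|_{\alpha/2}^2-2\int_\Omega\left(\kappa_1|U_N^n|^2+\kappa_2|U_N^n|^4\right)\Phi_N^n\,dx .$$ Then the discrete mass and energy are conserved: $$\mathcal{M}^n=\mathcal{M}^0,\qquad \mathcal{E}^n=\mathcal{E}^0,\qquad n=1,2,\dots,N_t .$$
   Context: Parameters: $\Omega=(a,b)$ is a bounded interval, $1<\alpha<2$, $T>0$, $\lambda,\kappa_1,\kappa_2,\gamma\ge 0$, $\eta\in\mathbb{R}$. Norms: $(u,v)=\int_\Omega u\bar v\,dx$, $\|u\|=\sqrt{(u,u)}$. $H_0^{\mu}(\Omega)$ is the fractional Sobolev space of order $\mu$ obtained as the closure of $C_0^\infty(\Omega)$ in the $H^\mu$ norm. Fractional derivatives: for $0<\mu<1$ the left and right Riemann-Liouville derivatives are ${}_aD_x^{\mu}u=\frac{1}{\Gamma(1-\mu)}\frac{d}{dx}\int_a^x\frac{u(\xi)\,d\xi}{(x-\xi)^{\mu}}$ and ${}_xD_b^{\mu}u=-\frac{1}{\Gamma(1-\mu)}\frac{d}{dx}\int_x^b\frac{u(\xi)\,d\xi}{(\xi-x)^{\mu}}$.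 For $u,w\in H_0^{\alpha/2}(\Omega)$, $$\mathcal{B}(u,w)=\frac{1}{2\cos(\alpha\pi/2)}\Big(({}_aD_x^{\alpha/2}u,{}_xD_b^{\alpha/2}w)+({}_xD_b^{\alpha/2}u,{}_aD_x^{\alpha/2}w)\Big),\qquad |u|_{\alpha/2}=\sqrt{\mathcal{B}(u,u)} .$$ Discrete space: $P_N(\Omega)$ is the space of polynomials of degree at most $N$ on $\Omega$, and $X_N^0(\Omega)=P_N(\Omega)\cap H_0^{\alpha/2}(\Omega)$. The projection $\Pi_N^{\alpha/2,0}:H_0^{\alpha/2}(\Omega)\to X_N^0(\Omega)$ is defined by $\mathcal{B}(u-\Pi_N^{\alpha/2,0}u,w_N)=0$ for all $w_N\in X_N^0(\Omega)$. Time grid: $\tau=T/N_t$, $t_n=n\tau$; for a sequence $v^n$, $\delta_t v^{n+1/2}=(v^{n+1}-v^n)/\tau$ and $v^{n+1/2}=(v^{n+1}+v^n)/2$. CN-SGM scheme: for $n=0,\dots,N_t-1$ and all $w_N\in X_N^0(\Omega)$, $$\mathrm{i}(\delta_tU_N^{n+1/2},w_N)-\tfrac{\lambda}{2}\mathcal{B}(U_N^{n+1/2},w_N)+\kappa_1(U_N^{n+1/2}\Phi_N^{n+1/2},w_N)+\kappa_2\big((|U_N^{n+1}|^2+|U_N^n|^2)U_N^{n+1/2}\Phi_N^{n+1/2},w_N\big)=0,$$ $$(\delta_t\Phi_N^{n+1/2},w_N)=(\Psi_N^{n+1/2},w_N),$$ $$(\delta_t\Psi_N^{n+1/2},w_N)+\gamma\mathcal{B}(\Phi_N^{n+1/2},w_N)+\eta^2(\Phi_N^{n+1/2},w_N)-\tfrac{\kappa_1}{2}\big(|U_N^{n+1}|^2+|U_N^n|^2,w_N\big)-\tfrac{\kappa_2}{2}\big(|U_N^{n+1}|^4+|U_N^n|^4,w_N\big)=0,$$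 with $U_N^0=\Pi_N^{\alpha/2,0}u_0$, $\Phi_N^0=\Pi_N^{\alpha/2,0}\phi_0$, $\Psi_N^0=\Pi_N^{\alpha/2,0}\phi_1$, where $u_0$ (complex-valued) and $\phi_0,\phi_1$ (real-valued) are given smooth functions in $H_0^{\alpha/2}(\Omega)$. *)

theory Defs
  imports "HOL-Analysis.Analysis"
begin

text \<open>
  Functions on the interval \<open>\<Omega> = {a<..<b}\<close> are represented by total functions on the reals.
  Only their values on \<open>\<Omega>\<close> matter; test functions are taken with their extension by zero.
\<close>

subsection \<open>Inner product and the spaces \<open>C\<^sub>0\<^sup>\<infinity>(\<Omega>)\<close> and \<open>H\<^sub>0\<^sup>\<mu>(\<Omega>)\<close>\<close>

definition ip :: "real \<Rightarrow> real \<Rightarrow> (real \<Rightarrow> complex) \<Rightarrow> (real \<Rightarrow> complex) \<Rightarrow> complex" where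
  "ip a b u v = (LINT x:{a<..<b}|lebesgue. u x * cnj (v x))"

definition L2_nrm :: "real \<Rightarrow> real \<Rightarrow> (real \<Rightarrow> complex) \<Rightarrow> real" where
  "L2_nrm a b u = sqrt (Re (ip a b u u))"

text \<open>\<open>D k\<close> is the \<open>k\<close>-th derivative; \<open>S\<close> is meant to be open.\<close>

definition smooth_on :: "real set \<Rightarrow> (real \<Rightarrow> 'a::real_normed_vector) \<Rightarrow> bool" where
  "smooth_on S u \<longleftrightarrow> (\<exists>D :: nat \<Rightarrow> real \<Rightarrow> 'a. D 0 = u \<and>
     (\<forall>k. \<forall>x\<in>S. (D k has_vector_derivative D (Suc k) x) (at x)))"

definition test_functions :: "real \<Rightarrow> real \<Rightarrow> (real \<Rightarrow> complex) set" where
  "test_functions a b = {\<phi>. smooth_on UNIV \<phi> \<and>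
     (\<exists>K. compact K \<and> K \<subseteq> {a<..<b} \<and> (\<forall>x. x \<notin> K \<longrightarrow> \<phi> x = 0))}"

text \<open>
  The square of the Sobolev-Slobodeckij norm for \<open>0 < \<mu> < 1\<close>, with value \<open>\<infinity>\<close> outside \<open>H\<^sup>\<mu>(\<Omega>)\<close>.
\<close>

definition Hs_norm_sq :: "real \<Rightarrow> real \<Rightarrow> real \<Rightarrow> (real \<Rightarrow> complex) \<Rightarrow> ennreal" where
  "Hs_norm_sq a b \<mu> u =
     (\<integral>\<^sup>+x\<in>{a<..<b}. ennreal ((cmod (u x))\<^sup>2) \<partial>lebesgue) +
     (\<integral>\<^sup>+x\<in>{a<..<b}. (\<integral>\<^sup>+y\<in>{a<..<b}.
        ennreal ((cmod (u x - u y))\<^sup>2 / \<bar>x - y\<bar> powr (1 + 2 * \<mu>)) \<partial>lebesgue) \<partial>lebesgue)"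

definition Hs :: "real \<Rightarrow> real \<Rightarrow> real \<Rightarrow> (real \<Rightarrow> complex) set" where
  "Hs a b \<mu> = {u. set_borel_measurable lebesgue {a<..<b} u \<and> Hs_norm_sq a b \<mu> u < \<infinity>}"

definition Hs0 :: "real \<Rightarrow> real \<Rightarrow> real \<Rightarrow> (real \<Rightarrow> complex) set" where
  "Hs0 a b \<mu> = {u \<in> Hs a b \<mu>. \<forall>\<epsilon>>0. \<exists>\<phi>\<in>test_functions a b.
     Hs_norm_sq a b \<mu> (\<lambda>x. u x - \<phi> x) < ennreal (\<epsilon>\<^sup>2)}"


subsection \<open>Riemann-Liouville derivatives and the form \<open>\<B>\<close>\<close>

text \<open>
  For \<open>1/2 < \<mu> < 1\<close> and \<open>u\<close> in \<open>H\<^sub>0\<^sup>\<mu>(\<Omega>)\<close> the functions differentiated here are absolutely continuous,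
  so that the pointwise derivative exists almost everywhere and agrees with the weak one.
\<close>

definition RL_left :: "real \<Rightarrow> real \<Rightarrow> (real \<Rightarrow> complex) \<Rightarrow> real \<Rightarrow> complex" where
  "RL_left a \<mu> u x = (1 / Gamma (1 - \<mu>)) *\<^sub>R
     vector_derivative (\<lambda>y. LINT \<xi>:{a<..<y}|lebesgue. u \<xi> /\<^sub>R ((y - \<xi>) powr \<mu>)) (at x)"

definition RL_right :: "real \<Rightarrow> real \<Rightarrow> (real \<Rightarrow> complex) \<Rightarrow> real \<Rightarrow> complex" where
  "RL_right b \<mu> u x = - (1 / Gamma (1 - \<mu>)) *\<^sub>R
     vector_derivative (\<lambda>y. LINT \<xi>:{y<..<b}|lebesgue. u \<xi> /\<^sub>R ((\<xi> - y) powr \<mu>)) (at x)"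

definition frac_form ::
  "real \<Rightarrow> real \<Rightarrow> real \<Rightarrow> (real \<Rightarrow> complex) \<Rightarrow> (real \<Rightarrow> complex) \<Rightarrow> complex" where
  "frac_form a b \<alpha> u w = complex_of_real (1 / (2 * cos (\<alpha> * pi / 2))) *
     (ip a b (RL_left a (\<alpha> / 2) u) (RL_right b (\<alpha> / 2) w) +
      ip a b (RL_right b (\<alpha> / 2) u) (RL_left a (\<alpha> / 2) w))"

text \<open>\<open>\<B>(u, u)\<close> is real, because \<open>\<B>\<close> is Hermitian; \<open>Re\<close> only changes the type.\<close>

definition frac_seminorm :: "real \<Rightarrow> real \<Rightarrow> real \<Rightarrow> (real \<Rightarrow> complex) \<Rightarrow> real" where
  "frac_seminorm a b \<alpha> u = sqrt (Re (frac_form a b \<alpha> u u))"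


subsection \<open>Polynomial space and projection\<close>

definition poly_space :: "real \<Rightarrow> real \<Rightarrow> nat \<Rightarrow> (real \<Rightarrow> complex) set" where
  "poly_space a b N =
     {u. \<exists>p :: complex poly. degree p \<le> N \<and> (\<forall>x\<in>{a<..<b}. u x = poly p (complex_of_real x))}"

definition XN0 :: "real \<Rightarrow> real \<Rightarrow> real \<Rightarrow> nat \<Rightarrow> (real \<Rightarrow> complex) set" where
  "XN0 a b \<alpha> N = poly_space a b N \<inter> Hs0 a b (\<alpha> / 2)"

text \<open>
  \<open>p = \<Pi> u\<close> on \<open>\<Omega>\<close>. This is a relation because the values of \<open>p\<close> outside \<open>\<Omega>\<close> are not determined.
\<close>

definition is_projection ::
  "real \<Rightarrow> real \<Rightarrow> real \<Rightarrow> nat \<Rightarrow> (real \<Rightarrow> complex) \<Rightarrow> (real \<Rightarrow> complex) \<Rightarrow> bool" where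
  "is_projection a b \<alpha> N u p \<longleftrightarrow>
     p \<in> XN0 a b \<alpha> N \<and> (\<forall>w\<in>XN0 a b \<alpha> N. frac_form a b \<alpha> (\<lambda>x. u x - p x) w = 0)"


subsection \<open>The scheme\<close>

text \<open>\<open>dt \<tau> v n\<close> is \<open>\<delta>\<^sub>t v\<close> and \<open>mid v n\<close> the average of \<open>v\<close>, both at the half step \<open>n + 1/2\<close>.\<close>

definition dt :: "real \<Rightarrow> (nat \<Rightarrow> real \<Rightarrow> 'a::real_vector) \<Rightarrow> nat \<Rightarrow> real \<Rightarrow> 'a" where
  "dt \<tau> v n x = (v (Suc n) x - v n x) /\<^sub>R \<tau>"

definition mid :: "(nat \<Rightarrow> real \<Rightarrow> 'a::real_vector) \<Rightarrow> nat \<Rightarrow> real \<Rightarrow> 'a" where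
  "mid v n x = (v (Suc n) x + v n x) /\<^sub>R 2"

definition cplx :: "(real \<Rightarrow> real) \<Rightarrow> real \<Rightarrow> complex" where
  "cplx f x = complex_of_real (f x)"

definition CN_SGM_solution ::
  "real \<Rightarrow> real \<Rightarrow> real \<Rightarrow> real \<Rightarrow> real \<Rightarrow> real \<Rightarrow> real \<Rightarrow> real \<Rightarrow> real \<Rightarrow> nat \<Rightarrow> nat \<Rightarrow>
   (real \<Rightarrow> complex) \<Rightarrow> (real \<Rightarrow> real) \<Rightarrow> (real \<Rightarrow> real) \<Rightarrow>
   (nat \<Rightarrow> real \<Rightarrow> complex) \<Rightarrow> (nat \<Rightarrow> real \<Rightarrow> real) \<Rightarrow> (nat \<Rightarrow> real \<Rightarrow> real) \<Rightarrow> bool" where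
  "CN_SGM_solution a b \<alpha> lam \<kappa>\<^sub>1 \<kappa>\<^sub>2 \<gamma> \<eta> T N Nt u\<^sub>0 \<phi>\<^sub>0 \<phi>\<^sub>1 U \<Phi> \<Psi> \<longleftrightarrow>
     (let \<tau> = T / real Nt; X = XN0 a b \<alpha> N; \<B> = frac_form a b \<alpha> in
      (\<forall>n\<le>Nt. U n \<in> X \<and> cplx (\<Phi> n) \<in> X \<and> cplx (\<Psi> n) \<in> X) \<and>
      is_projection a b \<alpha> N u\<^sub>0 (U 0) \<and>
      is_projection a b \<alpha> N (cplx \<phi>\<^sub>0) (cplx (\<Phi> 0)) \<and>
      is_projection a b \<alpha> N (cplx \<phi>\<^sub>1) (cplx (\<Psi> 0)) \<and>
      (\<forall>n<Nt. \<forall>w\<in>X.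
         \<i> * ip a b (dt \<tau> U n) w
           - complex_of_real (lam / 2) * \<B> (mid U n) w
           + complex_of_real \<kappa>\<^sub>1 * ip a b (\<lambda>x. mid U n x * cplx (mid \<Phi> n) x) w
           + complex_of_real \<kappa>\<^sub>2 * ip a b (\<lambda>x.
               complex_of_real ((cmod (U (Suc n) x))\<^sup>2 + (cmod (U n x))\<^sup>2)
                 * mid U n x * cplx (mid \<Phi> n) x) w = 0 \<and>
         ip a b (cplx (dt \<tau> \<Phi> n)) w = ip a b (cplx (mid \<Psi> n)) w \<and>
         ip a b (cplx (dt \<tau> \<Psi> n)) w
           + complex_of_real \<gamma> * \<B> (cplx (mid \<Phi> n)) w
           + complex_of_real (\<eta>\<^sup>2) * ip a b (cplx (mid \<Phi> n)) w
           - complex_of_real (\<kappa>\<^sub>1 / 2) * ip a b (\<lambda>x.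
               complex_of_real ((cmod (U (Suc n) x))\<^sup>2 + (cmod (U n x))\<^sup>2)) w
           - complex_of_real (\<kappa>\<^sub>2 / 2) * ip a b (\<lambda>x.
               complex_of_real ((cmod (U (Suc n) x))^4 + (cmod (U n x))^4)) w = 0))"

definition discrete_mass :: "real \<Rightarrow> real \<Rightarrow> (nat \<Rightarrow> real \<Rightarrow> complex) \<Rightarrow> nat \<Rightarrow> real" where
  "discrete_mass a b U n = (L2_nrm a b (U n))\<^sup>2"

definition discrete_energy ::
  "real \<Rightarrow> real \<Rightarrow> real \<Rightarrow> real \<Rightarrow> real \<Rightarrow> real \<Rightarrow> real \<Rightarrow> real \<Rightarrow>
   (nat \<Rightarrow> real \<Rightarrow> complex) \<Rightarrow> (nat \<Rightarrow> real \<Rightarrow> real) \<Rightarrow> (nat \<Rightarrow> real \<Rightarrow> real) \<Rightarrow> nat \<Rightarrow> real" where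
  "discrete_energy a b \<alpha> lam \<kappa>\<^sub>1 \<kappa>\<^sub>2 \<gamma> \<eta> U \<Phi> \<Psi> n =
     (L2_nrm a b (cplx (\<Psi> n)))\<^sup>2
     + \<gamma> * (frac_seminorm a b \<alpha> (cplx (\<Phi> n)))\<^sup>2
     + \<eta>\<^sup>2 * (L2_nrm a b (cplx (\<Phi> n)))\<^sup>2
     + lam * (frac_seminorm a b \<alpha> (U n))\<^sup>2
     - 2 * (LINT x:{a<..<b}|lebesgue.
              (\<kappa>\<^sub>1 * (cmod (U n x))\<^sup>2 + \<kappa>\<^sub>2 * (cmod (U n x))^4) * \<Phi> n x)"

end

theory Submission
  imports Defs
begin

text \<open>
  The conservation laws come from testing the scheme with discrete solutions. The first equation
  tested with \<open>U\<^sup>n\<^sup>+\<^sup>1\<^sup>/\<^sup>2\<close> has an imaginary part in which only the change of mass survives, since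
  \<open>\<B>(u, u)\<close> and the coupling terms are real. For the energy, the first equation is tested with
  \<open>\<delta>\<^sub>t U\<close>, the second with \<open>\<delta>\<^sub>t \<Psi>\<close> and the third with \<open>\<delta>\<^sub>t \<Phi>\<close>. The real parts of the products of
  an average with a difference quotient telescope to differences of squares, and the coupling terms
  of the first and third equations combine through the product rule
  \<open>(A' - A)(Q + P) + (A' + A)(Q - P) = 2(A'Q - AP)\<close>, applied to \<open>A = |U|\<^sup>2\<close> and \<open>A = |U|\<^sup>4\<close>
  (lemmas \<open>mass_step\<close> and \<open>energy_step\<close>).

  The analytic work is in justifying these manipulations of \<open>\<B>\<close>. The three equations only evaluate
  \<open>\<B>\<close> on polynomials. A Riemann-Liouville derivative of a polynomial is a smooth function times
  \<open>(x - a) powr (-\<mu>)\<close> or \<open>(b - x) powr (-\<mu>)\<close> with \<open>\<mu> = \<alpha>/2 < 1\<close>. A left and a right derivative are thus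
  singular at different endpoints, their product is integrable, and \<open>\<B>\<close> is sesquilinear and
  Hermitian on all polynomials (\<open>frac_form_linear\<close>, \<open>frac_form_cnj\<close>).

  The energy contains the square of the seminorm \<open>sqrt (\<B>(u, u))\<close>. This equals
  \<open>\<B>(u, u)\<close> only if \<open>\<B>(u, u) \<ge> 0\<close>, which is false for the constant
  \<open>1\<close> and requires the boundary condition. A polynomial in
  \<open>H\<^sub>0\<^sup>\<mu>\<close> with \<open>\<mu> > 1/2\<close> vanishes at both endpoints
  (\<open>poly_in_Hs0_vanishes\<close>): a boundary value is bounded by the Sobolev norm because of the
  identity
  \<open>\<integral>\<integral> (g(x) - g(y)) / (x - a)\<^sup>2 dy dx = (mean of g) - g(a)\<close>, with
  integration over \<open>a < y < x < b\<close>. For such polynomials both derivatives are fractional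
  integrals of order \<open>s = 1 - \<mu> < 1/2\<close> of \<open>u'\<close>, with opposite signs. By
  Fubini, the pairing of the left and right integral of a function \<open>q\<close> is a positive
  multiple of the integral of \<open>q(y) cnj (q(z)) (z - y) powr (2s - 1)\<close> over
  \<open>y < z\<close>. Twice the real part of the latter is the integral against the Riesz kernel
  \<open>\<bar>y - z\<bar> powr (2s - 1)\<close> over the whole square, which is positive definite
  because it is, up to a constant, the composition of a one-sided kernel with its transpose
  (\<open>Re_left_right_frac_integral_nonneg\<close>). Since \<open>cos (\<alpha>\<pi>/2) < 0\<close>
  for \<open>1 < \<alpha> < 2\<close>, the signs cancel and \<open>\<B>(u, u) \<ge> 0\<close>
  (\<open>frac_form_nonneg\<close>).
\<close>

section \<open>Riemann-Liouville derivatives of polynomials\<close>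

lemma has_bochner_integral_lborel_nonneg:
  fixes f :: "real \<Rightarrow> real"
  assumes [measurable]: "f \<in> borel_measurable borel" "A \<in> sets borel"
    and nn: "\<And>x. x \<in> A \<Longrightarrow> f x \<ge> 0" and I: "(f has_integral I) A"
  shows "has_bochner_integral lborel (\<lambda>x. indicator A x *\<^sub>R f x) I"
proof (rule has_bochner_integral_nn_integral)
  show "I \<ge> 0" using nn I by (rule has_integral_nonneg[rotated])
  show "(\<integral>\<^sup>+ x. ennreal (indicator A x *\<^sub>R f x) \<partial>lborel) = ennreal I"
    using nn_integral_has_integral_lebesgue[OF nn I] by simp
qed (use nn in \<open>auto simp: indicator_def\<close>)

text \<open>
  Euler's Beta integral, transported from \<open>[0, 1]\<close> by \<open>t = (\<xi> - a) / (y - a)\<close>.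
\<close>

lemma has_integral_Beta_affine:
  fixes a y p r :: real
  assumes "a < y" "p > -1" "r > -1"
  shows "((\<lambda>\<xi>. (\<xi> - a) powr p * (y - \<xi>) powr r) has_integral
    Beta (p + 1) (r + 1) * (y - a) powr (p + r + 1)) {a<..<y}"
proof -
  let ?L = "y - a"
  have L: "?L > 0" using assms by simp
  have "((\<lambda>t. t powr p * (1 - t) powr r) has_integral Beta (p + 1) (r + 1)) (cbox 0 1)"
    using has_integral_Beta_real[of "p + 1" "r + 1"] assms by simp
  from has_integral_affinity[OF this, of "1 / ?L" "- a / ?L"]
  have "((\<lambda>\<xi>. ((\<xi> - a) / ?L) powr p * (1 - (\<xi> - a) / ?L) powr r) has_integral
      ?L * Beta (p + 1) (r + 1)) ((\<lambda>x. ?L * x + a) ` {0..1})"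
    using L by (simp add: diff_divide_distrib)
  also have "(\<lambda>x. ?L * x + a) ` {0..1} = {a..y}"
    using L by (subst image_affinity_atLeastAtMost) simp
  finally have "((\<lambda>\<xi>. ((\<xi> - a) / ?L) powr p * (1 - (\<xi> - a) / ?L) powr r) has_integral
      ?L * Beta (p + 1) (r + 1)) {a<..<y}"
    by (simp only: has_integral_Icc_iff_Ioo)
  from has_integral_mult_right[OF this, of "?L powr (p + r)"]
  have "((\<lambda>\<xi>. ?L powr (p + r) * (((\<xi> - a) / ?L) powr p * (1 - (\<xi> - a) / ?L) powr r)) has_integral
      ?L powr (p + r) * (?L * Beta (p + 1) (r + 1))) {a<..<y}" .
  also have "?L powr (p + r) * (?L * Beta (p + 1) (r + 1)) = Beta (p + 1) (r + 1) * ?L powr (p + r + 1)"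
    using L by (simp add: powr_add)
  finally show ?thesis
  proof (rule has_integral_eq[rotated])
    fix \<xi> assume "\<xi> \<in> {a<..<y}"
    then have "1 - (\<xi> - a) / ?L = (y - \<xi>) / ?L" "\<xi> - a \<ge> 0" "y - \<xi> \<ge> 0"
      using L by (auto simp: field_simps)
    then show "?L powr (p + r) * (((\<xi> - a) / ?L) powr p * (1 - (\<xi> - a) / ?L) powr r) =
        (\<xi> - a) powr p * (y - \<xi>) powr r"
      using L by (simp add: powr_divide powr_add)
  qed
qed

lemma has_bochner_integral_Beta:
  fixes a y p r :: real
  assumes "a < y" "p > -1" "r > -1"
  shows "has_bochner_integral lebesgue (\<lambda>\<xi>. indicator {a<..<y} \<xi> *\<^sub>R ((\<xi> - a) powr p * (y - \<xi>) powr r))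
    (Beta (p + 1) (r + 1) * (y - a) powr (p + r + 1))"
proof -
  have "has_bochner_integral lborel (\<lambda>\<xi>. indicator {a<..<y} \<xi> *\<^sub>R ((\<xi> - a) powr p * (y - \<xi>) powr r))
      (Beta (p + 1) (r + 1) * (y - a) powr (p + r + 1))"
    by (rule has_bochner_integral_lborel_nonneg) (use has_integral_Beta_affine[OF assms] in auto)
  then show ?thesis
    by (simp add: has_bochner_integral_iff integrable_completion integral_completion)
qed

lemma poly_eq_sum_of_degree_le:
  fixes p :: "'a::comm_semiring_1 poly"
  assumes "degree p \<le> n"
  shows "poly p x = (\<Sum>k\<le>n. coeff p k * x ^ k)"
  unfolding poly_altdef
  by (rule sum.mono_neutral_left) (use assms in \<open>auto simp: coeff_eq_0\<close>)

text \<open>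
  Polynomials are expanded in powers of \<open>x - a\<close> because each such power is mapped by the fractional
  integral to a multiple of another power; the multiple is a Beta value.
\<close>

lemma frac_integral_power_sum:
  fixes f :: "real \<Rightarrow> complex"
  assumes \<mu>: "\<mu> < 1" and y: "a < y"
    and f: "\<And>x. x \<in> {a<..<y} \<Longrightarrow> f x = (\<Sum>k\<le>n. c k * of_real ((x - a) ^ k))"
  shows "(LINT \<xi>:{a<..<y}|lebesgue. f \<xi> /\<^sub>R ((y - \<xi>) powr \<mu>)) =
    (\<Sum>k\<le>n. c k * of_real (Beta (real k + 1) (1 - \<mu>) * (y - a) powr (real k + 1 - \<mu>)))"
proof -
  have power_k: "has_bochner_integral lebesgue
      (\<lambda>\<xi>. c k * of_real (indicator {a<..<y} \<xi> *\<^sub>R ((\<xi> - a) powr real k * (y - \<xi>) powr (- \<mu>))))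
      (c k * of_real (Beta (real k + 1) (1 - \<mu>) * (y - a) powr (real k + 1 - \<mu>)))" for k
    using has_bochner_integral_Beta[OF y, of "real k" "- \<mu>"] \<mu>
    by (intro has_bochner_integral_mult_right has_bochner_integral_of_real) (simp add: algebra_simps)
  have "has_bochner_integral lebesgue (\<lambda>\<xi>. \<Sum>k\<le>n.
      c k * of_real (indicator {a<..<y} \<xi> *\<^sub>R ((\<xi> - a) powr real k * (y - \<xi>) powr (- \<mu>))))
    (\<Sum>k\<le>n. c k * of_real (Beta (real k + 1) (1 - \<mu>) * (y - a) powr (real k + 1 - \<mu>)))"
    by (intro has_bochner_integral_sum power_k)
  also have "(\<lambda>\<xi>. \<Sum>k\<le>n.
      c k * of_real (indicator {a<..<y} \<xi> *\<^sub>R ((\<xi> - a) powr real k * (y - \<xi>) powr (- \<mu>)))) =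
      (\<lambda>\<xi>. indicator {a<..<y} \<xi> *\<^sub>R (f \<xi> /\<^sub>R ((y - \<xi>) powr \<mu>)))"
  proof
    fix \<xi> show "(\<Sum>k\<le>n.
        c k * of_real (indicator {a<..<y} \<xi> *\<^sub>R ((\<xi> - a) powr real k * (y - \<xi>) powr (- \<mu>)))) =
        indicator {a<..<y} \<xi> *\<^sub>R (f \<xi> /\<^sub>R ((y - \<xi>) powr \<mu>))"
      by (cases "\<xi> \<in> {a<..<y}")
        (auto simp: f powr_realpow powr_minus scaleR_conv_of_real sum_distrib_left mult_ac)
  qed
  finally show ?thesis
    unfolding set_lebesgue_integral_def by (rule has_bochner_integral_integral_eq)
qed

text \<open>
  The constant in the power rule: differentiating \<open>(y - a) powr (k + 1 - \<mu>)\<close> produces the factor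
  \<open>k + 1 - \<mu>\<close>, which turns the Beta value into a quotient of Gamma values.
\<close>

lemma Beta_power_rule:
  assumes "\<mu> < (1::real)"
  shows "Beta (real k + 1) (1 - \<mu>) * (real k + 1 - \<mu>) = Gamma (1 - \<mu>) * (fact k / Gamma (real k + 1 - \<mu>))"
proof -
  have "Gamma (real k + 1 + (1 - \<mu>)) = (real k + 1 - \<mu>) * Gamma (real k + 1 - \<mu>)"
    using Gamma_plus1[of "real k + 1 - \<mu>"] assms by (force elim!: nonpos_Ints_cases simp: algebra_simps)
  moreover have "Gamma (real k + 1) = fact k" using Gamma_fact[of k] by (simp add: add.commute)
  moreover have "real k + 1 - \<mu> \<noteq> 0" using assms by linarith
  ultimately show ?thesis by (simp add: Beta_def)
qed

lemma frac_integral_has_derivative: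
  fixes u :: "real \<Rightarrow> complex"
  assumes \<mu>: "\<mu> < 1" and x: "x \<in> {a<..<b}"
    and u: "\<And>x. x \<in> {a<..<b} \<Longrightarrow> u x = (\<Sum>k\<le>n. c k * of_real ((x - a) ^ k))"
  shows "((\<lambda>y. LINT \<xi>:{a<..<y}|lebesgue. u \<xi> /\<^sub>R ((y - \<xi>) powr \<mu>)) has_vector_derivative
    Gamma (1 - \<mu>) *\<^sub>R (\<Sum>k\<le>n. c k * of_real (fact k / Gamma (real k + 1 - \<mu>) * (x - a) powr (real k - \<mu>)))) (at x)"
proof -
  let ?g = "\<lambda>y. \<Sum>k\<le>n. c k * of_real (Beta (real k + 1) (1 - \<mu>) * (y - a) powr (real k + 1 - \<mu>))"
  have pow: "((\<lambda>y. (y - a) powr (real k + 1 - \<mu>)) has_real_derivative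
      (real k + 1 - \<mu>) * (x - a) powr (real k - \<mu>)) (at x)" for k
  proof -
    have "real k + 1 - \<mu> - 1 = real k - \<mu>" by simp
    then show ?thesis
      using x by (auto intro!: derivative_eq_intros)
  qed
  have "(?g has_vector_derivative (\<Sum>k\<le>n. c k * of_real (Beta (real k + 1) (1 - \<mu>) *
      ((real k + 1 - \<mu>) * (x - a) powr (real k - \<mu>))))) (at x)"
    by (intro has_vector_derivative_sum has_vector_derivative_mult_right has_vector_derivative_of_real DERIV_cmult pow)
  also have "(\<Sum>k\<le>n. c k * of_real (Beta (real k + 1) (1 - \<mu>) *
      ((real k + 1 - \<mu>) * (x - a) powr (real k - \<mu>)))) =
     Gamma (1 - \<mu>) *\<^sub>R (\<Sum>k\<le>n. c k * of_real (fact k / Gamma (real k + 1 - \<mu>) * (x - a) powr (real k - \<mu>)))"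
    unfolding mult.assoc[symmetric] Beta_power_rule[OF \<mu>]
    by (simp add: scaleR_conv_of_real sum_distrib_left mult_ac)
  finally show ?thesis
  proof (rule has_vector_derivative_transform_within_open[OF _ open_greaterThanLessThan x])
    fix y assume y: "y \<in> {a<..<b}"
    then show "?g y = (LINT \<xi>:{a<..<y}|lebesgue. u \<xi> /\<^sub>R ((y - \<xi>) powr \<mu>))"
      by (subst frac_integral_power_sum[OF \<mu>]) (use u in auto)
  qed
qed

text \<open>
  The classical power rule
  \<open>D\<^sup>\<mu> (x - a)\<^sup>k = \<Gamma>(k + 1) / \<Gamma>(k + 1 - \<mu>) (x - a)\<^sup>k\<^sup>-\<^sup>\<mu>\<close>.
\<close>

lemma RL_left_power_sum:
  assumes \<mu>: "\<mu> < 1" and x: "x \<in> {a<..<b}"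
    and u: "\<And>x. x \<in> {a<..<b} \<Longrightarrow> u x = (\<Sum>k\<le>n. c k * of_real ((x - a) ^ k))"
  shows "RL_left a \<mu> u x =
    (\<Sum>k\<le>n. c k * of_real (fact k / Gamma (real k + 1 - \<mu>) * (x - a) powr (real k - \<mu>)))"
proof -
  have "Gamma (1 - \<mu>) > 0" using \<mu> by (intro Gamma_real_pos) simp
  then show ?thesis
    using vector_derivative_at[OF frac_integral_has_derivative[OF assms]] by (simp add: RL_left_def)
qed

lemma set_integral_reflect:
  fixes f :: "real \<Rightarrow> complex"
  shows "(LINT \<xi>:{y<..<b}|lebesgue. f \<xi>) = (LINT \<xi>:{- b<..<- y}|lebesgue. f (- \<xi>))"
proof -
  have "indicator {y<..<b} (- \<xi>) = (indicator {- b<..<- y} \<xi> :: real)" for \<xi>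
    by (auto simp: indicator_def)
  then show ?thesis
    unfolding set_lebesgue_integral_def
    by (subst lebesgue_integral_real_affine[where c = "-1" and t = 0]) auto
qed

lemma poly_space_power_sum:
  assumes "u \<in> poly_space a b N"
  obtains c where "\<And>x. x \<in> {a<..<b} \<Longrightarrow> u x = (\<Sum>k\<le>N. c k * of_real ((x - t) ^ k))"
proof -
  obtain p where p: "degree p \<le> N" "\<And>x. x \<in> {a<..<b} \<Longrightarrow> u x = poly p (complex_of_real x)"
    using assms by (auto simp: poly_space_def)
  let ?q = "pcompose p [:complex_of_real t, 1:]"
  have "u x = (\<Sum>k\<le>N. coeff ?q k * of_real ((x - t) ^ k))" if "x \<in> {a<..<b}" for x
  proof -
    have "u x = poly ?q (of_real (x - t))" using p(2)[OF that] by (simp add: poly_pcompose)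
    also have "\<dots> = (\<Sum>k\<le>N. coeff ?q k * of_real (x - t) ^ k)"
      by (rule poly_eq_sum_of_degree_le) (use p(1) degree_pcompose_le[of p "[:complex_of_real t, 1:]"] in simp)
    finally show ?thesis by simp
  qed
  then show thesis by (rule that)
qed

lemma poly_space_reflect:
  assumes "u \<in> poly_space a b N"
  shows "(\<lambda>x. u (- x)) \<in> poly_space (- b) (- a) N"
proof -
  obtain p where p: "degree p \<le> N" "\<And>x. x \<in> {a<..<b} \<Longrightarrow> u x = poly p (complex_of_real x)"
    using assms by (auto simp: poly_space_def)
  then show ?thesis
    unfolding poly_space_def
    by (auto intro!: exI[of _ "pcompose p [:0, -1:]"] simp: poly_pcompose degree_pcompose)
qed

text \<open>
  Every fact about right derivatives is obtained from the left ones through \<open>x \<mapsto> - x\<close>. Working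
  with polynomials ensures that the fractional integral is differentiable, so that the chain rule
  applies to the pointwise derivative.
\<close>

lemma RL_right_eq_RL_left_reflect:
  assumes u: "u \<in> poly_space a b N" and \<mu>: "\<mu> < 1" and x: "x \<in> {a<..<b}"
  shows "RL_right b \<mu> u x = RL_left (- b) \<mu> (\<lambda>x. u (- x)) (- x)"
proof -
  let ?F = "\<lambda>y. LINT \<xi>:{- b<..<y}|lebesgue. u (- \<xi>) /\<^sub>R ((y - \<xi>) powr \<mu>)"
  obtain c where c: "\<And>x. x \<in> {- b<..<- a} \<Longrightarrow> u (- x) = (\<Sum>k\<le>N. c k * of_real ((x - (- b)) ^ k))"
    using poly_space_power_sum[OF poly_space_reflect[OF u]] by blast
  obtain d where d: "(?F has_vector_derivative d) (at (- x))"
    using frac_integral_has_derivative[OF \<mu>, of "- x" "- b" "- a", OF _ c] x by auto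
  have G: "(\<lambda>y. LINT \<xi>:{y<..<b}|lebesgue. u \<xi> /\<^sub>R ((\<xi> - y) powr \<mu>)) = ?F \<circ> uminus"
    by (subst set_integral_reflect) (simp add: fun_eq_iff add.commute)
  have "((?F \<circ> uminus) has_vector_derivative (-1) *\<^sub>R d) (at x)"
    by (rule vector_diff_chain_at) (use d in \<open>auto intro!: derivative_eq_intros\<close>)
  then show ?thesis
    unfolding RL_right_def RL_left_def G using d by (simp add: vector_derivative_at)
qed

text \<open>
  The singularity at \<open>a\<close> is at worst of order \<open>\<mu>\<close>, even if \<open>u\<close> does not vanish there.
\<close>

lemma RL_left_poly_space:
  assumes u: "u \<in> poly_space a b N" and \<mu>: "\<mu> < 1"
  obtains P where "continuous_on UNIV P"
    "\<And>x. x \<in> {a<..<b} \<Longrightarrow> RL_left a \<mu> u x = (x - a) powr (- \<mu>) *\<^sub>R P x"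
proof -
  obtain c where c: "\<And>x. x \<in> {a<..<b} \<Longrightarrow> u x = (\<Sum>k\<le>N. c k * of_real ((x - a) ^ k))"
    using poly_space_power_sum[OF u] by blast
  let ?P = "\<lambda>x. \<Sum>k\<le>N. c k * complex_of_real (fact k / Gamma (real k + 1 - \<mu>) * (x - a) ^ k)"
  have "RL_left a \<mu> u x = (x - a) powr (- \<mu>) *\<^sub>R ?P x" if x: "x \<in> {a<..<b}" for x
  proof -
    have "RL_left a \<mu> u x =
      (\<Sum>k\<le>N. c k * of_real (fact k / Gamma (real k + 1 - \<mu>) * (x - a) powr (real k - \<mu>)))"
      by (rule RL_left_power_sum[OF \<mu> x]) (rule c)
    then show ?thesis
      using x by (simp add: powr_diff powr_minus powr_realpow scaleR_conv_of_real sum_distrib_left field_simps)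
  qed
  moreover have "continuous_on UNIV ?P" by (intro continuous_intros)
  ultimately show thesis using that by blast
qed

lemma RL_right_poly_space:
  assumes u: "u \<in> poly_space a b N" and \<mu>: "\<mu> < 1"
  obtains P where "continuous_on UNIV P"
    "\<And>x. x \<in> {a<..<b} \<Longrightarrow> RL_right b \<mu> u x = (b - x) powr (- \<mu>) *\<^sub>R P x"
proof -
  obtain P where P: "continuous_on UNIV P" "\<And>x. x \<in> {- b<..<- a} \<Longrightarrow>
      RL_left (- b) \<mu> (\<lambda>x. u (- x)) x = (x - (- b)) powr (- \<mu>) *\<^sub>R P x"
    using RL_left_poly_space[OF poly_space_reflect[OF u] \<mu>] by blast
  have "continuous_on UNIV (\<lambda>x. P (- x))"
    by (rule continuous_on_compose2[OF P(1)]) (auto intro: continuous_intros)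
  moreover have "RL_right b \<mu> u x = (b - x) powr (- \<mu>) *\<^sub>R P (- x)" if "x \<in> {a<..<b}" for x
    using that by (simp add: RL_right_eq_RL_left_reflect[OF u \<mu> that] P(2) add.commute)
  ultimately show thesis using that by blast
qed

lemma RL_left_linear:
  assumes u: "u \<in> poly_space a b N" and v: "v \<in> poly_space a b N"
    and \<mu>: "\<mu> < 1" and x: "x \<in> {a<..<b}"
  shows "RL_left a \<mu> (\<lambda>x. r *\<^sub>R u x + t *\<^sub>R v x) x = r *\<^sub>R RL_left a \<mu> u x + t *\<^sub>R RL_left a \<mu> v x"
proof -
  obtain c where c: "\<And>x. x \<in> {a<..<b} \<Longrightarrow> u x = (\<Sum>k\<le>N. c k * of_real ((x - a) ^ k))"
    using poly_space_power_sum[OF u] by blast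
  obtain d where d: "\<And>x. x \<in> {a<..<b} \<Longrightarrow> v x = (\<Sum>k\<le>N. d k * of_real ((x - a) ^ k))"
    using poly_space_power_sum[OF v] by blast
  have cd: "r *\<^sub>R u x + t *\<^sub>R v x = (\<Sum>k\<le>N. (r *\<^sub>R c k + t *\<^sub>R d k) * of_real ((x - a) ^ k))"
    if "x \<in> {a<..<b}" for x
    by (simp add: c[OF that] d[OF that] scaleR_sum_right distrib_right sum.distrib)
  let ?D = "\<lambda>k. complex_of_real (fact k / Gamma (real k + 1 - \<mu>) * (x - a) powr (real k - \<mu>))"
  have "RL_left a \<mu> u x = (\<Sum>k\<le>N. c k * ?D k)"
    by (rule RL_left_power_sum[OF \<mu> x]) (rule c)
  moreover have "RL_left a \<mu> v x = (\<Sum>k\<le>N. d k * ?D k)"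
    by (rule RL_left_power_sum[OF \<mu> x]) (rule d)
  moreover have "RL_left a \<mu> (\<lambda>x. r *\<^sub>R u x + t *\<^sub>R v x) x = (\<Sum>k\<le>N. (r *\<^sub>R c k + t *\<^sub>R d k) * ?D k)"
    by (rule RL_left_power_sum[OF \<mu> x]) (rule cd)
  ultimately show ?thesis
    by (simp add: scaleR_sum_right distrib_right sum.distrib del: of_real_mult of_real_divide)
qed

lemma poly_space_linear:
  assumes "u \<in> poly_space a b N" "v \<in> poly_space a b N"
  shows "(\<lambda>x. r *\<^sub>R u x + t *\<^sub>R v x) \<in> poly_space a b N"
proof -
  obtain p q where "degree p \<le> N" "\<And>x. x \<in> {a<..<b} \<Longrightarrow> u x = poly p (complex_of_real x)"
    "degree q \<le> N" "\<And>x. x \<in> {a<..<b} \<Longrightarrow> v x = poly q (complex_of_real x)"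
    using assms by (auto simp: poly_space_def)
  then show ?thesis
    unfolding poly_space_def
    by (auto intro!: exI[of _ "smult (of_real r) p + smult (of_real t) q"] degree_add_le
        simp: scaleR_conv_of_real intro: order_trans[OF degree_smult_le])
qed

lemma RL_right_linear:
  assumes u: "u \<in> poly_space a b N" and v: "v \<in> poly_space a b N"
    and \<mu>: "\<mu> < 1" and x: "x \<in> {a<..<b}"
  shows "RL_right b \<mu> (\<lambda>x. r *\<^sub>R u x + t *\<^sub>R v x) x = r *\<^sub>R RL_right b \<mu> u x + t *\<^sub>R RL_right b \<mu> v x"
  using RL_left_linear[OF poly_space_reflect[OF u] poly_space_reflect[OF v] \<mu>, of "- x" r t] x
  by (simp add: RL_right_eq_RL_left_reflect[OF u \<mu> x] RL_right_eq_RL_left_reflect[OF v \<mu> x]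
      RL_right_eq_RL_left_reflect[OF poly_space_linear[OF u v] \<mu> x])

text \<open>
  The singularities of order \<open>\<mu> < 1\<close> sit at opposite endpoints, so that the product is dominated by
  a Beta integrand.
\<close>

lemma RL_product_integrable:
  assumes u: "u \<in> poly_space a b N" and w: "w \<in> poly_space a b N" and \<mu>: "\<mu> < 1"
  shows "set_integrable lebesgue {a<..<b} (\<lambda>x. RL_left a \<mu> u x * cnj (RL_right b \<mu> w x))"
    and "set_integrable lebesgue {a<..<b} (\<lambda>x. RL_right b \<mu> w x * cnj (RL_left a \<mu> u x))"
proof -
  obtain P where P: "continuous_on UNIV P"
    "\<And>x. x \<in> {a<..<b} \<Longrightarrow> RL_left a \<mu> u x = (x - a) powr (- \<mu>) *\<^sub>R P x"
    using RL_left_poly_space[OF u \<mu>] by blast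
  obtain Q where Q: "continuous_on UNIV Q"
    "\<And>x. x \<in> {a<..<b} \<Longrightarrow> RL_right b \<mu> w x = (b - x) powr (- \<mu>) *\<^sub>R Q x"
    using RL_right_poly_space[OF w \<mu>] by blast
  have contPQ: "continuous_on UNIV (\<lambda>x. P x * cnj (Q x))"
    by (intro continuous_intros P Q)
  have "bounded ((\<lambda>x. P x * cnj (Q x)) ` {a..b})"
    by (intro compact_imp_bounded compact_continuous_image continuous_on_subset[OF contPQ]) auto
  then obtain M where M: "\<forall>x\<in>{a..b}. norm (P x * cnj (Q x)) \<le> M"
    unfolding bounded_iff by auto
  have [measurable]: "(\<lambda>x. P x * cnj (Q x)) \<in> borel_measurable borel"
    using contPQ by (rule borel_measurable_continuous_onI)
  show *: "set_integrable lebesgue {a<..<b} (\<lambda>x. RL_left a \<mu> u x * cnj (RL_right b \<mu> w x))"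
  proof (cases "a < b")
    case True
    have int: "integrable lborel (\<lambda>x. M * (indicator {a<..<b} x *\<^sub>R ((x - a) powr (- \<mu>) * (b - x) powr (- \<mu>))))"
      using has_bochner_integral_Beta[OF True, of "- \<mu>" "- \<mu>"] \<mu>
      by (simp add: has_bochner_integral_iff integrable_completion)
    have "integrable lborel (\<lambda>x. (indicator {a<..<b} x *\<^sub>R ((x - a) powr (- \<mu>) * (b - x) powr (- \<mu>))) *\<^sub>R (P x * cnj (Q x)))"
    proof (rule Bochner_Integration.integrable_bound[OF int])
      show "AE x in lborel. norm ((indicator {a<..<b} x *\<^sub>R ((x - a) powr (- \<mu>) * (b - x) powr (- \<mu>))) *\<^sub>R (P x * cnj (Q x)))
        \<le> norm (M * (indicator {a<..<b} x *\<^sub>R ((x - a) powr (- \<mu>) * (b - x) powr (- \<mu>))))"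
      proof (rule AE_I2)
        fix x
        show "norm ((indicator {a<..<b} x *\<^sub>R ((x - a) powr (- \<mu>) * (b - x) powr (- \<mu>))) *\<^sub>R (P x * cnj (Q x)))
          \<le> norm (M * (indicator {a<..<b} x *\<^sub>R ((x - a) powr (- \<mu>) * (b - x) powr (- \<mu>))))"
        proof (cases "x \<in> {a<..<b}")
          case True
          then have "norm (P x * cnj (Q x)) \<le> \<bar>M\<bar>" using bspec[OF M, of x] by auto
          then show ?thesis using True
            by (simp add: abs_mult mult.commute[of "\<bar>M\<bar>"] mult_left_mono)
        qed simp
      qed
    qed measurable
    then have "integrable lebesgue (\<lambda>x. (indicator {a<..<b} x *\<^sub>R ((x - a) powr (- \<mu>) * (b - x) powr (- \<mu>))) *\<^sub>R (P x * cnj (Q x)))"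
      by (subst integrable_completion) auto
    also have "(\<lambda>x. (indicator {a<..<b} x *\<^sub>R ((x - a) powr (- \<mu>) * (b - x) powr (- \<mu>))) *\<^sub>R (P x * cnj (Q x))) =
        (\<lambda>x. indicator {a<..<b} x *\<^sub>R (RL_left a \<mu> u x * cnj (RL_right b \<mu> w x)))"
      by (auto simp: P Q indicator_def fun_eq_iff)
    finally show ?thesis unfolding set_integrable_def .
  qed (simp add: set_integrable_def)
  have "integrable lebesgue (\<lambda>x. cnj (indicator {a<..<b} x *\<^sub>R (RL_left a \<mu> u x * cnj (RL_right b \<mu> w x))))"
    using * unfolding set_integrable_def by (rule integrable_cnj)
  then show "set_integrable lebesgue {a<..<b} (\<lambda>x. RL_right b \<mu> w x * cnj (RL_left a \<mu> u x))"
    unfolding set_integrable_def by (simp add: mult.commute)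
qed

text \<open>
  The Caputo form of the derivative. The Riemann-Liouville derivative exceeds it by a multiple of
  \<open>u(a) (x - a) powr (-\<mu>)\<close>, which is absent here. The two sides agree term by term on powers.
\<close>

lemma RL_left_eq_frac_integral_deriv:
  assumes \<mu>: "\<mu> < 1" and x: "x \<in> {a<..<b}"
    and u: "\<And>x. x \<in> {a<..<b} \<Longrightarrow> u x = poly p (complex_of_real x)" and p0: "poly p (of_real a) = 0"
  shows "RL_left a \<mu> u x = (1 / Gamma (1 - \<mu>)) *\<^sub>R
    (LINT \<xi>:{a<..<x}|lebesgue. poly (pderiv p) (of_real \<xi>) /\<^sub>R ((x - \<xi>) powr \<mu>))"
proof -
  define q where "q = pcompose p [:complex_of_real a, 1:]"
  define n where "n = degree q"
  have u': "u x = (\<Sum>k\<le>Suc n. coeff q k * of_real ((x - a) ^ k))" if "x \<in> {a<..<b}" for x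
  proof -
    have "u x = poly q (of_real (x - a))" using u[OF that] by (simp add: q_def poly_pcompose)
    also have "\<dots> = (\<Sum>k\<le>Suc n. coeff q k * of_real (x - a) ^ k)"
      by (rule poly_eq_sum_of_degree_le) (simp add: n_def)
    finally show ?thesis by simp
  qed
  have d: "poly (pderiv p) (of_real x) = (\<Sum>k\<le>n. coeff (pderiv q) k * of_real ((x - a) ^ k))" for x
  proof -
    have "pderiv q = pcompose (pderiv p) [:complex_of_real a, 1:]"
      by (simp add: q_def pderiv_pcompose pderiv_pCons)
    then have "poly (pderiv p) (of_real x) = poly (pderiv q) (of_real (x - a))" by (simp add: poly_pcompose)
    also have "\<dots> = (\<Sum>k\<le>n. coeff (pderiv q) k * of_real (x - a) ^ k)"
      by (rule poly_eq_sum_of_degree_le) (simp add: n_def degree_pderiv)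
    finally show ?thesis by simp
  qed
  have q0: "coeff q 0 = 0" using p0 by (simp add: q_def flip: poly_0_coeff_0) (simp add: poly_pcompose)
  have G: "Gamma (1 - \<mu>) > 0" using \<mu> by (intro Gamma_real_pos) simp
  have shift: "real (Suc k) * Beta (real k + 1) (1 - \<mu>) = Gamma (1 - \<mu>) * (fact (Suc k) / Gamma (real (Suc k) + 1 - \<mu>))" for k
    using Gamma_fact[of k, where ?'a = real] by (simp add: Beta_def algebra_simps)
  \<comment> \<open>The constant coefficient of \<open>q\<close> is \<open>u(a) = 0\<close>, so the expansion starts at \<open>k = 1\<close>.\<close>
  have "RL_left a \<mu> u x =
      (\<Sum>k\<le>n. coeff q (Suc k) * of_real (fact (Suc k) / Gamma (real (Suc k) + 1 - \<mu>) * (x - a) powr (real (Suc k) - \<mu>)))"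
    by (subst RL_left_power_sum[OF \<mu> x, where u = u and n = "Suc n" and c = "coeff q"], rule u', assumption)
      (simp only: sum.atMost_Suc_shift q0 mult_zero_left add_0)
  also have "\<dots> = (1 / Gamma (1 - \<mu>)) *\<^sub>R (\<Sum>k\<le>n. coeff (pderiv q) k *
      of_real (Beta (real k + 1) (1 - \<mu>) * (x - a) powr (real k + 1 - \<mu>)))"
    unfolding scaleR_sum_right
  proof (rule sum.cong[OF refl])
    fix k
    have *: "complex_of_real (fact (Suc k) / Gamma (real (Suc k) + 1 - \<mu>)) =
        of_real (real (Suc k) * Beta (real k + 1) (1 - \<mu>) / Gamma (1 - \<mu>))"
      unfolding shift using G by simp
    show "coeff q (Suc k) * of_real (fact (Suc k) / Gamma (real (Suc k) + 1 - \<mu>) * (x - a) powr (real (Suc k) - \<mu>)) =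
      (1 / Gamma (1 - \<mu>)) *\<^sub>R (coeff (pderiv q) k *
      of_real (Beta (real k + 1) (1 - \<mu>) * (x - a) powr (real k + 1 - \<mu>)))"
      unfolding of_real_mult * by (simp add: coeff_pderiv scaleR_conv_of_real add.commute mult_ac)
  qed
  also have "(\<Sum>k\<le>n. coeff (pderiv q) k *
      of_real (Beta (real k + 1) (1 - \<mu>) * (x - a) powr (real k + 1 - \<mu>))) =
      (LINT \<xi>:{a<..<x}|lebesgue. poly (pderiv p) (of_real \<xi>) /\<^sub>R ((x - \<xi>) powr \<mu>))"
    by (subst frac_integral_power_sum[OF \<mu>]) (use x d in auto)
  finally show ?thesis .
qed

lemma RL_right_eq_frac_integral_deriv:
  assumes \<mu>: "\<mu> < 1" and x: "x \<in> {a<..<b}"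
    and u: "\<And>x. x \<in> {a<..<b} \<Longrightarrow> u x = poly p (complex_of_real x)" and p0: "poly p (of_real b) = 0"
  shows "RL_right b \<mu> u x = - (1 / Gamma (1 - \<mu>)) *\<^sub>R
    (LINT \<xi>:{x<..<b}|lebesgue. poly (pderiv p) (of_real \<xi>) /\<^sub>R ((\<xi> - x) powr \<mu>))"
proof -
  let ?q = "pcompose p [:0, -1 :: complex:]"
  have "u \<in> poly_space a b (degree p)" using u by (auto simp: poly_space_def)
  then have "RL_right b \<mu> u x = RL_left (- b) \<mu> (\<lambda>x. u (- x)) (- x)"
    using \<mu> x by (rule RL_right_eq_RL_left_reflect)
  also have "\<dots> = (1 / Gamma (1 - \<mu>)) *\<^sub>R
    (LINT \<xi>:{- b<..<- x}|lebesgue. poly (pderiv ?q) (of_real \<xi>) /\<^sub>R ((- x - \<xi>) powr \<mu>))"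
    by (rule RL_left_eq_frac_integral_deriv[OF \<mu>, where b = "- a"]) (use x u p0 in \<open>auto simp: poly_pcompose\<close>)
  also have "(LINT \<xi>:{- b<..<- x}|lebesgue. poly (pderiv ?q) (of_real \<xi>) /\<^sub>R ((- x - \<xi>) powr \<mu>)) =
      - (LINT \<xi>:{x<..<b}|lebesgue. poly (pderiv p) (of_real \<xi>) /\<^sub>R ((\<xi> - x) powr \<mu>))"
    by (subst (2) set_integral_reflect)
      (simp add: pderiv_pcompose pderiv_pCons poly_pcompose minus_diff_commute set_lebesgue_integral_def)
  finally show ?thesis by simp
qed

section \<open>The form \<open>\<B>\<close> on polynomials is sesquilinear and Hermitian\<close>

lemma ip_cnj: "cnj (ip a b u v) = ip a b v u"
  unfolding ip_def set_lebesgue_integral_def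
  by (subst Bochner_Integration.integral_cnj[symmetric]) (simp add: mult.commute)

lemma frac_form_cnj: "cnj (frac_form a b \<alpha> u w) = frac_form a b \<alpha> w u"
  by (simp add: frac_form_def ip_cnj add.commute)

text \<open>
  Linearity in the first argument; linearity in the second follows from the Hermitian symmetry.
\<close>

lemma frac_form_linear:
  assumes u: "u \<in> poly_space a b N" and v: "v \<in> poly_space a b N" and w: "w \<in> poly_space a b N"
    and \<alpha>: "\<alpha> < 2"
  shows "frac_form a b \<alpha> (\<lambda>x. r *\<^sub>R u x + t *\<^sub>R v x) w =
    r *\<^sub>R frac_form a b \<alpha> u w + t *\<^sub>R frac_form a b \<alpha> v w"
proof -
  have \<mu>: "\<alpha> / 2 < 1" using \<alpha> by simp
  note int = RL_product_integrable[OF _ _ \<mu>]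
  have lin: "ip a b f g = r *\<^sub>R ip a b f1 g + t *\<^sub>R ip a b f2 g"
    if "\<And>x. x \<in> {a<..<b} \<Longrightarrow> f x = r *\<^sub>R f1 x + t *\<^sub>R f2 x"
      "set_integrable lebesgue {a<..<b} (\<lambda>x. f1 x * cnj (g x))"
      "set_integrable lebesgue {a<..<b} (\<lambda>x. f2 x * cnj (g x))" for f f1 f2 g
  proof -
    have "ip a b f g = (LINT x:{a<..<b}|lebesgue. r *\<^sub>R (f1 x * cnj (g x)) + t *\<^sub>R (f2 x * cnj (g x)))"
      unfolding ip_def by (rule set_lebesgue_integral_cong) (auto simp: that(1) distrib_right)
    also have "\<dots> = r *\<^sub>R ip a b f1 g + t *\<^sub>R ip a b f2 g"
      unfolding ip_def using that(2,3) by (subst set_integral_add) auto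
    finally show ?thesis .
  qed
  have "ip a b (RL_left a (\<alpha> / 2) (\<lambda>x. r *\<^sub>R u x + t *\<^sub>R v x)) (RL_right b (\<alpha> / 2) w) =
      r *\<^sub>R ip a b (RL_left a (\<alpha> / 2) u) (RL_right b (\<alpha> / 2) w) +
      t *\<^sub>R ip a b (RL_left a (\<alpha> / 2) v) (RL_right b (\<alpha> / 2) w)"
    by (rule lin) (use int u v w RL_left_linear[OF u v \<mu>] in auto)
  moreover have "ip a b (RL_right b (\<alpha> / 2) (\<lambda>x. r *\<^sub>R u x + t *\<^sub>R v x)) (RL_left a (\<alpha> / 2) w) =
      r *\<^sub>R ip a b (RL_right b (\<alpha> / 2) u) (RL_left a (\<alpha> / 2) w) +
      t *\<^sub>R ip a b (RL_right b (\<alpha> / 2) v) (RL_left a (\<alpha> / 2) w)"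
    by (rule lin) (use int u v w RL_right_linear[OF u v \<mu>] in auto)
  ultimately show ?thesis
    by (simp add: frac_form_def scaleR_conv_of_real algebra_simps)
qed

section \<open>Linear structure and reflection of \<open>H\<^sub>0\<^sup>\<mu>(\<Omega>)\<close>\<close>

text \<open>
  The extended integral does not change under completion, whatever the integrand. Over the Borel
  measure, Tonelli and substitution apply to Borel functions without further measurability concerns.
\<close>

lemma Hs_norm_sq_lborel:
  "Hs_norm_sq a b \<mu> u =
     (\<integral>\<^sup>+x\<in>{a<..<b}. ennreal ((cmod (u x))\<^sup>2) \<partial>lborel) +
     (\<integral>\<^sup>+x\<in>{a<..<b}. (\<integral>\<^sup>+y\<in>{a<..<b}.
        ennreal ((cmod (u x - u y))\<^sup>2 / \<bar>x - y\<bar> powr (1 + 2 * \<mu>)) \<partial>lborel) \<partial>lborel)"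
  by (simp add: Hs_norm_sq_def nn_integral_completion)

text \<open>
  This allows a function that is polynomial on \<open>\<Omega>\<close> to be replaced by the polynomial itself, which
  is Borel measurable on the whole line.
\<close>

lemma Hs_norm_sq_cong:
  assumes "\<And>x. x \<in> {a<..<b} \<Longrightarrow> u x = v x"
  shows "Hs_norm_sq a b \<mu> u = Hs_norm_sq a b \<mu> v"
proof -
  have inner: "(\<integral>\<^sup>+y\<in>{a<..<b}. ennreal ((cmod (u x - u y))\<^sup>2 / \<bar>x - y\<bar> powr (1 + 2 * \<mu>)) \<partial>lborel) =
      (\<integral>\<^sup>+y\<in>{a<..<b}. ennreal ((cmod (v x - v y))\<^sup>2 / \<bar>x - y\<bar> powr (1 + 2 * \<mu>)) \<partial>lborel)"
    if "x \<in> {a<..<b}" for x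
    by (intro nn_integral_cong) (use assms that in \<open>auto simp: indicator_def\<close>)
  have "(\<integral>\<^sup>+x\<in>{a<..<b}. (\<integral>\<^sup>+y\<in>{a<..<b}. ennreal ((cmod (u x - u y))\<^sup>2 / \<bar>x - y\<bar> powr (1 + 2 * \<mu>)) \<partial>lborel) \<partial>lborel) =
      (\<integral>\<^sup>+x\<in>{a<..<b}. (\<integral>\<^sup>+y\<in>{a<..<b}. ennreal ((cmod (v x - v y))\<^sup>2 / \<bar>x - y\<bar> powr (1 + 2 * \<mu>)) \<partial>lborel) \<partial>lborel)"
    using inner by (intro nn_integral_cong) (simp add: indicator_def)
  moreover have "(\<integral>\<^sup>+x\<in>{a<..<b}. ennreal ((cmod (u x))\<^sup>2) \<partial>lborel) = (\<integral>\<^sup>+x\<in>{a<..<b}. ennreal ((cmod (v x))\<^sup>2) \<partial>lborel)"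
    by (intro nn_integral_cong) (use assms in \<open>auto simp: indicator_def\<close>)
  ultimately show ?thesis by (simp add: Hs_norm_sq_lborel)
qed

lemma norm_linear_sq_le:
  fixes u v :: complex
  shows "(cmod (r *\<^sub>R u + t *\<^sub>R v))\<^sup>2 \<le> 2 * r\<^sup>2 * (cmod u)\<^sup>2 + 2 * t\<^sup>2 * (cmod v)\<^sup>2"
proof -
  have "(cmod (r *\<^sub>R u + t *\<^sub>R v))\<^sup>2 \<le> (\<bar>r\<bar> * cmod u + \<bar>t\<bar> * cmod v)\<^sup>2"
    by (intro power_mono order_trans[OF norm_triangle_ineq]) auto
  also have "\<dots> \<le> 2 * (\<bar>r\<bar> * cmod u)\<^sup>2 + 2 * (\<bar>t\<bar> * cmod v)\<^sup>2"
    using sum_squares_bound[of "\<bar>r\<bar> * cmod u" "\<bar>t\<bar> * cmod v"] by (simp add: power2_sum)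
  finally show ?thesis by (simp add: power_mult_distrib)
qed

lemma Hs_norm_sq_linear_le:
  assumes [measurable]: "u \<in> borel_measurable borel" "v \<in> borel_measurable borel"
  shows "Hs_norm_sq a b \<mu> (\<lambda>x. r *\<^sub>R u x + t *\<^sub>R v x) \<le>
    ennreal (2 * r\<^sup>2) * Hs_norm_sq a b \<mu> u + ennreal (2 * t\<^sup>2) * Hs_norm_sq a b \<mu> v"
proof -
  let ?I = "\<lambda>f. \<integral>\<^sup>+x\<in>{a<..<b}. ennreal ((cmod (f x))\<^sup>2) \<partial>lborel"
  let ?k = "\<lambda>f x y. ennreal ((cmod (f x - f y))\<^sup>2 / \<bar>x - y\<bar> powr (1 + 2 * \<mu>))"
  let ?J = "\<lambda>f. \<integral>\<^sup>+x\<in>{a<..<b}. (\<integral>\<^sup>+y\<in>{a<..<b}. ?k f x y \<partial>lborel) \<partial>lborel"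
  let ?w = "\<lambda>x. r *\<^sub>R u x + t *\<^sub>R v x"
  let ?r = "ennreal (2 * r\<^sup>2)" and ?t = "ennreal (2 * t\<^sup>2)"
  have split: "ennreal X * i \<le> ?r * (ennreal Y * i) + ?t * (ennreal Z * i)"
    if "X \<le> 2 * r\<^sup>2 * Y + 2 * t\<^sup>2 * Z" "Y \<ge> 0" "Z \<ge> 0" for X Y Z and i :: ennreal
  proof -
    have "ennreal X \<le> ennreal (2 * r\<^sup>2 * Y + 2 * t\<^sup>2 * Z)" using that(1) by (rule ennreal_leI)
    also have "\<dots> = ?r * ennreal Y + ?t * ennreal Z"
      using that(2,3) by (simp add: ennreal_mult)
    finally have "ennreal X * i \<le> (?r * ennreal Y + ?t * ennreal Z) * i" by (rule mult_right_mono) simp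
    then show ?thesis by (simp add: distrib_right mult.assoc)
  qed
  have "?I ?w \<le> (\<integral>\<^sup>+x. ?r * (ennreal ((cmod (u x))\<^sup>2) * indicator {a<..<b} x) +
      ?t * (ennreal ((cmod (v x))\<^sup>2) * indicator {a<..<b} x) \<partial>lborel)"
    by (intro nn_integral_mono split norm_linear_sq_le) auto
  also have "\<dots> = ?r * ?I u + ?t * ?I v"
    by (simp add: nn_integral_add nn_integral_cmult)
  finally have I: "?I ?w \<le> ?r * ?I u + ?t * ?I v" .
  have k: "?k ?w x y * i \<le> ?r * (?k u x y * i) + ?t * (?k v x y * i)" for x y and i :: ennreal
  proof (rule split)
    have "(cmod (?w x - ?w y))\<^sup>2 \<le> 2 * r\<^sup>2 * (cmod (u x - u y))\<^sup>2 + 2 * t\<^sup>2 * (cmod (v x - v y))\<^sup>2"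
      using norm_linear_sq_le[of r "u x - u y" t "v x - v y"] by (simp add: algebra_simps)
    then show "(cmod (?w x - ?w y))\<^sup>2 / \<bar>x - y\<bar> powr (1 + 2 * \<mu>) \<le>
      2 * r\<^sup>2 * ((cmod (u x - u y))\<^sup>2 / \<bar>x - y\<bar> powr (1 + 2 * \<mu>)) +
      2 * t\<^sup>2 * ((cmod (v x - v y))\<^sup>2 / \<bar>x - y\<bar> powr (1 + 2 * \<mu>))"
      by (simp add: divide_right_mono flip: add_divide_distrib)
  qed auto
  have inner: "(\<integral>\<^sup>+y\<in>{a<..<b}. ?k ?w x y \<partial>lborel) \<le>
      ?r * (\<integral>\<^sup>+y\<in>{a<..<b}. ?k u x y \<partial>lborel) + ?t * (\<integral>\<^sup>+y\<in>{a<..<b}. ?k v x y \<partial>lborel)" for x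
  proof -
    have "(\<integral>\<^sup>+y\<in>{a<..<b}. ?k ?w x y \<partial>lborel) \<le> (\<integral>\<^sup>+y. ?r * (?k u x y * indicator {a<..<b} y) +
        ?t * (?k v x y * indicator {a<..<b} y) \<partial>lborel)"
      by (intro nn_integral_mono k)
    also have "\<dots> = ?r * (\<integral>\<^sup>+y\<in>{a<..<b}. ?k u x y \<partial>lborel) + ?t * (\<integral>\<^sup>+y\<in>{a<..<b}. ?k v x y \<partial>lborel)"
      by (simp add: nn_integral_add nn_integral_cmult)
    finally show ?thesis .
  qed
  have "?J ?w \<le> (\<integral>\<^sup>+x. ?r * ((\<integral>\<^sup>+y\<in>{a<..<b}. ?k u x y \<partial>lborel) * indicator {a<..<b} x) +
     ?t * ((\<integral>\<^sup>+y\<in>{a<..<b}. ?k v x y \<partial>lborel) * indicator {a<..<b} x) \<partial>lborel)"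
    using mult_right_mono[OF inner] by (intro nn_integral_mono) (simp add: distrib_right mult.assoc)
  also have "\<dots> = ?r * ?J u + ?t * ?J v"
    by (simp add: nn_integral_add nn_integral_cmult)
  finally have J: "?J ?w \<le> ?r * ?J u + ?t * ?J v" .
  show ?thesis
    unfolding Hs_norm_sq_lborel using add_mono[OF I J] by (simp add: distrib_left ac_simps)
qed

lemma Hs_norm_sq_reflect:
  assumes [measurable]: "u \<in> borel_measurable borel"
  shows "Hs_norm_sq (- b) (- a) \<mu> (\<lambda>x. u (- x)) = Hs_norm_sq a b \<mu> u"
proof -
  have refl: "(\<integral>\<^sup>+x. F x \<partial>lborel) = (\<integral>\<^sup>+x. F (- x) \<partial>lborel)"
    if "F \<in> borel_measurable borel" for F :: "real \<Rightarrow> ennreal"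
    using nn_integral_real_affine[OF that, of "-1" 0] by simp
  have ind: "indicator {- b<..<- a} (- x) = (indicator {a<..<b} x :: ennreal)" for x :: real
    by (auto simp: indicator_def)
  let ?k = "\<lambda>x y. ennreal ((cmod (u (- x) - u (- y)))\<^sup>2 / \<bar>x - y\<bar> powr (1 + 2 * \<mu>))"
  have inner: "(\<integral>\<^sup>+y\<in>{- b<..<- a}. ?k (- x) y \<partial>lborel) =
      (\<integral>\<^sup>+y\<in>{a<..<b}. ennreal ((cmod (u x - u y))\<^sup>2 / \<bar>x - y\<bar> powr (1 + 2 * \<mu>)) \<partial>lborel)" for x
    by (subst refl) (simp_all add: ind abs_minus_commute)
  have "(\<integral>\<^sup>+x\<in>{- b<..<- a}. (\<integral>\<^sup>+y\<in>{- b<..<- a}. ?k x y \<partial>lborel) \<partial>lborel) =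
     (\<integral>\<^sup>+x\<in>{a<..<b}. (\<integral>\<^sup>+y\<in>{- b<..<- a}. ?k (- x) y \<partial>lborel) \<partial>lborel)"
    by (subst refl) (simp_all add: ind)
  moreover have "(\<integral>\<^sup>+x\<in>{- b<..<- a}. ennreal ((cmod (u (- x)))\<^sup>2) \<partial>lborel) =
     (\<integral>\<^sup>+x\<in>{a<..<b}. ennreal ((cmod (u x))\<^sup>2) \<partial>lborel)"
    by (subst refl) (simp_all add: ind)
  ultimately show ?thesis
    unfolding Hs_norm_sq_lborel by (simp only: inner)
qed

lemma test_functions_continuous:
  assumes "\<phi> \<in> test_functions a b"
  shows "continuous_on UNIV \<phi>"
proof -
  from assms obtain D where "D (0::nat) = \<phi>" "\<And>k x. (D k has_vector_derivative D (Suc k) x) (at x)"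
    by (auto simp: test_functions_def smooth_on_def)
  then show ?thesis
    by (metis has_vector_derivative_continuous continuous_at_imp_continuous_on)
qed

lemma test_functions_linear:
  assumes "\<phi> \<in> test_functions a b" "\<psi> \<in> test_functions a b"
  shows "(\<lambda>x. r *\<^sub>R \<phi> x + t *\<^sub>R \<psi> x) \<in> test_functions a b"
proof -
  obtain D E K L where D: "D (0::nat) = \<phi>" "\<And>k x. (D k has_vector_derivative D (Suc k) x) (at x)"
    and E: "E (0::nat) = \<psi>" "\<And>k x. (E k has_vector_derivative E (Suc k) x) (at x)"
    and K: "compact K" "K \<subseteq> {a<..<b}" "\<And>x. x \<notin> K \<Longrightarrow> \<phi> x = 0"
    and L: "compact L" "L \<subseteq> {a<..<b}" "\<And>x. x \<notin> L \<Longrightarrow> \<psi> x = 0"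
    using assms by (auto simp: test_functions_def smooth_on_def)
  have "smooth_on UNIV (\<lambda>x. r *\<^sub>R \<phi> x + t *\<^sub>R \<psi> x)"
    unfolding smooth_on_def
  proof (intro exI[of _ "\<lambda>k x. r *\<^sub>R D k x + t *\<^sub>R E k x"] conjI allI ballI)
    show "((\<lambda>x. r *\<^sub>R D k x + t *\<^sub>R E k x) has_vector_derivative r *\<^sub>R D (Suc k) x + t *\<^sub>R E (Suc k) x) (at x)"
      for k x
      by (intro has_vector_derivative_add bounded_linear.has_vector_derivative[OF bounded_linear_scaleR_right] D E)
  qed (simp add: D E)
  moreover have "\<exists>K. compact K \<and> K \<subseteq> {a<..<b} \<and> (\<forall>x. x \<notin> K \<longrightarrow> r *\<^sub>R \<phi> x + t *\<^sub>R \<psi> x = 0)"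
    by (rule exI[of _ "K \<union> L"]) (use K L in auto)
  ultimately show ?thesis by (simp add: test_functions_def)
qed

lemma test_functions_reflect:
  assumes "\<phi> \<in> test_functions a b"
  shows "(\<lambda>x. \<phi> (- x)) \<in> test_functions (- b) (- a)"
proof -
  obtain D K where D: "D (0::nat) = \<phi>" "\<And>k x. (D k has_vector_derivative D (Suc k) x) (at x)"
    and K: "compact K" "K \<subseteq> {a<..<b}" "\<And>x. x \<notin> K \<Longrightarrow> \<phi> x = 0"
    using assms by (auto simp: test_functions_def smooth_on_def)
  have "smooth_on UNIV (\<lambda>x. \<phi> (- x))"
    unfolding smooth_on_def
  proof (intro exI[of _ "\<lambda>k x. (- 1) ^ k *\<^sub>R D k (- x)"] conjI allI ballI)
    fix k x
    have "((D k \<circ> uminus) has_vector_derivative (- 1) *\<^sub>R D (Suc k) (- x)) (at x)"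
      by (rule vector_diff_chain_at) (use D in \<open>auto intro!: derivative_eq_intros\<close>)
    from bounded_linear.has_vector_derivative[OF bounded_linear_scaleR_right this, of "(- 1) ^ k"]
    show "((\<lambda>x. (- 1) ^ k *\<^sub>R D k (- x)) has_vector_derivative (- 1) ^ Suc k *\<^sub>R D (Suc k) (- x)) (at x)"
      by (simp add: o_def)
  qed (simp add: D)
  moreover have "\<exists>K. compact K \<and> K \<subseteq> {- b<..<- a} \<and> (\<forall>x. x \<notin> K \<longrightarrow> \<phi> (- x) = 0)"
    by (rule exI[of _ "uminus ` K"])
      (use K in \<open>auto intro!: compact_continuous_image continuous_intros simp: image_iff, metis minus_minus\<close>)
  ultimately show ?thesis by (simp add: test_functions_def)
qed

text \<open>
  The scheme is tested with averages and difference quotients of discrete solutions, so these have to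
  be in the test space.
\<close>

lemma XN0_linear:
  assumes u: "u \<in> XN0 a b \<alpha> N" and v: "v \<in> XN0 a b \<alpha> N"
  shows "(\<lambda>x. r *\<^sub>R u x + t *\<^sub>R v x) \<in> XN0 a b \<alpha> N"
proof -
  let ?\<mu> = "\<alpha> / 2"
  have ps: "u \<in> poly_space a b N" "v \<in> poly_space a b N" using u v by (auto simp: XN0_def)
  then obtain p q where p: "\<And>x. x \<in> {a<..<b} \<Longrightarrow> u x = poly p (complex_of_real x)"
    and q: "\<And>x. x \<in> {a<..<b} \<Longrightarrow> v x = poly q (complex_of_real x)"
    by (auto simp: poly_space_def)
  define k where "k = 2 * r\<^sup>2 + 2 * t\<^sup>2"
  have k: "k \<ge> 0" by (simp add: k_def)
  have uH: "u \<in> Hs0 a b ?\<mu>" and vH: "v \<in> Hs0 a b ?\<mu>" using u v by (auto simp: XN0_def)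
  have bound: "Hs_norm_sq a b ?\<mu> (\<lambda>x. (r *\<^sub>R u x + t *\<^sub>R v x) - (r *\<^sub>R \<phi> x + t *\<^sub>R \<psi> x)) \<le>
      ennreal (2 * r\<^sup>2) * Hs_norm_sq a b ?\<mu> (\<lambda>x. u x - \<phi> x) + ennreal (2 * t\<^sup>2) * Hs_norm_sq a b ?\<mu> (\<lambda>x. v x - \<psi> x)"
    if "continuous_on UNIV \<phi>" "continuous_on UNIV \<psi>" for \<phi> \<psi>
  proof -
    let ?f = "\<lambda>x. poly p (complex_of_real x) - \<phi> x" and ?g = "\<lambda>x. poly q (complex_of_real x) - \<psi> x"
    have [measurable]: "?f \<in> borel_measurable borel" "?g \<in> borel_measurable borel"
      by (auto intro!: borel_measurable_continuous_onI continuous_intros that)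
    have "Hs_norm_sq a b ?\<mu> (\<lambda>x. (r *\<^sub>R u x + t *\<^sub>R v x) - (r *\<^sub>R \<phi> x + t *\<^sub>R \<psi> x)) =
        Hs_norm_sq a b ?\<mu> (\<lambda>x. r *\<^sub>R ?f x + t *\<^sub>R ?g x)"
      by (rule Hs_norm_sq_cong) (simp add: p q scaleR_right_diff_distrib)
    moreover have "Hs_norm_sq a b ?\<mu> (\<lambda>x. u x - \<phi> x) = Hs_norm_sq a b ?\<mu> ?f"
      by (rule Hs_norm_sq_cong) (simp add: p)
    moreover have "Hs_norm_sq a b ?\<mu> (\<lambda>x. v x - \<psi> x) = Hs_norm_sq a b ?\<mu> ?g"
      by (rule Hs_norm_sq_cong) (simp add: q)
    moreover have "Hs_norm_sq a b ?\<mu> (\<lambda>x. r *\<^sub>R ?f x + t *\<^sub>R ?g x) \<le>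
        ennreal (2 * r\<^sup>2) * Hs_norm_sq a b ?\<mu> ?f + ennreal (2 * t\<^sup>2) * Hs_norm_sq a b ?\<mu> ?g"
      by (rule Hs_norm_sq_linear_le) measurable
    ultimately show ?thesis by simp
  qed
  have "Hs_norm_sq a b ?\<mu> (\<lambda>x. r *\<^sub>R u x + t *\<^sub>R v x) < \<infinity>"
  proof -
    have "Hs_norm_sq a b ?\<mu> u < \<infinity>" "Hs_norm_sq a b ?\<mu> v < \<infinity>"
      using uH vH by (auto simp: Hs0_def Hs_def)
    then have "ennreal (2 * r\<^sup>2) * Hs_norm_sq a b ?\<mu> u + ennreal (2 * t\<^sup>2) * Hs_norm_sq a b ?\<mu> v < \<infinity>"
      by (simp add: ennreal_mult_less_top)
    then show ?thesis using bound[of "\<lambda>_. 0" "\<lambda>_. 0"] by (auto intro: le_less_trans)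
  qed
  moreover have "set_borel_measurable lebesgue {a<..<b} (\<lambda>x. r *\<^sub>R u x + t *\<^sub>R v x)"
  proof -
    have [measurable]: "(\<lambda>x. indicator {a<..<b} x *\<^sub>R u x) \<in> borel_measurable lebesgue"
      "(\<lambda>x. indicator {a<..<b} x *\<^sub>R v x) \<in> borel_measurable lebesgue"
      using uH vH by (auto simp: Hs0_def Hs_def set_borel_measurable_def)
    have "(\<lambda>x. r *\<^sub>R (indicator {a<..<b} x *\<^sub>R u x) + t *\<^sub>R (indicator {a<..<b} x *\<^sub>R v x)) \<in> borel_measurable lebesgue"
      by measurable
    then show ?thesis by (simp add: set_borel_measurable_def scaleR_right_distrib mult.commute)
  qed
  moreover have "\<exists>\<phi>\<in>test_functions a b.
      Hs_norm_sq a b ?\<mu> (\<lambda>x. (r *\<^sub>R u x + t *\<^sub>R v x) - \<phi> x) < ennreal (\<epsilon>\<^sup>2)" if "\<epsilon> > 0" for \<epsilon>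
  proof -
    \<comment> \<open>With approximations of accuracy \<open>\<delta>\<close>, the linear combination has squared error at most
      \<open>k \<delta>\<^sup>2 < \<epsilon>\<^sup>2\<close>; the summand \<open>1\<close> covers \<open>k = 0\<close>.\<close>
    define \<delta> where "\<delta> = \<epsilon> / sqrt (k + 1)"
    have \<delta>: "\<delta> > 0" "k * \<delta>\<^sup>2 < \<epsilon>\<^sup>2"
      using that k by (auto simp: \<delta>_def power_divide field_simps)
    obtain \<phi> where \<phi>: "\<phi> \<in> test_functions a b" "Hs_norm_sq a b ?\<mu> (\<lambda>x. u x - \<phi> x) < ennreal (\<delta>\<^sup>2)"
      using uH \<delta>(1) unfolding Hs0_def by blast
    obtain \<psi> where \<psi>: "\<psi> \<in> test_functions a b" "Hs_norm_sq a b ?\<mu> (\<lambda>x. v x - \<psi> x) < ennreal (\<delta>\<^sup>2)"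
      using vH \<delta>(1) unfolding Hs0_def by blast
    have "Hs_norm_sq a b ?\<mu> (\<lambda>x. (r *\<^sub>R u x + t *\<^sub>R v x) - (r *\<^sub>R \<phi> x + t *\<^sub>R \<psi> x)) \<le>
      ennreal (2 * r\<^sup>2) * Hs_norm_sq a b ?\<mu> (\<lambda>x. u x - \<phi> x) + ennreal (2 * t\<^sup>2) * Hs_norm_sq a b ?\<mu> (\<lambda>x. v x - \<psi> x)"
      by (rule bound) (rule test_functions_continuous[OF \<phi>(1)] test_functions_continuous[OF \<psi>(1)])+
    also have "\<dots> \<le> ennreal (2 * r\<^sup>2) * ennreal (\<delta>\<^sup>2) + ennreal (2 * t\<^sup>2) * ennreal (\<delta>\<^sup>2)"
      using \<phi>(2) \<psi>(2) by (intro add_mono mult_left_mono) auto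
    also have "\<dots> = ennreal (k * \<delta>\<^sup>2)"
      by (simp add: k_def ennreal_mult'[symmetric] ennreal_plus[symmetric] distrib_right del: ennreal_plus)
    also have "\<dots> < ennreal (\<epsilon>\<^sup>2)" using \<delta> k by (intro ennreal_lessI) (use that in auto)
    finally show ?thesis
      by (intro bexI[of _ "\<lambda>x. r *\<^sub>R \<phi> x + t *\<^sub>R \<psi> x"] test_functions_linear \<phi>(1) \<psi>(1))
  qed
  ultimately show ?thesis
    using poly_space_linear[OF ps] by (auto simp: XN0_def Hs0_def Hs_def)
qed

section \<open>Boundary values in \<open>H\<^sub>0\<^sup>\<mu>(\<Omega>)\<close> for \<open>\<mu> > 1/2\<close>\<close>

text \<open>
  Integrating first in the second variable, over an interval of length \<open>x - a\<close>, cancels the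
  singularity. This function dominates everything in the trace identity.
\<close>

lemma triangle_integrable:
  fixes a b :: real
  assumes "a < b"
  shows "integrable (lborel \<Otimes>\<^sub>M lborel) (\<lambda>w. if a < snd w \<and> snd w < fst w \<and> fst w < b then 1 / (fst w - a) else 0)"
proof (rule integrableI_bounded)
  have "(\<integral>\<^sup>+ w. ennreal (norm (if a < snd w \<and> snd w < fst w \<and> fst w < b then 1 / (fst w - a) else 0)) \<partial>(lborel \<Otimes>\<^sub>M lborel)) =
    (\<integral>\<^sup>+ x. \<integral>\<^sup>+ y. ennreal (norm (if a < y \<and> y < x \<and> x < b then 1 / (x - a) else 0)) \<partial>lborel \<partial>lborel)"
    by (subst lborel.nn_integral_fst[symmetric]) (simp_all cong: if_cong)
  also have "\<dots> = (\<integral>\<^sup>+ x. indicator {a<..<b} x \<partial>lborel)"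
  proof (rule nn_integral_cong)
    fix x :: real
    show "(\<integral>\<^sup>+ y. ennreal (norm (if a < y \<and> y < x \<and> x < b then 1 / (x - a) else 0)) \<partial>lborel) = indicator {a<..<b} x"
    proof (cases "x \<in> {a<..<b}")
      case True
      have "(\<integral>\<^sup>+ y. ennreal (norm (if a < y \<and> y < x \<and> x < b then 1 / (x - a) else 0)) \<partial>lborel) =
          (\<integral>\<^sup>+ y. ennreal (1 / (x - a)) * indicator {a<..<x} y \<partial>lborel)"
        using True by (intro nn_integral_cong) auto
      also have "\<dots> = ennreal (1 / (x - a)) * ennreal (x - a)"
        using True by (subst nn_integral_cmult_indicator) auto
      also have "\<dots> = 1" using True by (simp add: ennreal_mult'[symmetric])
      finally show ?thesis using True by simp
    next
      case False
      then have "(\<integral>\<^sup>+ y. ennreal (norm (if a < y \<and> y < x \<and> x < b then 1 / (x - a) else 0)) \<partial>lborel) = (\<integral>\<^sup>+ (y::real). 0 \<partial>lborel)"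
        by (intro nn_integral_cong) auto
      then show ?thesis using False by simp
    qed
  qed
  also have "\<dots> < \<infinity>" using assms by simp
  finally show "(\<integral>\<^sup>+ w. ennreal (norm (if a < snd w \<and> snd w < fst w \<and> fst w < b then 1 / (fst w - a) else 0)) \<partial>(lborel \<Otimes>\<^sub>M lborel)) < \<infinity>" .
qed measurable

lemma has_bochner_integral_inverse_square:
  fixes a y b :: real
  assumes "a < y" "y < b"
  shows "has_bochner_integral lborel (\<lambda>x. indicator {y<..<b} x *\<^sub>R (1 / (x - a)\<^sup>2)) (1 / (y - a) - 1 / (b - a))"
proof -
  have "((\<lambda>x. 1 / (x - a)\<^sup>2) has_integral (- 1 / (b - a)) - (- 1 / (y - a))) {y..b}"
    using assms by (intro fundamental_theorem_of_calculus)
      (auto intro!: derivative_eq_intros simp: has_real_derivative_iff_has_vector_derivative[symmetric] power2_eq_square)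
  then have "has_bochner_integral lborel (\<lambda>x. indicator {y<..<b} x *\<^sub>R (1 / (x - a)\<^sup>2))
      ((- 1 / (b - a)) - (- 1 / (y - a)))"
    by (intro has_bochner_integral_lborel_nonneg) (auto simp: has_integral_Icc_iff_Ioo)
  then show ?thesis by simp
qed

text \<open>
  With \<open>\<psi>(x)\<close> the mean of \<open>g\<close> over \<open>(a, x)\<close>, the inner integral of \<open>f\<close> is \<open>\<psi>'(x)\<close>, so that the double
  integral is \<open>\<psi>(b) - \<psi>(a)\<close>, the mean of \<open>g\<close> minus its boundary value \<open>c\<close>. The proof avoids
  differentiation: \<open>f\<close> is split into the part with \<open>g(x) - c\<close>, integrated first in \<open>y\<close>, and the part
  with \<open>g(y) - c\<close>, integrated first in \<open>x\<close>. Both are integrable because \<open>g - c\<close> is of order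
  \<open>x - a\<close>. They leave the common term \<open>d1\<close>, the integrand \<open>(g(x) - c) / (x - a)\<close>, which cancels.
\<close>

lemma trace_identity:
  fixes g h :: "real \<Rightarrow> complex"
  assumes ab: "a < b" and [measurable]: "g \<in> borel_measurable borel"
    and g: "\<And>x. x \<in> {a<..<b} \<Longrightarrow> g x = c + (x - a) *\<^sub>R h x"
    and h: "\<And>x. x \<in> {a<..<b} \<Longrightarrow> norm (h x) \<le> M"
  defines "f \<equiv> \<lambda>w. if a < snd w \<and> snd w < fst w \<and> fst w < b then (g (fst w) - g (snd w)) /\<^sub>R (fst w - a)\<^sup>2 else 0"
  shows "integrable (lborel \<Otimes>\<^sub>M lborel) f"
    and "integrable lborel (\<lambda>x. indicator {a<..<b} x *\<^sub>R g x)"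
    and "(b - a) *\<^sub>R c = (LINT x|lborel. indicator {a<..<b} x *\<^sub>R g x) - (b - a) *\<^sub>R (LINT w|(lborel \<Otimes>\<^sub>M lborel). f w)"
proof -
  let ?M = "lborel \<Otimes>\<^sub>M lborel :: (real \<times> real) measure"
  let ?T = "\<lambda>w. a < snd w \<and> snd w < fst w \<and> fst w < (b :: real)"
  have "norm (h ((a + b) / 2)) \<le> M" by (rule h) (use ab in auto)
  then have M: "M \<ge> 0" using norm_ge_zero order_trans by blast
  have d: "norm (g x - c) \<le> (x - a) * M" if "x \<in> {a<..<b}" for x
    using g[OF that] h[OF that] that by (simp add: mult_left_mono)
  define f1 where "f1 w = (if ?T w then (g (fst w) - c) /\<^sub>R (fst w - a)\<^sup>2 else 0)" for w
  define f2 where "f2 w = (if ?T w then (g (snd w) - c) /\<^sub>R (fst w - a)\<^sup>2 else 0)" for w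
  have T: "integrable ?M (\<lambda>w. M * (if ?T w then 1 / (fst w - a) else 0))"
    using triangle_integrable[OF ab] by simp
  have bnd: "norm (z /\<^sub>R (x - a)\<^sup>2) \<le> M * (1 / (x - a))" if "norm z \<le> (x - a) * M" "a < x" for z :: complex and x
  proof -
    have "norm (z /\<^sub>R (x - a)\<^sup>2) = norm z / (x - a)\<^sup>2" by (simp add: divide_inverse mult.commute)
    also have "\<dots> \<le> (x - a) * M / (x - a)\<^sup>2" using that by (intro divide_right_mono) auto
    also have "\<dots> = M * (1 / (x - a))" using that by (simp add: power2_eq_square)
    finally show ?thesis .
  qed
  have [measurable]: "f1 \<in> borel_measurable ?M" "f2 \<in> borel_measurable ?M"
    unfolding f1_def f2_def by measurable
  have f1: "integrable ?M f1"
  proof (rule Bochner_Integration.integrable_bound[OF T])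
    show "AE w in ?M. norm (f1 w) \<le> norm (M * (if ?T w then 1 / (fst w - a) else 0))"
    proof (rule AE_I2)
      fix w :: "real \<times> real"
      show "norm (f1 w) \<le> norm (M * (if ?T w then 1 / (fst w - a) else 0))"
        using bnd[of "g (fst w) - c" "fst w"] d[of "fst w"] M by (auto simp: f1_def abs_mult)
    qed
  qed measurable
  have f2: "integrable ?M f2"
  proof (rule Bochner_Integration.integrable_bound[OF T])
    show "AE w in ?M. norm (f2 w) \<le> norm (M * (if ?T w then 1 / (fst w - a) else 0))"
    proof (rule AE_I2)
      fix w :: "real \<times> real"
      show "norm (f2 w) \<le> norm (M * (if ?T w then 1 / (fst w - a) else 0))"
      proof (cases "?T w")
        case True
        have "norm (g (snd w) - c) \<le> (snd w - a) * M" using True by (intro d) auto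
        also have "\<dots> \<le> (fst w - a) * M" using True M by (intro mult_right_mono) auto
        finally show ?thesis using bnd[of "g (snd w) - c" "fst w"] True M by (simp add: f2_def abs_mult)
      qed (auto simp: f2_def)
    qed
  qed measurable
  have f: "f = (\<lambda>w. f1 w - f2 w)"
    by (auto simp: f_def f1_def f2_def fun_eq_iff scaleR_right_diff_distrib)
  show "integrable ?M f" unfolding f using f1 f2 by (rule Bochner_Integration.integrable_diff)
  have c_int: "integrable lborel (\<lambda>x. indicator {a<..<b} x *\<^sub>R c)"
    by (intro integrable_scaleR_left) (simp add: ab less_imp_le)
  have d_int: "integrable lborel (\<lambda>x. indicator {a<..<b} x *\<^sub>R (g x - c))"
  proof (rule Bochner_Integration.integrable_bound[where f = "\<lambda>x. indicator {a<..<b} x *\<^sub>R ((b - a) * M)"])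
    show "AE x in lborel. norm (indicator {a<..<b} x *\<^sub>R (g x - c)) \<le> norm (indicat_real {a<..<b} x *\<^sub>R ((b - a) * M))"
    proof (rule AE_I2)
      fix x
      show "norm (indicator {a<..<b} x *\<^sub>R (g x - c)) \<le> norm (indicat_real {a<..<b} x *\<^sub>R ((b - a) * M))"
      proof (cases "x \<in> {a<..<b}")
        case True
        then have "(x - a) * M \<le> (b - a) * M" using M by (intro mult_right_mono) auto
        then show ?thesis using d[OF True] True M by auto
      qed simp
    qed
  qed (auto simp: ab less_imp_le)
  have gsplit: "(\<lambda>x. indicator {a<..<b} x *\<^sub>R g x) =
      (\<lambda>x. indicator {a<..<b} x *\<^sub>R (g x - c) + indicator {a<..<b} x *\<^sub>R c)"
    by (simp add: fun_eq_iff flip: scaleR_right_distrib)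
  show "integrable lborel (\<lambda>x. indicator {a<..<b} x *\<^sub>R g x)"
    unfolding gsplit by (intro Bochner_Integration.integrable_add d_int c_int)
  define d1 where "d1 x = indicator {a<..<b} x *\<^sub>R ((g x - c) /\<^sub>R (x - a))" for x
  have row: "(LINT y|lborel. f1 (x, y)) = d1 x" for x
  proof -
    have "(LINT y|lborel. f1 (x, y)) = (LINT y|lborel. indicator {a<..<x} y *\<^sub>R (indicator {a<..<b} x *\<^sub>R ((g x - c) /\<^sub>R (x - a)\<^sup>2)))"
      by (intro Bochner_Integration.integral_cong) (auto simp: f1_def indicator_def)
    also have "\<dots> = measure lborel {a<..<x} *\<^sub>R (indicator {a<..<b} x *\<^sub>R ((g x - c) /\<^sub>R (x - a)\<^sup>2))"
      by (cases "a < x") auto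
    also have "\<dots> = d1 x"
      by (cases "a < x") (auto simp: d1_def power2_eq_square indicator_def)
    finally show ?thesis .
  qed
  have col: "(LINT x|lborel. f2 (x, y)) = d1 y - (1 / (b - a)) *\<^sub>R (indicator {a<..<b} y *\<^sub>R (g y - c))" for y
  proof (cases "y \<in> {a<..<b}")
    case True
    have "(LINT x|lborel. f2 (x, y)) = (LINT x|lborel. (indicator {y<..<b} x *\<^sub>R (1 / (x - a)\<^sup>2)) *\<^sub>R (g y - c))"
      using True by (intro Bochner_Integration.integral_cong) (auto simp: f2_def indicator_def divide_inverse)
    also have "\<dots> = (1 / (y - a) - 1 / (b - a)) *\<^sub>R (g y - c)"
      using True by (intro has_bochner_integral_integral_eq has_bochner_integral_scaleR_left
        has_bochner_integral_inverse_square) auto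
    finally show ?thesis using True by (simp add: d1_def scaleR_left_diff_distrib divide_inverse)
  next
    case False
    then have "(LINT x|lborel. f2 (x, y)) = (LINT (x::real)|lborel. 0)"
      by (intro Bochner_Integration.integral_cong) (auto simp: f2_def)
    then show ?thesis using False by (simp add: d1_def)
  qed
  have I1: "(LINT w|?M. f1 w) = (LINT x|lborel. d1 x)"
    using lborel_pair.integral_fst'[OF f1] by (simp add: row)
  have f2': "integrable ?M (case_prod (\<lambda>x y. f2 (x, y)))" using f2 by simp
  have d1_int: "integrable lborel d1"
    using lborel_pair.integrable_fst'[OF f1] by (simp add: row)
  have I2: "(LINT w|?M. f2 w) = (LINT x|lborel. d1 x) - (1 / (b - a)) *\<^sub>R (LINT x|lborel. indicator {a<..<b} x *\<^sub>R (g x - c))"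
  proof -
    have int: "integrable lborel (\<lambda>x. (1 / (b - a)) *\<^sub>R (indicator {a<..<b} x *\<^sub>R (g x - c)))"
      by (intro integrable_scaleR_right d_int)
    have "(LINT w|?M. f2 w) = (LINT y|lborel. LINT x|lborel. f2 (x, y))"
      using lborel_pair.integral_snd[OF f2'] by simp
    also have "\<dots> = (LINT y|lborel. d1 y - (1 / (b - a)) *\<^sub>R (indicator {a<..<b} y *\<^sub>R (g y - c)))"
      by (simp only: col)
    finally show ?thesis
      unfolding Bochner_Integration.integral_diff[OF d1_int int] integral_scaleR_right .
  qed
  have "(LINT w|?M. f w) = (1 / (b - a)) *\<^sub>R (LINT x|lborel. indicator {a<..<b} x *\<^sub>R (g x - c))"
    unfolding f by (simp add: Bochner_Integration.integral_diff[OF f1 f2] I1 I2)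
  then have "(b - a) *\<^sub>R (LINT w|?M. f w) = (LINT x|lborel. indicator {a<..<b} x *\<^sub>R (g x - c))"
    using ab by simp
  moreover have "(LINT x|lborel. indicator {a<..<b} x *\<^sub>R g x) =
      (LINT x|lborel. indicator {a<..<b} x *\<^sub>R (g x - c)) + (b - a) *\<^sub>R c"
    unfolding gsplit using ab by (subst Bochner_Integration.integral_add[OF d_int c_int]) simp
  ultimately show "(b - a) *\<^sub>R c = (LINT x|lborel. indicator {a<..<b} x *\<^sub>R g x) - (b - a) *\<^sub>R (LINT w|?M. f w)"
    by simp
qed

text \<open>
  With \<open>P = t D powr (1 + 2\<mu>)\<close> and \<open>d = D\<close> this is \<open>X N \<le> X\<^sup>2 + N\<^sup>2\<close> for
  \<open>X = P / D\<^sup>2\<close>, divided by \<open>P\<close>; a smaller \<open>d\<close> only increases the right-hand side. For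
  \<open>N = |g(x) - g(y)|\<close>, \<open>d = x - y\<close> and \<open>D = x - a\<close> it separates the integrand of the Slobodeckij
  seminorm from a function that is integrable over the triangle since \<open>\<mu> > 1/2\<close>.
\<close>

lemma weighted_am_gm:
  fixes N d D t \<mu> :: real
  assumes t: "t > 0" and d: "0 < d" "d \<le> D" and \<mu>: "\<mu> > 1 / 2"
  shows "N / D\<^sup>2 \<le> t * D powr (2 * \<mu> - 3) + (1 / t) * (N\<^sup>2 / d powr (1 + 2 * \<mu>))"
proof -
  have D: "D > 0" using d by simp
  define P where "P = t * D powr (1 + 2 * \<mu>)"
  have P: "P > 0" using t D by (simp add: P_def)
  define X where "X = P / D\<^sup>2"
  have "0 \<le> (X - N / 2)\<^sup>2 + 3 / 4 * N\<^sup>2" by simp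
  also have "\<dots> = X\<^sup>2 + N\<^sup>2 - X * N" by (simp add: power2_eq_square algebra_simps)
  finally have "X * N / P \<le> (X\<^sup>2 + N\<^sup>2) / P" using P by (intro divide_right_mono) auto
  moreover have "X * N / P = N / D\<^sup>2" using P by (simp add: X_def)
  moreover have "(X\<^sup>2 + N\<^sup>2) / P = P / (D\<^sup>2)\<^sup>2 + N\<^sup>2 / P"
    using P by (simp add: X_def add_divide_distrib power2_eq_square)
  ultimately have "N / D\<^sup>2 \<le> P / (D\<^sup>2)\<^sup>2 + N\<^sup>2 / P" by simp
  also have "P / (D\<^sup>2)\<^sup>2 = t * D powr (2 * \<mu> - 3)"
  proof -
    have "D powr (1 + 2 * \<mu>) = D powr (2 * \<mu> - 3) * D powr real 4"
      unfolding powr_add[symmetric] by simp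
    also have "D powr real 4 = (D\<^sup>2)\<^sup>2" using D by (subst powr_realpow) auto
    finally show ?thesis using D by (simp add: P_def)
  qed
  also have "N\<^sup>2 / P \<le> (1 / t) * (N\<^sup>2 / d powr (1 + 2 * \<mu>))"
  proof -
    have "d powr (1 + 2 * \<mu>) \<le> D powr (1 + 2 * \<mu>)" using d \<mu> by (intro powr_mono2) auto
    then have "N\<^sup>2 / D powr (1 + 2 * \<mu>) \<le> N\<^sup>2 / d powr (1 + 2 * \<mu>)"
      using d by (intro divide_left_mono) auto
    then have "(1 / t) * (N\<^sup>2 / D powr (1 + 2 * \<mu>)) \<le> (1 / t) * (N\<^sup>2 / d powr (1 + 2 * \<mu>))"
      using t by (intro mult_left_mono) auto
    then show ?thesis by (simp add: P_def)
  qed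
  finally show ?thesis by simp
qed

text \<open>
  The parameter \<open>t\<close> replaces the Cauchy-Schwarz inequality: optimizing over \<open>t\<close> would bound \<open>|c|\<close> by
  a multiple of the Sobolev norm. The boundedness of \<open>h\<close> makes the double integral in the trace
  identity converge, while the constant \<open>K\<close> is the same for all \<open>g\<close>, so that the bound can be used
  along an approximating sequence.
\<close>

lemma trace_bound:
  fixes g h :: "real \<Rightarrow> complex"
  assumes ab: "a < b" and \<mu>: "1 / 2 < \<mu>" and t: "t > 0"
    and [measurable]: "g \<in> borel_measurable borel"
    and g: "\<And>x. x \<in> {a<..<b} \<Longrightarrow> g x = c + (x - a) *\<^sub>R h x"
    and h: "\<And>x. x \<in> {a<..<b} \<Longrightarrow> norm (h x) \<le> M"
  defines "K \<equiv> (b - a) + (b - a) * ((b - a) powr (2 * \<mu> - 1) / (2 * \<mu> - 1))"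
  shows "ennreal ((b - a) * norm c) \<le> ennreal (t * K) + ennreal ((1 + (b - a)) / t) * Hs_norm_sq a b \<mu> g"
proof -
  let ?M = "lborel \<Otimes>\<^sub>M lborel :: (real \<times> real) measure"
  let ?L = "b - a"
  let ?C = "?L powr (2 * \<mu> - 1) / (2 * \<mu> - 1)"
  let ?I = "\<integral>\<^sup>+x\<in>{a<..<b}. ennreal ((cmod (g x))\<^sup>2) \<partial>lborel"
  let ?k = "\<lambda>x y. ennreal ((cmod (g x - g y))\<^sup>2 / \<bar>x - y\<bar> powr (1 + 2 * \<mu>))"
  let ?J = "\<integral>\<^sup>+x\<in>{a<..<b}. (\<integral>\<^sup>+y\<in>{a<..<b}. ?k x y \<partial>lborel) \<partial>lborel"
  define f where "f = (\<lambda>w. if a < snd w \<and> snd w < fst w \<and> fst w < b then (g (fst w) - g (snd w)) /\<^sub>R (fst w - a)\<^sup>2 else 0)"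
  note trace_id = trace_identity[OF ab _ g h, folded f_def]
  have C: "?C \<ge> 0" using \<mu> by simp
  have f: "integrable ?M f" by (rule trace_id(1)) simp_all
  have gi: "integrable lborel (\<lambda>x. indicator {a<..<b} x *\<^sub>R g x)" by (rule trace_id(2)) simp_all
  have eq: "?L *\<^sub>R c = (LINT x|lborel. indicator {a<..<b} x *\<^sub>R g x) - ?L *\<^sub>R (LINT w|?M. f w)"
    by (rule trace_id(3)) simp_all
  have G: "ennreal (norm (LINT x|lborel. indicator {a<..<b} x *\<^sub>R g x)) \<le> ennreal (t * ?L) + ennreal (1 / t) * ?I"
  proof -
    have "ennreal (norm (LINT x|lborel. indicator {a<..<b} x *\<^sub>R g x)) \<le>
        (\<integral>\<^sup>+x. ennreal (norm (indicator {a<..<b} x *\<^sub>R g x)) \<partial>lborel)"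
      by (rule integral_norm_bound_ennreal[OF gi])
    also have "\<dots> \<le> (\<integral>\<^sup>+x. ennreal t * indicator {a<..<b} x +
        ennreal (1 / t) * (ennreal ((cmod (g x))\<^sup>2) * indicator {a<..<b} x) \<partial>lborel)"
    proof (rule nn_integral_mono)
      fix x
      have "cmod (g x) \<le> t + (1 / t) * (cmod (g x))\<^sup>2"
        using weighted_am_gm[OF t, of 1 1 1 "cmod (g x)"] by simp
      then have "ennreal (cmod (g x)) \<le> ennreal t + ennreal (1 / t) * ennreal ((cmod (g x))\<^sup>2)"
        using t by (simp add: ennreal_mult'[symmetric] ennreal_plus[symmetric] del: ennreal_plus)
      then show "ennreal (norm (indicator {a<..<b} x *\<^sub>R g x)) \<le> ennreal t * indicator {a<..<b} x +
        ennreal (1 / t) * (ennreal ((cmod (g x))\<^sup>2) * indicator {a<..<b} x)"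
        by (simp add: indicator_def)
    qed
    also have "\<dots> = ennreal t * ennreal ?L + ennreal (1 / t) * ?I"
      using ab by (simp add: nn_integral_add nn_integral_cmult)
    also have "ennreal t * ennreal ?L = ennreal (t * ?L)"
      using t by (simp add: ennreal_mult'[symmetric])
    finally show ?thesis .
  qed
  have F: "ennreal (norm (LINT w|?M. f w)) \<le> ennreal (t * ?C) + ennreal (1 / t) * ?J"
  proof -
    let ?T = "\<lambda>x y. ennreal (t * (x - a) powr (2 * \<mu> - 3)) * (if a < y \<and> y < x \<and> x < b then 1 else 0)"
    have "ennreal (norm (LINT w|?M. f w)) \<le> (\<integral>\<^sup>+w. ennreal (norm (f w)) \<partial>?M)"
      by (rule integral_norm_bound_ennreal[OF f])
    also have "\<dots> = (\<integral>\<^sup>+x. \<integral>\<^sup>+y. ennreal (norm (f (x, y))) \<partial>lborel \<partial>lborel)"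
      using f by (subst lborel.nn_integral_fst[symmetric]) simp_all
    also have "\<dots> \<le> (\<integral>\<^sup>+x. \<integral>\<^sup>+y. ?T x y +
        ennreal (1 / t) * (?k x y * indicator {a<..<b} y * indicator {a<..<b} x) \<partial>lborel \<partial>lborel)"
    proof (intro nn_integral_mono)
      fix x y :: real
      show "ennreal (norm (f (x, y))) \<le> ?T x y + ennreal (1 / t) * (?k x y * indicator {a<..<b} y * indicator {a<..<b} x)"
      proof (cases "a < y \<and> y < x \<and> x < b")
        case True
        have "norm (f (x, y)) = cmod (g x - g y) / (x - a)\<^sup>2"
          using True by (simp add: f_def divide_inverse mult.commute)
        also have "\<dots> \<le> t * (x - a) powr (2 * \<mu> - 3) + (1 / t) * ((cmod (g x - g y))\<^sup>2 / \<bar>x - y\<bar> powr (1 + 2 * \<mu>))"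
          using True weighted_am_gm[OF t _ _ \<mu>, of "\<bar>x - y\<bar>" "x - a" "cmod (g x - g y)"] by simp
        finally have "ennreal (norm (f (x, y))) \<le> ennreal (t * (x - a) powr (2 * \<mu> - 3)) + ennreal (1 / t) * ?k x y"
          using t by (simp add: ennreal_mult'[symmetric] ennreal_plus[symmetric] del: ennreal_plus)
        then show ?thesis using True by simp
      qed (auto simp: f_def)
    qed
    also have "\<dots> = (\<integral>\<^sup>+x. (\<integral>\<^sup>+y. ?T x y \<partial>lborel) +
        ennreal (1 / t) * ((\<integral>\<^sup>+y\<in>{a<..<b}. ?k x y \<partial>lborel) * indicator {a<..<b} x) \<partial>lborel)"
      by (simp add: nn_integral_add nn_integral_cmult nn_integral_multc)
    also have "\<dots> = (\<integral>\<^sup>+x. (\<integral>\<^sup>+y. ?T x y \<partial>lborel) \<partial>lborel) + ennreal (1 / t) * ?J"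
      by (simp add: nn_integral_add nn_integral_cmult)
    also have "(\<integral>\<^sup>+x. (\<integral>\<^sup>+y. ?T x y \<partial>lborel) \<partial>lborel) =
        (\<integral>\<^sup>+x. ennreal t * ennreal (indicator {a<..<b} x *\<^sub>R (x - a) powr (2 * \<mu> - 2)) \<partial>lborel)"
    proof (rule nn_integral_cong)
      fix x :: real
      show "(\<integral>\<^sup>+y. ?T x y \<partial>lborel) = ennreal t * ennreal (indicator {a<..<b} x *\<^sub>R (x - a) powr (2 * \<mu> - 2))"
      proof (cases "x \<in> {a<..<b}")
        case True
        have "(\<integral>\<^sup>+y. ?T x y \<partial>lborel) =
            (\<integral>\<^sup>+y. ennreal (t * (x - a) powr (2 * \<mu> - 3)) * indicator {a<..<x} y \<partial>lborel)"
          using True by (intro nn_integral_cong) (auto simp: indicator_def)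
        also have "\<dots> = ennreal (t * (x - a) powr (2 * \<mu> - 3)) * ennreal (x - a)"
          using True by (subst nn_integral_cmult_indicator) auto
        also have "\<dots> = ennreal (t * (x - a) powr (2 * \<mu> - 2))"
          using True t powr_add[of "x - a" "2 * \<mu> - 3" 1] by (simp add: ennreal_mult'[symmetric] mult.assoc)
        finally show ?thesis using True t by (simp add: ennreal_mult'[symmetric])
      next
        case False
        then have "(\<integral>\<^sup>+y. ?T x y \<partial>lborel) = (\<integral>\<^sup>+(y::real). 0 \<partial>lborel)"
          by (intro nn_integral_cong) auto
        then show ?thesis using False by simp
      qed
    qed
    also have "\<dots> = ennreal t * (\<integral>\<^sup>+x. ennreal (indicator {a<..<b} x *\<^sub>R (x - a) powr (2 * \<mu> - 2)) \<partial>lborel)"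
      by (rule nn_integral_cmult) simp
    also have "(\<integral>\<^sup>+x. ennreal (indicator {a<..<b} x *\<^sub>R (x - a) powr (2 * \<mu> - 2)) \<partial>lborel) = ennreal ?C"
    proof -
      have "(\<integral>\<^sup>+x. ennreal (indicator {a<..<b} x *\<^sub>R (x - a) powr (2 * \<mu> - 2)) \<partial>lborel) =
          (\<integral>\<^sup>+v. ennreal (indicator {a<..<b} (a + v) *\<^sub>R v powr (2 * \<mu> - 2)) \<partial>lborel)"
        by (subst nn_integral_real_affine[where c = 1 and t = a]) simp_all
      also have "\<dots> = (\<integral>\<^sup>+v. ennreal (indicator {0<..<?L} v * v powr (2 * \<mu> - 2)) \<partial>lborel)"
        by (intro nn_integral_cong) (auto simp: indicator_def)
      also have "\<dots> = ennreal ?C"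
        using has_integral_powr_from_0[of "2 * \<mu> - 2" ?L] \<mu> ab
        by (intro nn_integral_has_integral_lebesgue) (simp_all add: has_integral_Icc_iff_Ioo)
      finally show ?thesis .
    qed
    also have "ennreal t * ennreal ?C = ennreal (t * ?C)" by (rule ennreal_mult'[symmetric]) (use t in simp)
    finally show ?thesis .
  qed
  have "?L * norm c = norm (?L *\<^sub>R c)" using ab by simp
  also have "\<dots> \<le> norm (LINT x|lborel. indicator {a<..<b} x *\<^sub>R g x) + ?L * norm (LINT w|?M. f w)"
    unfolding eq using norm_triangle_ineq4[of _ "?L *\<^sub>R (LINT w|?M. f w)"] ab by simp
  finally have "ennreal (?L * norm c) \<le>
      ennreal (norm (LINT x|lborel. indicator {a<..<b} x *\<^sub>R g x) + ?L * norm (LINT w|?M. f w))"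
    by (rule ennreal_leI)
  also have "\<dots> = ennreal (norm (LINT x|lborel. indicator {a<..<b} x *\<^sub>R g x)) + ennreal ?L * ennreal (norm (LINT w|?M. f w))"
    using ab by (simp add: ennreal_mult')
  also have "\<dots> \<le> (ennreal (t * ?L) + ennreal (1 / t) * ?I) + ennreal ?L * (ennreal (t * ?C) + ennreal (1 / t) * ?J)"
    by (intro add_mono mult_left_mono F G) simp
  also have "\<dots> = (ennreal (t * ?L) + ennreal (?L * (t * ?C))) + (ennreal (1 / t) * ?I + ennreal (?L / t) * ?J)"
    using ab t by (simp add: distrib_left ennreal_mult'[symmetric] mult.assoc[symmetric] add_ac)
  also have "ennreal (t * ?L) + ennreal (?L * (t * ?C)) = ennreal (t * K)"
  proof -
    have *: "t * ?L + ?L * (t * y) = t * (?L + ?L * y)" for y by (simp add: algebra_simps)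
    have "ennreal (t * K) = ennreal (t * ?L + ?L * (t * ?C))" unfolding K_def * ..
    moreover have "0 \<le> ?L * (t * ?C)" using ab t C by (intro mult_nonneg_nonneg) auto
    ultimately show ?thesis using ab t by (subst ennreal_plus[symmetric]) auto
  qed
  also have "ennreal (1 / t) * ?I + ennreal (?L / t) * ?J \<le>
      ennreal ((1 + ?L) / t) * ?I + ennreal ((1 + ?L) / t) * ?J"
    using ab t by (intro add_mono mult_right_mono ennreal_leI divide_right_mono) auto
  also have "\<dots> = ennreal ((1 + ?L) / t) * Hs_norm_sq a b \<mu> g"
    by (simp add: Hs_norm_sq_lborel distrib_left)
  finally show ?thesis by (simp add: add_left_mono)
qed

text \<open>
  The difference \<open>g\<close> of the polynomial and a test function has the same boundary value as the
  polynomial, because the test function vanishes near \<open>a\<close>, and its Sobolev norm can be made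
  arbitrarily small.
\<close>

lemma poly_trace_left:
  assumes ab: "a < b" and \<mu>: "1 / 2 < \<mu>"
    and approx: "\<And>\<epsilon>. \<epsilon> > 0 \<Longrightarrow> \<exists>\<phi>\<in>test_functions a b. Hs_norm_sq a b \<mu> (\<lambda>x. poly p (complex_of_real x) - \<phi> x) < ennreal (\<epsilon>\<^sup>2)"
  shows "poly p (of_real a) = 0"
proof (rule ccontr)
  let ?c = "poly p (complex_of_real a)"
  assume "?c \<noteq> 0"
  define K where "K = (b - a) + (b - a) * ((b - a) powr (2 * \<mu> - 1) / (2 * \<mu> - 1))"
  have K: "K > 0" unfolding K_def using ab \<mu> by (intro add_pos_nonneg mult_nonneg_nonneg) auto
  \<comment> \<open>Taking \<open>t\<close> also as the accuracy of the approximation, the trace bound becomes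
    \<open>(b - a) |c| \<le> t (K + 1 + (b - a))\<close>, whose right-hand side is half of the left for this \<open>t\<close>.\<close>
  define t where "t = (b - a) * norm ?c / (2 * (K + (1 + (b - a))))"
  have t: "t > 0" unfolding t_def using ab K \<open>?c \<noteq> 0\<close> by (intro divide_pos_pos mult_pos_pos) auto
  obtain \<phi> where \<phi>: "\<phi> \<in> test_functions a b"
    "Hs_norm_sq a b \<mu> (\<lambda>x. poly p (complex_of_real x) - \<phi> x) < ennreal (t\<^sup>2)"
    using approx[OF t] by blast
  define g where "g = (\<lambda>x. poly p (complex_of_real x) - \<phi> x)"
  have cont: "continuous_on UNIV \<phi>" by (rule test_functions_continuous[OF \<phi>(1)])
  have "continuous_on UNIV g" unfolding g_def by (intro continuous_intros cont)
  then have [measurable]: "g \<in> borel_measurable borel" by (rule borel_measurable_continuous_onI)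
  obtain A where A: "compact A" "A \<subseteq> {a<..<b}" "\<And>x. x \<notin> A \<Longrightarrow> \<phi> x = 0"
    using \<phi>(1) by (auto simp: test_functions_def)
  have "[:- complex_of_real a, 1:] dvd p - [:?c:]" by (rule poly_eq_0_iff_dvd[THEN iffD1]) simp
  then obtain r where r: "p - [:?c:] = [:- complex_of_real a, 1:] * r" by (rule dvdE)
  have p: "poly p (of_real x) = ?c + (x - a) *\<^sub>R poly r (of_real x)" for x
  proof -
    have "poly (p - [:?c:]) (of_real x) = (x - a) *\<^sub>R poly r (of_real x)"
      unfolding r by (simp add: scaleR_conv_of_real algebra_simps)
    then show ?thesis by (simp add: algebra_simps)
  qed
  have "bounded ((\<lambda>x. poly r (complex_of_real x)) ` {a..b})"
    by (intro compact_imp_bounded compact_continuous_image continuous_intros) auto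
  then obtain R where R: "\<forall>x\<in>{a..b}. norm (poly r (complex_of_real x)) \<le> R"
    unfolding bounded_iff by auto
  have "bounded ((\<lambda>x. \<phi> x /\<^sub>R (x - a)) ` A)"
  proof (intro compact_imp_bounded compact_continuous_image A(1))
    have "continuous_on A \<phi>" using cont by (rule continuous_on_subset) simp
    then show "continuous_on A (\<lambda>x. \<phi> x /\<^sub>R (x - a))"
      by (rule continuous_on_scaleR[rotated]) (rule continuous_on_inverse, intro continuous_intros, use A(2) in force)
  qed
  then obtain S where S: "\<forall>x\<in>A. norm (\<phi> x /\<^sub>R (x - a)) \<le> S"
    unfolding bounded_iff by blast
  define h where "h x = poly r (of_real x) - \<phi> x /\<^sub>R (x - a)" for x
  have gh: "g x = ?c + (x - a) *\<^sub>R h x" if "x \<in> {a<..<b}" for x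
    using that by (simp add: g_def h_def p[of x] scaleR_right_diff_distrib)
  have h: "norm (h x) \<le> R + \<bar>S\<bar>" if "x \<in> {a<..<b}" for x
  proof -
    have "norm (h x) \<le> norm (poly r (complex_of_real x)) + norm (\<phi> x /\<^sub>R (x - a))"
      unfolding h_def by (rule norm_triangle_ineq4)
    moreover have "norm (poly r (complex_of_real x)) \<le> R" using R that by auto
    moreover have "norm (\<phi> x /\<^sub>R (x - a)) \<le> \<bar>S\<bar>"
    proof (cases "x \<in> A")
      case True
      then have "norm (\<phi> x /\<^sub>R (x - a)) \<le> S" using S by blast
      then show ?thesis by linarith
    next
      case False
      then show ?thesis using A(3) by simp
    qed
    ultimately show ?thesis by linarith
  qed
  have pos: "t * (K + (1 + (b - a))) \<ge> 0" using ab t K by (intro mult_nonneg_nonneg) auto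
  have "ennreal ((b - a) * norm ?c) \<le> ennreal (t * K) + ennreal ((1 + (b - a)) / t) * Hs_norm_sq a b \<mu> g"
    unfolding K_def by (rule trace_bound[OF ab \<mu> t _ gh h]) auto
  also have "\<dots> \<le> ennreal (t * K) + ennreal ((1 + (b - a)) / t) * ennreal (t\<^sup>2)"
    using \<phi>(2) by (intro add_left_mono mult_left_mono) (auto simp: g_def)
  also have "\<dots> = ennreal (t * (K + (1 + (b - a))))"
  proof -
    have "ennreal ((1 + (b - a)) / t) * ennreal (t\<^sup>2) = ennreal ((1 + (b - a)) * t)"
      using ab t by (subst ennreal_mult'[symmetric]) (simp_all add: power2_eq_square)
    moreover have "0 \<le> (1 + (b - a)) * t" "0 \<le> t * K" using ab t K by (simp_all add: mult_nonneg_nonneg)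
    then have "ennreal (t * K) + ennreal ((1 + (b - a)) * t) = ennreal (t * (K + (1 + (b - a))))"
      by (subst ennreal_plus[symmetric]) (simp_all add: algebra_simps)
    ultimately show ?thesis by simp
  qed
  finally have "(b - a) * norm ?c \<le> t * (K + (1 + (b - a)))"
    using pos by (subst (asm) ennreal_le_iff) auto
  also have "\<dots> = (b - a) * norm ?c / 2" unfolding t_def using ab K by (simp add: field_simps)
  finally show False using ab \<open>?c \<noteq> 0\<close> by simp
qed

lemma poly_in_Hs0_vanishes:
  assumes ab: "a < b" and \<mu>: "1 / 2 < \<mu>" and u: "u \<in> Hs0 a b \<mu>"
    and p: "\<And>x. x \<in> {a<..<b} \<Longrightarrow> u x = poly p (complex_of_real x)"
  shows "poly p (of_real a) = 0" "poly p (of_real b) = 0"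
proof -
  have approx: "\<exists>\<phi>\<in>test_functions a b. Hs_norm_sq a b \<mu> (\<lambda>x. poly p (complex_of_real x) - \<phi> x) < ennreal (\<epsilon>\<^sup>2)"
    if eps: "\<epsilon> > 0" for \<epsilon>
  proof -
    obtain \<phi> where "\<phi> \<in> test_functions a b" "Hs_norm_sq a b \<mu> (\<lambda>x. u x - \<phi> x) < ennreal (\<epsilon>\<^sup>2)"
      using u eps unfolding Hs0_def by blast
    moreover have "Hs_norm_sq a b \<mu> (\<lambda>x. u x - \<phi> x) = Hs_norm_sq a b \<mu> (\<lambda>x. poly p (complex_of_real x) - \<phi> x)"
      by (rule Hs_norm_sq_cong) (simp add: p)
    ultimately show ?thesis by auto
  qed
  show "poly p (of_real a) = 0" by (rule poly_trace_left[OF ab \<mu> approx])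
  have "poly (pcompose p [:0, -1:]) (complex_of_real (- b)) = 0"
  proof (rule poly_trace_left[where b = "- a" and \<mu> = \<mu>])
    fix \<epsilon> :: real assume "\<epsilon> > 0"
    then obtain \<phi> where \<phi>: "\<phi> \<in> test_functions a b"
      "Hs_norm_sq a b \<mu> (\<lambda>x. poly p (complex_of_real x) - \<phi> x) < ennreal (\<epsilon>\<^sup>2)"
      using approx by blast
    have "continuous_on UNIV (\<lambda>x. poly p (complex_of_real x) - \<phi> x)"
      by (intro continuous_intros test_functions_continuous[OF \<phi>(1)])
    then have "Hs_norm_sq (- b) (- a) \<mu> (\<lambda>x. poly p (complex_of_real (- x)) - \<phi> (- x)) < ennreal (\<epsilon>\<^sup>2)"
      using \<phi>(2) by (subst Hs_norm_sq_reflect) (auto intro: borel_measurable_continuous_onI)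
    then show "\<exists>\<phi>\<in>test_functions (- b) (- a).
        Hs_norm_sq (- b) (- a) \<mu> (\<lambda>x. poly (pcompose p [:0, -1:]) (complex_of_real x) - \<phi> x) < ennreal (\<epsilon>\<^sup>2)"
      using test_functions_reflect[OF \<phi>(1)] by (intro bexI) (auto simp: poly_pcompose)
  qed (use ab \<mu> in auto)
  then show "poly p (of_real b) = 0" by (simp add: poly_pcompose)
qed

section \<open>Positivity of left and right fractional integrals against each other\<close>

lemma borel_measurable_cnj [measurable (raw)]:
  assumes "f \<in> borel_measurable M"
  shows "(\<lambda>x. cnj (f x)) \<in> borel_measurable M"
  using assms by (rule borel_measurable_continuous_on[rotated]) (intro continuous_intros)

text \<open>
  Fubini for the composition of two nonnegative kernels. Only the composed kernel \<open>K\<close> needs to be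
  integrable against \<open>q\<close>, because the composition is computed with absolute values by Tonelli. The
  composition is allowed to differ from \<open>K\<close> on a null set, since for singular kernels the composition
  may diverge on the diagonal.
\<close>

lemma kernel_product_integral:
  fixes q :: "real \<Rightarrow> complex" and k1 k2 K :: "real \<Rightarrow> real \<Rightarrow> real"
  assumes [measurable]: "q \<in> borel_measurable borel"
    "(\<lambda>(x, y). k1 x y) \<in> borel_measurable (lborel \<Otimes>\<^sub>M lborel)"
    "(\<lambda>(x, y). k2 x y) \<in> borel_measurable (lborel \<Otimes>\<^sub>M lborel)"
    "(\<lambda>(x, y). K x y) \<in> borel_measurable (lborel \<Otimes>\<^sub>M lborel)"
    and nn: "\<And>x y. k1 x y \<ge> 0" "\<And>x y. k2 x y \<ge> 0" "\<And>x y. K x y \<ge> 0"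
    and K: "AE w in lborel \<Otimes>\<^sub>M lborel.
      (\<integral>\<^sup>+x. ennreal (k1 x (fst w) * k2 x (snd w)) \<partial>lborel) = ennreal (K (fst w) (snd w))"
    and fin: "integrable (lborel \<Otimes>\<^sub>M lborel)
      (\<lambda>w. K (fst w) (snd w) *\<^sub>R (q (fst w) * cnj (q (snd w))))"
  shows "(LINT x|lborel. (LINT y|lborel. k1 x y *\<^sub>R q y) * cnj (LINT z|lborel. k2 x z *\<^sub>R q z)) =
    (LINT w|(lborel \<Otimes>\<^sub>M lborel). K (fst w) (snd w) *\<^sub>R (q (fst w) * cnj (q (snd w))))"
proof -
  let ?M = "lborel \<Otimes>\<^sub>M lborel :: (real \<times> real) measure"
  define F where "F x w = (k1 x (fst w) * k2 x (snd w)) *\<^sub>R (q (fst w) * cnj (q (snd w)))"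
    for x :: real and w :: "real \<times> real"
  interpret P: pair_sigma_finite lborel ?M
    by (intro pair_sigma_finite.intro lborel.sigma_finite_measure_axioms
        sigma_finite_pair_measure)
  have [measurable]: "(\<lambda>(x, w). F x w) \<in> borel_measurable (lborel \<Otimes>\<^sub>M ?M)"
    unfolding F_def by measurable
  have slice_nn: "AE w in ?M. (\<integral>\<^sup>+x. ennreal (norm (F x w)) \<partial>lborel) =
      ennreal (norm (K (fst w) (snd w) *\<^sub>R (q (fst w) * cnj (q (snd w)))))"
    using K
  proof eventually_elim
    case (elim w)
    have "(\<integral>\<^sup>+x. ennreal (norm (F x w)) \<partial>lborel) =
        (\<integral>\<^sup>+x. ennreal (k1 x (fst w) * k2 x (snd w)) * ennreal (norm (q (fst w) * cnj (q (snd w)))) \<partial>lborel)"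
      unfolding F_def by (intro nn_integral_cong) (simp add: nn abs_mult ennreal_mult'[symmetric])
    also have "\<dots> = (\<integral>\<^sup>+x. ennreal (k1 x (fst w) * k2 x (snd w)) \<partial>lborel) * ennreal (norm (q (fst w) * cnj (q (snd w))))"
      by (rule nn_integral_multc) measurable
    finally show ?case using elim by (simp add: nn ennreal_mult'[symmetric])
  qed
  have "integrable (lborel \<Otimes>\<^sub>M ?M) (\<lambda>(x, w). F x w)"
  proof (rule integrableI_bounded)
    have "(\<integral>\<^sup>+ z. ennreal (norm (case z of (x, w) \<Rightarrow> F x w)) \<partial>(lborel \<Otimes>\<^sub>M ?M)) =
        (\<integral>\<^sup>+ w. \<integral>\<^sup>+ x. ennreal (norm (F x w)) \<partial>lborel \<partial>?M)"
      by (subst P.nn_integral_snd[symmetric]) (auto simp: split_beta')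
    also have "\<dots> = (\<integral>\<^sup>+ w. ennreal (norm (K (fst w) (snd w) *\<^sub>R (q (fst w) * cnj (q (snd w))))) \<partial>?M)"
      using slice_nn by (rule nn_integral_cong_AE)
    also have "\<dots> < \<infinity>" using fin unfolding integrable_iff_bounded by simp
    finally show "(\<integral>\<^sup>+ z. ennreal (norm (case z of (x, w) \<Rightarrow> F x w)) \<partial>(lborel \<Otimes>\<^sub>M ?M)) < \<infinity>" .
  qed measurable
  note intF = this
  have inner: "AE x in lborel. (LINT y|lborel. k1 x y *\<^sub>R q y) * cnj (LINT z|lborel. k2 x z *\<^sub>R q z) =
      (LINT w|?M. F x w)"
    using P.AE_integrable_fst[OF intF]
  proof eventually_elim
    case (elim x)
    have "(LINT w|?M. F x w) = (LINT y|lborel. LINT z|lborel. F x (y, z))"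
      using lborel_pair.integral_fst'[OF elim] by simp
    also have "\<dots> = (LINT y|lborel. LINT z|lborel. (k1 x y *\<^sub>R q y) * cnj (k2 x z *\<^sub>R q z))"
      by (simp add: F_def algebra_simps)
    also have "\<dots> = (LINT y|lborel. k1 x y *\<^sub>R q y) * (LINT z|lborel. cnj (k2 x z *\<^sub>R q z))"
      by (simp only: integral_mult_right_zero integral_mult_left_zero)
    finally show ?case by (simp only: Bochner_Integration.integral_cnj)
  qed
  have "(LINT x|lborel. (LINT y|lborel. k1 x y *\<^sub>R q y) * cnj (LINT z|lborel. k2 x z *\<^sub>R q z)) =
      (LINT x|lborel. LINT w|?M. F x w)"
    by (rule integral_cong_AE) (use inner in \<open>auto intro!: lborel_pair.borel_measurable_lebesgue_integral borel_measurable_times\<close>)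
  also have "\<dots> = (LINT w|?M. LINT x|lborel. F x w)"
    using P.Fubini_integral[OF intF] by simp
  also have "\<dots> = (LINT w|?M. K (fst w) (snd w) *\<^sub>R (q (fst w) * cnj (q (snd w))))"
  proof (rule integral_cong_AE)
    show "AE w in ?M. (LINT x|lborel. F x w) = K (fst w) (snd w) *\<^sub>R (q (fst w) * cnj (q (snd w)))"
      using K
    proof eventually_elim
      case (elim w)
      have "has_bochner_integral lborel (\<lambda>x. k1 x (fst w) * k2 x (snd w)) (K (fst w) (snd w))"
        by (rule has_bochner_integral_nn_integral) (use elim nn in auto)
      from has_bochner_integral_scaleR_left[OF this, of "q (fst w) * cnj (q (snd w))"]
      show ?case unfolding F_def by (auto dest: has_bochner_integral_integral_eq)
    qed
  qed measurable
  finally show ?thesis .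
qed

text \<open>
  The kernel of the left fractional integral of order \<open>s\<close>, without the factor \<open>1 / \<Gamma>(s)\<close>. With its
  arguments exchanged it is the kernel of the right one.
\<close>

definition frac_kernel :: "real \<Rightarrow> real \<Rightarrow> real \<Rightarrow> real" where
  "frac_kernel s x y = (if y < x then (x - y) powr (s - 1) else 0)"

lemma frac_kernel_nonneg: "frac_kernel s x y \<ge> 0"
  by (simp add: frac_kernel_def)

lemma measurable_frac_kernel [measurable]:
  assumes "f \<in> borel_measurable M" "g \<in> borel_measurable M"
  shows "(\<lambda>w. frac_kernel s (f w) (g w)) \<in> borel_measurable M"
  using assms unfolding frac_kernel_def by measurable

text \<open>
  Because of this homogeneity, compositions of such kernels are determined up to a constant by the
  substitution that maps the two base points to \<open>0\<close> and \<open>1\<close>.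
\<close>

lemma frac_kernel_affine:
  assumes "c > 0"
  shows "frac_kernel s (t + c * x) (t + c * y) = c powr (s - 1) * frac_kernel s x y"
proof -
  have "t + c * x - (t + c * y) = c * (x - y)" by (simp add: algebra_simps)
  then show ?thesis using assms by (simp add: frac_kernel_def powr_mult)
qed

text \<open>
  The semigroup law: integrals of order \<open>s\<close> compose to one of order \<open>2s\<close>.
\<close>

lemma frac_kernel_between:
  assumes s: "s > 0"
  shows "(\<integral>\<^sup>+x. ennreal (frac_kernel s x y * frac_kernel s z x) \<partial>lborel) =
    ennreal (Beta s s * frac_kernel (2 * s) z y)"
proof (cases "y < z")
  case True
  have [simp]: "z - y > 0" "z - y \<noteq> 0" using True by auto
  have eq: "frac_kernel s (y + (z - y) * v) y * frac_kernel s z (y + (z - y) * v) =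
     (z - y) powr (2 * s - 2) * (indicator {0..1} v * (v powr (s - 1) * (1 - v) powr (s - 1)))" for v
  proof -
    have 1: "frac_kernel s (y + (z - y) * v) y = (z - y) powr (s - 1) * frac_kernel s v 0"
      using frac_kernel_affine[of "z - y" s y v 0] True by simp
    have 2: "frac_kernel s z (y + (z - y) * v) = (z - y) powr (s - 1) * frac_kernel s 1 v"
      using frac_kernel_affine[of "z - y" s y 1 v] True by simp
    show ?thesis unfolding 1 2
      by (auto simp: frac_kernel_def powr_add[symmetric] indicator_def)
  qed
  have "(\<integral>\<^sup>+x. ennreal (frac_kernel s x y * frac_kernel s z x) \<partial>lborel) =
     ennreal (z - y) * (\<integral>\<^sup>+v. ennreal ((z - y) powr (2 * s - 2)) *
       ennreal (indicator {0..1} v * (v powr (s - 1) * (1 - v) powr (s - 1))) \<partial>lborel)"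
    by (subst nn_integral_real_affine[where c = "z - y" and t = y])
      (use True in \<open>simp_all add: eq ennreal_mult'\<close>)
  also have "\<dots> = ennreal (z - y) * (ennreal ((z - y) powr (2 * s - 2)) * ennreal (Beta s s))"
    by (subst nn_integral_cmult, simp, subst nn_integral_has_integral_lebesgue[OF _ has_integral_Beta_real])
       (use s in auto)
  also have "\<dots> = ennreal ((z - y) powr (2 * s - 1) * Beta s s)"
    using True by (simp add: ennreal_mult'[symmetric] mult.assoc[symmetric] powr_mult_base)
  finally show ?thesis using True by (simp add: frac_kernel_def mult.commute)
next
  case False
  have "(\<integral>\<^sup>+x. ennreal (frac_kernel s x y * frac_kernel s z x) \<partial>lborel) = (\<integral>\<^sup>+(x::real). 0 \<partial>lborel)"
    using False by (intro nn_integral_cong) (auto simp: frac_kernel_def)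
  then show ?thesis using False by (simp add: frac_kernel_def)
qed

text \<open>
  The integrand behaves like \<open>\<bar>v\<bar> powr (s - 1)\<close> near \<open>0\<close> and like \<open>\<bar>v\<bar> powr (2s - 2)\<close> near \<open>-\<infinity>\<close>.
  The latter is integrable exactly for \<open>s < 1/2\<close>.
\<close>

lemma frac_kernel_below_constant:
  assumes s: "0 < s" "s < 1 / 2"
  obtains C where "C > 0"
    "(\<integral>\<^sup>+v. ennreal (frac_kernel s 0 v * frac_kernel s 1 v) \<partial>lborel) = ennreal C"
proof -
  let ?I = "\<integral>\<^sup>+v. ennreal (frac_kernel s 0 v * frac_kernel s 1 v) \<partial>lborel"
  have "?I = (\<integral>\<^sup>+v. ennreal (frac_kernel s 0 (-v) * frac_kernel s 1 (-v)) \<partial>lborel)"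
    by (subst nn_integral_real_affine[where c = "-1" and t = 0]) simp_all
  also have "\<dots> \<le> (\<integral>\<^sup>+v. ennreal (indicator {0..1} v * v powr (s - 1)) +
      ennreal (indicator {1..} v * v powr (2 * s - 2)) \<partial>lborel)"
  proof (rule nn_integral_mono)
    fix v :: real
    have "frac_kernel s 0 (-v) * frac_kernel s 1 (-v) \<le>
        indicator {0..1} v * v powr (s - 1) + indicator {1..} v * v powr (2 * s - 2)"
    proof (cases "v > 0")
      case True
      have 0: "frac_kernel s 0 (-v) * frac_kernel s 1 (-v) = v powr (s - 1) * (1 + v) powr (s - 1)"
        using True by (simp add: frac_kernel_def)
      show ?thesis
      proof (cases "v \<le> 1")
        case v: True
        have "(1 + v) powr (s - 1) \<le> (1 + v) powr 0" using True s by (intro powr_mono) auto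
        then have "v powr (s - 1) * (1 + v) powr (s - 1) \<le> v powr (s - 1) * 1"
          using True by (intro mult_left_mono) auto
        also have "\<dots> \<le> indicator {0..1} v * v powr (s - 1) + indicator {1..} v * v powr (2 * s - 2)"
          using True v by simp
        finally show ?thesis unfolding 0 .
      next
        case False
        have "(1 + v) powr (s - 1) \<le> v powr (s - 1)" using True s by (intro powr_mono2') auto
        then have "v powr (s - 1) * (1 + v) powr (s - 1) \<le> v powr (s - 1) * v powr (s - 1)"
          using True by (intro mult_left_mono) auto
        also have "\<dots> = v powr (2 * s - 2)" by (simp add: powr_add[symmetric])
        finally show ?thesis unfolding 0 using False True by simp
      qed
    qed (auto simp: frac_kernel_def indicator_def)
    then show "ennreal (frac_kernel s 0 (-v) * frac_kernel s 1 (-v)) \<le>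
        ennreal (indicator {0..1} v * v powr (s - 1)) + ennreal (indicator {1..} v * v powr (2 * s - 2))"
      by (auto simp: ennreal_plus[symmetric] simp del: ennreal_plus intro!: ennreal_leI)
  qed
  also have "\<dots> = (\<integral>\<^sup>+v. ennreal (indicator {0..1} v * v powr (s - 1)) \<partial>lborel) +
      (\<integral>\<^sup>+v. ennreal (indicator {1..} v * v powr (2 * s - 2)) \<partial>lborel)"
    by (rule nn_integral_add) simp_all
  also have "\<dots> < \<infinity>"
    using s by (subst nn_integral_has_integral_lebesgue[OF _ has_integral_powr_from_0], simp, simp, simp,
      subst nn_integral_has_integral_lebesgue[OF _ has_integral_powr_to_inf]) simp_all
  finally have fin: "?I < \<infinity>" .
  have "?I \<noteq> 0"
  proof
    assume "?I = 0"
    then have "AE v in lborel. frac_kernel s 0 v * frac_kernel s 1 v \<le> 0"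
      by (subst (asm) nn_integral_0_iff_AE) (auto simp: ennreal_eq_0_iff)
    then have "AE v in lborel. v \<notin> {-1<..<(0::real)}"
      by (rule eventually_mono) (auto simp: frac_kernel_def mult_le_0_iff)
    then have "emeasure lborel {-1<..<(0::real)} = 0"
      by (subst (asm) AE_iff_null_sets[symmetric]) auto
    then show False by simp
  qed
  with fin have "enn2real ?I > 0" "?I = ennreal (enn2real ?I)"
    by (auto simp: enn2real_positive_iff less_top zero_less_iff_neq_zero)
  then show thesis using that by blast
qed

text \<open>
  The factorization of the Riesz kernel \<open>\<bar>y - z\<bar> powr (2s - 1)\<close> that makes it positive definite.
  Here \<open>t\<close> ranges over the whole half-line below \<open>y\<close> and \<open>z\<close>, which is what makes the scaling
  argument work.
\<close>

lemma frac_kernel_below: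
  assumes s: "0 < s" "s < 1 / 2" and "y \<noteq> z"
    and C: "(\<integral>\<^sup>+v. ennreal (frac_kernel s 0 v * frac_kernel s 1 v) \<partial>lborel) = ennreal C" "C > 0"
  shows "(\<integral>\<^sup>+t. ennreal (frac_kernel s y t * frac_kernel s z t) \<partial>lborel) =
    ennreal (C * (frac_kernel (2 * s) y z + frac_kernel (2 * s) z y))"
proof -
  have *: "(\<integral>\<^sup>+t. ennreal (frac_kernel s y t * frac_kernel s z t) \<partial>lborel) =
    ennreal (C * (z - y) powr (2 * s - 1))" if "y < z" for y z
  proof -
    have [simp]: "z - y > 0" "z - y \<noteq> 0" using that by auto
    have eq: "frac_kernel s y (y + (z - y) * v) * frac_kernel s z (y + (z - y) * v) =
       (z - y) powr (2 * s - 2) * (frac_kernel s 0 v * frac_kernel s 1 v)" for v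
    proof -
      have 1: "frac_kernel s y (y + (z - y) * v) = (z - y) powr (s - 1) * frac_kernel s 0 v"
        using frac_kernel_affine[of "z - y" s y 0 v] that by simp
      have 2: "frac_kernel s z (y + (z - y) * v) = (z - y) powr (s - 1) * frac_kernel s 1 v"
        using frac_kernel_affine[of "z - y" s y 1 v] that by simp
      show ?thesis unfolding 1 2
        by (simp add: powr_add[symmetric])
    qed
    have "(\<integral>\<^sup>+t. ennreal (frac_kernel s y t * frac_kernel s z t) \<partial>lborel) =
       ennreal (z - y) * (\<integral>\<^sup>+v. ennreal ((z - y) powr (2 * s - 2)) *
         ennreal (frac_kernel s 0 v * frac_kernel s 1 v) \<partial>lborel)"
      by (subst nn_integral_real_affine[where c = "z - y" and t = y])
        (use that in \<open>simp_all add: eq ennreal_mult'\<close>)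
    also have "\<dots> = ennreal (z - y) * (ennreal ((z - y) powr (2 * s - 2)) * ennreal C)"
      by (subst nn_integral_cmult, simp, subst C) simp
    also have "\<dots> = ennreal ((z - y) powr (2 * s - 1) * C)"
      using that by (simp add: ennreal_mult'[symmetric] mult.assoc[symmetric] powr_mult_base)
    finally show ?thesis by (simp add: mult.commute)
  qed
  show ?thesis
  proof (cases "y < z")
    case True then show ?thesis using *[OF True] by (simp add: frac_kernel_def)
  next
    case False
    then have "z < y" using \<open>y \<noteq> z\<close> by auto
    then show ?thesis using *[of z y] by (simp add: frac_kernel_def mult.commute)
  qed
qed

lemma frac_kernel_integrable:
  fixes q :: "real \<Rightarrow> complex"
  assumes s: "s > 0" and "a < b"
    and [measurable]: "q \<in> borel_measurable borel"
    and bound: "\<And>x. norm (q x) \<le> M" and supp: "\<And>x. x \<notin> {a<..<b} \<Longrightarrow> q x = 0"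
  shows "integrable (lborel \<Otimes>\<^sub>M lborel)
      (\<lambda>w. frac_kernel s (snd w) (fst w) *\<^sub>R (q (fst w) * cnj (q (snd w))))"
proof (rule integrableI_bounded)
  have M: "M \<ge> 0" using bound[of 0] norm_ge_zero[of "q 0"] by linarith
  have row: "(\<integral>\<^sup>+z. ennreal (frac_kernel s z y * indicator {a<..<b} z) \<partial>lborel) \<le>
      ennreal ((b - a) powr s / s)" if "y \<in> {a<..<b}" for y
  proof -
    have "(\<integral>\<^sup>+z. ennreal (frac_kernel s z y * indicator {a<..<b} z) \<partial>lborel) =
        (\<integral>\<^sup>+v. ennreal (frac_kernel s (y + v) y * indicator {a<..<b} (y + v)) \<partial>lborel)"
      by (subst nn_integral_real_affine[where c = 1 and t = y]) simp_all
    also have "\<dots> \<le> (\<integral>\<^sup>+v. ennreal (indicator {0..b - a} v * v powr (s - 1)) \<partial>lborel)"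
      using that by (intro nn_integral_mono ennreal_leI) (auto simp: frac_kernel_def indicator_def)
    also have "\<dots> = ennreal ((b - a) powr s / s)"
      using s \<open>a < b\<close> by (subst nn_integral_has_integral_lebesgue[OF _ has_integral_powr_from_0]) simp_all
    finally show ?thesis .
  qed
  have "(\<integral>\<^sup>+ w. ennreal (norm (frac_kernel s (snd w) (fst w) *\<^sub>R (q (fst w) * cnj (q (snd w)))))
       \<partial>(lborel \<Otimes>\<^sub>M lborel)) =
     (\<integral>\<^sup>+ y. \<integral>\<^sup>+ z. ennreal (norm (frac_kernel s z y *\<^sub>R (q y * cnj (q z)))) \<partial>lborel \<partial>lborel)"
    by (subst lborel.nn_integral_fst[symmetric]) simp_all
  also have "\<dots> \<le> (\<integral>\<^sup>+ y. ennreal (M * M * ((b - a) powr s / s)) * indicator {a<..<b} y \<partial>lborel)"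
  proof (rule nn_integral_mono)
    fix y :: real
    show "(\<integral>\<^sup>+ z. ennreal (norm (frac_kernel s z y *\<^sub>R (q y * cnj (q z)))) \<partial>lborel) \<le>
        ennreal (M * M * ((b - a) powr s / s)) * indicator {a<..<b} y"
    proof (cases "y \<in> {a<..<b}")
      case True
      have "(\<integral>\<^sup>+ z. ennreal (norm (frac_kernel s z y *\<^sub>R (q y * cnj (q z)))) \<partial>lborel) \<le>
          (\<integral>\<^sup>+ z. ennreal (M * M) * ennreal (frac_kernel s z y * indicator {a<..<b} z) \<partial>lborel)"
      proof (rule nn_integral_mono)
        fix z :: real
        have "norm (frac_kernel s z y *\<^sub>R (q y * cnj (q z))) \<le> M * M * (frac_kernel s z y * indicator {a<..<b} z)"
        proof (cases "z \<in> {a<..<b}")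
          case True
          have "norm (q y) * norm (q z) \<le> M * M"
            using bound M by (intro mult_mono) auto
          then show ?thesis using True frac_kernel_nonneg[of s z y]
            by (simp add: norm_mult mult.commute[of "frac_kernel s z y"] mult_right_mono)
        qed (simp add: supp)
        then show "ennreal (norm (frac_kernel s z y *\<^sub>R (q y * cnj (q z)))) \<le>
            ennreal (M * M) * ennreal (frac_kernel s z y * indicator {a<..<b} z)"
          by (subst ennreal_mult'[symmetric]) (auto intro: ennreal_leI simp: M)
      qed
      also have "\<dots> = ennreal (M * M) * (\<integral>\<^sup>+ z. ennreal (frac_kernel s z y * indicator {a<..<b} z) \<partial>lborel)"
        by (rule nn_integral_cmult) simp
      also have "\<dots> \<le> ennreal (M * M) * ennreal ((b - a) powr s / s)"
        using row[OF True] by (rule mult_left_mono) simp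
      also have "\<dots> = ennreal (M * M * ((b - a) powr s / s)) * indicator {a<..<b} y"
        using True M by (subst ennreal_mult'[symmetric]) auto
      finally show ?thesis .
    qed (simp add: supp)
  qed
  also have "\<dots> < \<infinity>" 
    using \<open>a < b\<close> by (subst nn_integral_cmult_indicator) (auto simp: ennreal_mult_less_top)
  finally show "(\<integral>\<^sup>+ w. ennreal (norm (frac_kernel s (snd w) (fst w) *\<^sub>R (q (fst w) * cnj (q (snd w)))))
       \<partial>(lborel \<Otimes>\<^sub>M lborel)) < \<infinity>" .
qed measurable

text \<open>
  Let \<open>J\<close> be the integral of \<open>q(y) cnj (q(z)) (z - y) powr (2s - 1)\<close> over \<open>y < z\<close>. The pairing in the
  claim is a nonnegative multiple of \<open>J\<close>, whereas \<open>J + cnj J\<close> is a positive multiple of the squared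
  \<open>L\<^sup>2\<close> norm of a one-sided fractional integral of \<open>q\<close> over the real line.
\<close>

theorem Re_left_right_frac_integral_nonneg:
  fixes q :: "real \<Rightarrow> complex"
  assumes s: "0 < s" "s < 1 / 2" and ab: "a < b"
    and [measurable]: "q \<in> borel_measurable borel"
    and bound: "\<And>x. norm (q x) \<le> M" and supp: "\<And>x. x \<notin> {a<..<b} \<Longrightarrow> q x = 0"
  shows "Re (LINT x|lborel. (LINT y|lborel. frac_kernel s x y *\<^sub>R q y) *
    cnj (LINT z|lborel. frac_kernel s z x *\<^sub>R q z)) \<ge> 0"
proof -
  let ?M = "lborel \<Otimes>\<^sub>M lborel :: (real \<times> real) measure"
  obtain C where C: "C > 0"
    "(\<integral>\<^sup>+v. ennreal (frac_kernel s 0 v * frac_kernel s 1 v) \<partial>lborel) = ennreal C"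
    using frac_kernel_below_constant[OF s] by blast
  define f where "f w = frac_kernel (2 * s) (snd w) (fst w) *\<^sub>R (q (fst w) * cnj (q (snd w)))" for w
  define J where "J = (LINT w|?M. f w)"
  have B: "Beta s s \<ge> 0" using s by (simp add: Beta_def)
  have intf: "integrable ?M f" unfolding f_def
    by (rule frac_kernel_integrable[OF _ ab]) (use s bound supp in auto)
  \<comment> \<open>Exchanging the two variables conjugates the product of values of \<open>q\<close>.\<close>
  have f_swap: "(\<lambda>w. cnj (f (snd w, fst w))) =
      (\<lambda>w. frac_kernel (2 * s) (fst w) (snd w) *\<^sub>R (q (fst w) * cnj (q (snd w))))"
    by (auto simp: f_def fun_eq_iff)
  have intf': "integrable ?M (\<lambda>w. cnj (f (snd w, fst w)))"
    using lborel_pair.integrable_product_swap[OF intf] by (simp add: split_beta')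
  have J': "(LINT w|?M. cnj (f (snd w, fst w))) = cnj J"
    using lborel_pair.integral_product_swap[of f] borel_measurable_integrable[OF intf]
    by (simp add: integral_cnj J_def split_beta')
  have A: "(LINT x|lborel. (LINT y|lborel. frac_kernel s x y *\<^sub>R q y) *
      cnj (LINT z|lborel. frac_kernel s z x *\<^sub>R q z)) = Beta s s * J"
  proof -
    have "(LINT x|lborel. (LINT y|lborel. frac_kernel s x y *\<^sub>R q y) *
      cnj (LINT z|lborel. frac_kernel s z x *\<^sub>R q z)) =
      (LINT w|?M. (Beta s s * frac_kernel (2 * s) (snd w) (fst w)) *\<^sub>R (q (fst w) * cnj (q (snd w))))"
    proof (rule kernel_product_integral)
      show "integrable ?M (\<lambda>w. (Beta s s * frac_kernel (2 * s) (snd w) (fst w)) *\<^sub>R (q (fst w) * cnj (q (snd w))))"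
        using integrable_scaleR_right[OF intf, of "Beta s s"] by (simp add: f_def)
    qed (use B frac_kernel_between[OF s(1)] in \<open>auto simp: frac_kernel_nonneg\<close>)
    also have "\<dots> = Beta s s * J"
      unfolding J_def f_def scaleR_scaleR[symmetric] integral_scaleR_right by (simp add: scaleR_conv_of_real)
    finally show ?thesis .
  qed
  have S: "(LINT t|lborel. (LINT y|lborel. frac_kernel s y t *\<^sub>R q y) *
      cnj (LINT z|lborel. frac_kernel s z t *\<^sub>R q z)) = C * (J + cnj J)"
  proof -
    have eq: "(C * (frac_kernel (2 * s) (fst w) (snd w) + frac_kernel (2 * s) (snd w) (fst w))) *\<^sub>R
        (q (fst w) * cnj (q (snd w))) = C *\<^sub>R (f w + cnj (f (snd w, fst w)))" for w
      by (simp add: f_def algebra_simps)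
    have "(LINT t|lborel. (LINT y|lborel. frac_kernel s y t *\<^sub>R q y) *
      cnj (LINT z|lborel. frac_kernel s z t *\<^sub>R q z)) =
      (LINT w|?M. (C * (frac_kernel (2 * s) (fst w) (snd w) + frac_kernel (2 * s) (snd w) (fst w))) *\<^sub>R
        (q (fst w) * cnj (q (snd w))))"
    proof (rule kernel_product_integral)
      show "integrable ?M (\<lambda>w. (C * (frac_kernel (2 * s) (fst w) (snd w) + frac_kernel (2 * s) (snd w) (fst w))) *\<^sub>R
        (q (fst w) * cnj (q (snd w))))"
        unfolding eq by (intro integrable_scaleR_right Bochner_Integration.integrable_add intf intf')
      have "AE w in ?M. fst w \<noteq> snd w"
      proof (rule lborel_pair.AE_pair_measure)
        show "{w \<in> space ?M. fst w \<noteq> snd w} \<in> sets ?M" by measurable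
        show "AE y in lborel. AE z in lborel. fst (y, z) \<noteq> snd (y, z :: real)"
        proof (rule AE_I2)
          fix y :: real
          show "AE z in lborel. fst (y, z) \<noteq> snd (y, z)"
            by (rule eventually_mono[OF AE_lborel_singleton[of y]]) auto
        qed
      qed
      then show "AE w in ?M. (\<integral>\<^sup>+ t. ennreal (frac_kernel s (fst w) t * frac_kernel s (snd w) t) \<partial>lborel) =
          ennreal (C * (frac_kernel (2 * s) (fst w) (snd w) + frac_kernel (2 * s) (snd w) (fst w)))"
        by (rule eventually_mono) (use frac_kernel_below[OF s _ C(2) C(1)] in blast)
    qed (use C in \<open>auto simp: frac_kernel_nonneg\<close>)
    also have "\<dots> = C *\<^sub>R (J + cnj J)"
      unfolding eq using Bochner_Integration.integral_add[OF intf intf'] J' by (simp add: J_def)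
    finally show ?thesis by (simp add: scaleR_conv_of_real)
  qed
  have "0 \<le> (LINT t|lborel. (cmod (LINT y|lborel. frac_kernel s y t *\<^sub>R q y))\<^sup>2)" by simp
  also have "\<dots> = Re (LINT t|lborel. complex_of_real ((cmod (LINT y|lborel. frac_kernel s y t *\<^sub>R q y))\<^sup>2))"
    by (simp only: integral_complex_of_real Re_complex_of_real)
  also have "\<dots> = Re (C * (J + cnj J))"
    unfolding S[symmetric] by (simp only: complex_norm_square)
  also have "\<dots> = 2 * C * Re J" by simp
  finally have "Re J \<ge> 0" using C(1) by (simp add: zero_le_mult_iff)
  then show ?thesis unfolding A using B by simp
qed

section \<open>Positivity of \<open>\<B>\<close>\<close>

lemma left_frac_integral_eq_kernel:
  fixes f :: "real \<Rightarrow> complex"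
  assumes [measurable]: "f \<in> borel_measurable borel" and x: "x \<le> b"
  shows "(LINT \<xi>:{a<..<x}|lebesgue. f \<xi> /\<^sub>R ((x - \<xi>) powr \<mu>)) =
    (LINT y|lborel. frac_kernel (1 - \<mu>) x y *\<^sub>R (indicator {a<..<b} y *\<^sub>R f y))"
proof -
  have "(LINT \<xi>:{a<..<x}|lebesgue. f \<xi> /\<^sub>R ((x - \<xi>) powr \<mu>)) =
      (LINT y|lborel. indicator {a<..<x} y *\<^sub>R (f y /\<^sub>R ((x - y) powr \<mu>)))"
    unfolding set_lebesgue_integral_def by (rule integral_completion) measurable
  also have "\<dots> = (LINT y|lborel. frac_kernel (1 - \<mu>) x y *\<^sub>R (indicator {a<..<b} y *\<^sub>R f y))"
    by (intro Bochner_Integration.integral_cong)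
      (use x in \<open>auto simp: frac_kernel_def indicator_def powr_minus\<close>)
  finally show ?thesis .
qed

lemma right_frac_integral_eq_kernel:
  fixes f :: "real \<Rightarrow> complex"
  assumes [measurable]: "f \<in> borel_measurable borel" and x: "a \<le> x"
  shows "(LINT \<xi>:{x<..<b}|lebesgue. f \<xi> /\<^sub>R ((\<xi> - x) powr \<mu>)) =
    (LINT y|lborel. frac_kernel (1 - \<mu>) y x *\<^sub>R (indicator {a<..<b} y *\<^sub>R f y))"
proof -
  have "(LINT \<xi>:{x<..<b}|lebesgue. f \<xi> /\<^sub>R ((\<xi> - x) powr \<mu>)) =
      (LINT y|lborel. indicator {x<..<b} y *\<^sub>R (f y /\<^sub>R ((y - x) powr \<mu>)))"
    unfolding set_lebesgue_integral_def by (rule integral_completion) measurable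
  also have "\<dots> = (LINT y|lborel. frac_kernel (1 - \<mu>) y x *\<^sub>R (indicator {a<..<b} y *\<^sub>R f y))"
    by (intro Bochner_Integration.integral_cong)
      (use x in \<open>auto simp: frac_kernel_def indicator_def powr_minus\<close>)
  finally show ?thesis .
qed

text \<open>
  The boundary conditions turn both derivatives into fractional integrals of \<open>q = u'\<close> of order
  \<open>1 - \<mu> < 1/2\<close>. The right one carries a minus sign, and so does \<open>cos (\<alpha>\<pi>/2)\<close>.
\<close>

lemma frac_form_nonneg:
  assumes ab: "a < b" and \<alpha>: "1 < \<alpha>" "\<alpha> < 2"
    and u: "\<And>x. x \<in> {a<..<b} \<Longrightarrow> u x = poly p (complex_of_real x)"
    and pa: "poly p (of_real a) = 0" and pb: "poly p (of_real b) = 0"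
  shows "Re (frac_form a b \<alpha> u u) \<ge> 0"
proof -
  define \<mu> where "\<mu> = \<alpha> / 2"
  have \<mu>: "\<mu> < 1" "1 / 2 < \<mu>" using \<alpha> by (auto simp: \<mu>_def)
  let ?p' = "\<lambda>x. poly (pderiv p) (complex_of_real x)"
  define q where "q x = indicator {a<..<b} x *\<^sub>R ?p' x" for x
  have cont: "continuous_on A ?p'" for A by (intro continuous_intros)
  have [measurable]: "?p' \<in> borel_measurable borel" by (rule borel_measurable_continuous_onI[OF cont])
  have q [measurable]: "q \<in> borel_measurable borel" unfolding q_def by measurable
  have "bounded (?p' ` {a..b})"
    by (intro compact_imp_bounded compact_continuous_image cont) auto
  then obtain M where M: "\<forall>x\<in>{a..b}. norm (?p' x) \<le> M"
    unfolding bounded_iff by auto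
  have qM: "norm (q x) \<le> \<bar>M\<bar>" for x
    using bspec[OF M, of x] by (auto simp: q_def indicator_def)
  have q0: "q x = 0" if "x \<notin> {a<..<b}" for x using that by (simp add: q_def)
  define L where "L x = (LINT y|lborel. frac_kernel (1 - \<mu>) x y *\<^sub>R q y)" for x
  define R where "R x = (LINT y|lborel. frac_kernel (1 - \<mu>) y x *\<^sub>R q y)" for x
  have [measurable]: "L \<in> borel_measurable borel" "R \<in> borel_measurable borel"
    unfolding L_def R_def by measurable
  define g where "g = 1 / Gamma (1 - \<mu>)"
  have RL: "RL_left a \<mu> u x = g *\<^sub>R L x" "RL_right b \<mu> u x = - (g *\<^sub>R R x)" if x: "x \<in> {a<..<b}" for x
    using x RL_left_eq_frac_integral_deriv[OF \<mu>(1) x u pa] RL_right_eq_frac_integral_deriv[OF \<mu>(1) x u pb]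
    by (simp_all add: g_def L_def R_def q_def left_frac_integral_eq_kernel[where b = b]
        right_frac_integral_eq_kernel[where a = a])
  have zero: "L x * cnj (R x) = 0" if x: "x \<notin> {a<..<b}" for x
  proof -
    have "L x = 0" if "x \<le> a"
    proof -
      have "L x = (LINT (y::real)|lborel. 0)"
        unfolding L_def by (intro Bochner_Integration.integral_cong) (use that in \<open>auto simp: frac_kernel_def q_def\<close>)
      then show ?thesis by simp
    qed
    moreover have "R x = 0" if "x \<ge> b"
    proof -
      have "R x = (LINT (y::real)|lborel. 0)"
        unfolding R_def by (intro Bochner_Integration.integral_cong) (use that in \<open>auto simp: frac_kernel_def q_def\<close>)
      then show ?thesis by simp
    qed
    ultimately show ?thesis using x by (cases "x \<le> a") auto
  qed
  have "ip a b (RL_left a \<mu> u) (RL_right b \<mu> u) = (LINT x|lebesgue. (- g\<^sup>2) *\<^sub>R (L x * cnj (R x)))"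
    unfolding ip_def set_lebesgue_integral_def
    by (intro Bochner_Integration.integral_cong)
      (use zero in \<open>auto simp: RL indicator_def power2_eq_square\<close>)
  also have "\<dots> = (LINT x|lborel. (- g\<^sup>2) *\<^sub>R (L x * cnj (R x)))"
    by (rule integral_completion) measurable
  also have "\<dots> = (- g\<^sup>2) *\<^sub>R (LINT x|lborel. L x * cnj (R x))"
    by (rule integral_scaleR_right)
  finally have Z: "ip a b (RL_left a \<mu> u) (RL_right b \<mu> u) = (- g\<^sup>2) *\<^sub>R (LINT x|lborel. L x * cnj (R x))" .
  have "Re (LINT x|lborel. L x * cnj (R x)) \<ge> 0"
    unfolding L_def R_def
    by (rule Re_left_right_frac_integral_nonneg[OF _ _ ab q qM q0]) (use \<mu> in auto)
  then have "Re (ip a b (RL_left a \<mu> u) (RL_right b \<mu> u)) \<le> 0"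
    unfolding Z by (simp add: mult_nonneg_nonneg)
  moreover have "ip a b (RL_right b \<mu> u) (RL_left a \<mu> u) = cnj (ip a b (RL_left a \<mu> u) (RL_right b \<mu> u))"
    by (simp add: ip_cnj)
  ultimately have sum: "Re (ip a b (RL_left a \<mu> u) (RL_right b \<mu> u) + ip a b (RL_right b \<mu> u) (RL_left a \<mu> u)) \<le> 0"
    by simp
  have "cos (\<alpha> * pi / 2) < 0"
  proof -
    have "cos (pi - \<alpha> * pi / 2) > 0"
      by (rule cos_gt_zero_pi) (use \<alpha> in \<open>auto simp: field_simps\<close>)
    then show ?thesis by simp
  qed
  then have "1 / (2 * cos (\<alpha> * pi / 2)) \<le> 0" by simp
  from mult_nonpos_nonpos[OF this sum] show ?thesis
    by (simp add: frac_form_def \<mu>_def)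
qed

text \<open>
  The real square root is odd, so the square of the seminorm is in general only the absolute value of
  \<open>\<B>(u, u)\<close>; positivity identifies the two.
\<close>

lemma XN0_frac_seminorm_sq:
  assumes ab: "a < b" and \<alpha>: "1 < \<alpha>" "\<alpha> < 2" and u: "u \<in> XN0 a b \<alpha> N"
  shows "(frac_seminorm a b \<alpha> u)\<^sup>2 = Re (frac_form a b \<alpha> u u)"
proof -
  obtain p where p: "\<And>x. x \<in> {a<..<b} \<Longrightarrow> u x = poly p (complex_of_real x)"
    using u by (auto simp: XN0_def poly_space_def)
  have "u \<in> Hs0 a b (\<alpha> / 2)" using u by (simp add: XN0_def)
  moreover have "1 / 2 < \<alpha> / 2" using \<alpha> by simp
  ultimately have "poly p (of_real a) = 0" "poly p (of_real b) = 0"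
    using poly_in_Hs0_vanishes[OF ab _ _ p] by blast+
  then show ?thesis
    unfolding frac_seminorm_def using frac_form_nonneg[OF ab \<alpha> p] by simp
qed

section \<open>Functions that extend continuously past the endpoints\<close>

text \<open>
  Discrete solutions and their nonlinear expressions all have this property, which settles every
  integrability question in the scheme. It refers to values on \<open>\<Omega>\<close> only, since values outside are
  arbitrary.
\<close>

definition has_continuous_extension :: "real \<Rightarrow> real \<Rightarrow> (real \<Rightarrow> 'a::topological_space) \<Rightarrow> bool" where
  "has_continuous_extension a b f \<longleftrightarrow> (\<exists>g. continuous_on UNIV g \<and> (\<forall>x\<in>{a<..<b}. f x = g x))"

lemma has_continuous_extension_integrable:
  fixes f :: "real \<Rightarrow> 'a::{banach, second_countable_topology}"
  assumes "has_continuous_extension a b f"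
  shows "set_integrable lebesgue {a<..<b} f"
proof -
  obtain g where g: "continuous_on UNIV g" "\<And>x. x \<in> {a<..<b} \<Longrightarrow> f x = g x"
    using assms by (auto simp: has_continuous_extension_def)
  have "set_integrable lborel {a..b} g"
    unfolding set_integrable_def by (rule borel_integrable_compact) (auto intro: continuous_on_subset[OF g(1)])
  then have "set_integrable lborel {a<..<b} g"
    by (rule set_integrable_subset) auto
  then have "set_integrable lebesgue {a<..<b} g"
    using g(1) by (simp add: set_integrable_def integrable_completion borel_measurable_continuous_onI)
  also have "set_integrable lebesgue {a<..<b} g = set_integrable lebesgue {a<..<b} f"
    by (rule set_integrable_cong) (auto simp: g)
  finally show ?thesis .
qed

lemma has_continuous_extension_compose:
  assumes "has_continuous_extension a b f" "continuous_on UNIV F"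
  shows "has_continuous_extension a b (\<lambda>x. F (f x))"
proof -
  obtain g where g: "continuous_on UNIV g" "\<And>x. x \<in> {a<..<b} \<Longrightarrow> f x = g x"
    using assms by (auto simp: has_continuous_extension_def)
  then show ?thesis
    unfolding has_continuous_extension_def
    by (intro exI[of _ "\<lambda>x. F (g x)"]) (auto intro: continuous_on_compose2[OF assms(2)])
qed

lemma has_continuous_extension_Pair:
  assumes "has_continuous_extension a b f" "has_continuous_extension a b g"
  shows "has_continuous_extension a b (\<lambda>x. (f x, g x))"
proof -
  obtain f' g' where "continuous_on UNIV f'" "\<And>x. x \<in> {a<..<b} \<Longrightarrow> f x = f' x"
    "continuous_on UNIV g'" "\<And>x. x \<in> {a<..<b} \<Longrightarrow> g x = g' x"
    using assms by (auto simp: has_continuous_extension_def)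
  then show ?thesis
    unfolding has_continuous_extension_def
    by (intro exI[of _ "\<lambda>x. (f' x, g' x)"]) (auto intro: continuous_on_Pair)
qed

lemma poly_space_has_continuous_extension:
  assumes "u \<in> poly_space a b N"
  shows "has_continuous_extension a b u"
proof -
  obtain p where "\<And>x. x \<in> {a<..<b} \<Longrightarrow> u x = poly p (complex_of_real x)"
    using assms by (auto simp: poly_space_def)
  then show ?thesis unfolding has_continuous_extension_def
    by (intro exI[of _ "\<lambda>x. poly p (complex_of_real x)"]) (auto intro!: continuous_intros)
qed

text \<open>
  Pairs may be nested, so one application covers a continuous expression in any number of functions.
\<close>

lemma has_continuous_extension_Pair_integrable:
  fixes F :: "'a::topological_space \<times> 'b::topological_space \<Rightarrow> 'c::{banach, second_countable_topology}"
  assumes "has_continuous_extension a b f" "has_continuous_extension a b g" "continuous_on UNIV F"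
  shows "set_integrable lebesgue {a<..<b} (\<lambda>x. F (f x, g x))"
  using assms by (intro has_continuous_extension_integrable has_continuous_extension_compose[of a b _ F]
      has_continuous_extension_Pair)

section \<open>Difference quotients and averages in time\<close>

lemma L2_nrm_sq: "(L2_nrm a b u)\<^sup>2 = (LINT x:{a<..<b}|lebesgue. (cmod (u x))\<^sup>2)"
proof -
  have "ip a b u u = complex_of_real (LINT x:{a<..<b}|lebesgue. (cmod (u x))\<^sup>2)"
    unfolding ip_def set_integral_complex_of_real[symmetric]
    by (simp only: complex_norm_square)
  moreover have "(LINT x:{a<..<b}|lebesgue. (cmod (u x))\<^sup>2) \<ge> 0"
    unfolding set_lebesgue_integral_def by (intro Bochner_Integration.integral_nonneg) simp
  ultimately show ?thesis by (simp add: L2_nrm_def)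
qed

lemma Re_ip:
  assumes "has_continuous_extension a b u" "has_continuous_extension a b v"
  shows "Re (ip a b u v) = (LINT x:{a<..<b}|lebesgue. Re (u x * cnj (v x)))"
proof -
  have "set_integrable lebesgue {a<..<b} (\<lambda>x. u x * cnj (v x))"
    using has_continuous_extension_Pair_integrable[OF assms, of "\<lambda>z. fst z * cnj (snd z)"]
    by (simp add: continuous_intros)
  then have "integrable lebesgue (\<lambda>x. indicator {a<..<b} x *\<^sub>R (u x * cnj (v x)))"
    by (simp add: set_integrable_def)
  from integral_Re[OF this] show ?thesis
    by (simp add: ip_def set_lebesgue_integral_def)
qed

lemma Re_dt_mult_mid: "Re (dt \<tau> U n x * cnj (mid U n x)) = ((cmod (U (Suc n) x))\<^sup>2 - (cmod (U n x))\<^sup>2) / (2 * \<tau>)"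
proof -
  have diff_mult_cnj_sum: "Re ((v - u) * cnj (v + u)) = (cmod v)\<^sup>2 - (cmod u)\<^sup>2" for u v
    by (simp only: cmod_power2) (simp add: power2_eq_square algebra_simps)
  have "dt \<tau> U n x * cnj (mid U n x) =
      (1 / (2 * \<tau>)) *\<^sub>R ((U (Suc n) x - U n x) * cnj (U (Suc n) x + U n x))"
    unfolding dt_def mid_def complex_cnj_scaleR mult_scaleR_left mult_scaleR_right scaleR_scaleR
    by (rule arg_cong2[where f = scaleR]) (simp_all only: divide_inverse inverse_mult_distrib mult_1_left)
  then show ?thesis
    by (simp only: scaleR_complex.simps diff_mult_cnj_sum) simp
qed

lemma has_continuous_extension_dt_mid:
  fixes U :: "nat \<Rightarrow> real \<Rightarrow> 'a::real_normed_vector"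
  assumes "has_continuous_extension a b (U n)" "has_continuous_extension a b (U (Suc n))"
  shows "has_continuous_extension a b (dt \<tau> U n)" "has_continuous_extension a b (mid U n)"
proof -
  note pair = has_continuous_extension_Pair[OF assms]
  have "has_continuous_extension a b (\<lambda>x. (\<lambda>z. (snd z - fst z) /\<^sub>R \<tau>) (U n x, U (Suc n) x))"
    by (intro has_continuous_extension_compose[OF pair, of "\<lambda>z. (snd z - fst z) /\<^sub>R \<tau>"] continuous_intros)
  then show "has_continuous_extension a b (dt \<tau> U n)" by (simp add: dt_def[abs_def])
  have "has_continuous_extension a b (\<lambda>x. (\<lambda>z. (snd z + fst z) /\<^sub>R 2) (U n x, U (Suc n) x))"
    by (intro has_continuous_extension_compose[OF pair, of "\<lambda>z. (snd z + fst z) /\<^sub>R 2"] continuous_intros)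
  then show "has_continuous_extension a b (mid U n)" by (simp add: mid_def[abs_def])
qed

lemma Re_ip_dt_mid:
  assumes U: "has_continuous_extension a b (U n)" "has_continuous_extension a b (U (Suc n))"
  shows "Re (ip a b (dt \<tau> U n) (mid U n)) = ((L2_nrm a b (U (Suc n)))\<^sup>2 - (L2_nrm a b (U n))\<^sup>2) / (2 * \<tau>)"
    and "Re (ip a b (mid U n) (dt \<tau> U n)) = ((L2_nrm a b (U (Suc n)))\<^sup>2 - (L2_nrm a b (U n))\<^sup>2) / (2 * \<tau>)"
proof -
  have int: "set_integrable lebesgue {a<..<b} (\<lambda>x. (cmod (u x))\<^sup>2)" if "has_continuous_extension a b u" for u
    by (intro has_continuous_extension_integrable has_continuous_extension_compose[OF that, of "\<lambda>z. (cmod z)\<^sup>2"] continuous_intros)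
  show *: "Re (ip a b (dt \<tau> U n) (mid U n)) = ((L2_nrm a b (U (Suc n)))\<^sup>2 - (L2_nrm a b (U n))\<^sup>2) / (2 * \<tau>)"
    unfolding Re_ip[OF has_continuous_extension_dt_mid[OF U]] L2_nrm_sq Re_dt_mult_mid
    using int[OF U(1)] int[OF U(2)] by simp
  then show "Re (ip a b (mid U n) (dt \<tau> U n)) = ((L2_nrm a b (U (Suc n)))\<^sup>2 - (L2_nrm a b (U n))\<^sup>2) / (2 * \<tau>)"
    by (metis ip_cnj cnj.simps(1))
qed

lemma dt_linear: "dt \<tau> U n = (\<lambda>x. (1 / \<tau>) *\<^sub>R U (Suc n) x + (- 1 / \<tau>) *\<^sub>R U n x)"
  by (simp add: dt_def fun_eq_iff scaleR_right_diff_distrib divide_inverse)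

lemma mid_linear: "mid U n = (\<lambda>x. (1 / 2) *\<^sub>R U (Suc n) x + (1 / 2) *\<^sub>R U n x)"
  by (simp add: mid_def fun_eq_iff scaleR_right_distrib)

text \<open>
  The mixed terms cancel in the real part by Hermitian symmetry.
\<close>

lemma Re_frac_form_mid_dt:
  assumes U: "U n \<in> poly_space a b N" "U (Suc n) \<in> poly_space a b N" and \<alpha>: "\<alpha> < 2"
  shows "Re (frac_form a b \<alpha> (mid U n) (dt \<tau> U n)) =
    (Re (frac_form a b \<alpha> (U (Suc n)) (U (Suc n))) - Re (frac_form a b \<alpha> (U n) (U n))) / (2 * \<tau>)"
proof -
  let ?B = "frac_form a b \<alpha>"
  have D: "dt \<tau> U n \<in> poly_space a b N" unfolding dt_linear by (intro poly_space_linear U)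
  have B: "?B w (dt \<tau> U n) = (1 / \<tau>) *\<^sub>R ?B w (U (Suc n)) + (- 1 / \<tau>) *\<^sub>R ?B w (U n)"
    if "w \<in> poly_space a b N" for w
  proof -
    have "cnj (?B (dt \<tau> U n) w) = cnj ((1 / \<tau>) *\<^sub>R ?B (U (Suc n)) w + (- 1 / \<tau>) *\<^sub>R ?B (U n) w)"
      unfolding dt_linear frac_form_linear[OF U(2,1) that \<alpha>] ..
    then show ?thesis by (simp add: frac_form_cnj)
  qed
  have sym: "Re (?B (U n) (U (Suc n))) = Re (?B (U (Suc n)) (U n))"
    by (metis frac_form_cnj cnj.simps(1))
  have "?B (mid U n) (dt \<tau> U n) = (1 / 2) *\<^sub>R ?B (U (Suc n)) (dt \<tau> U n) + (1 / 2) *\<^sub>R ?B (U n) (dt \<tau> U n)"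
    unfolding mid_linear by (rule frac_form_linear[OF U(2,1) D \<alpha>])
  then show ?thesis
    by (simp only: B[OF U(1)] B[OF U(2)] plus_complex.simps scaleR_complex.simps sym)
      (simp add: distrib_left diff_divide_distrib)
qed

text \<open>
  The coupling terms have this form, so they drop out of the mass balance.
\<close>

lemma ip_real_multiple_Im: "Im (ip a b (\<lambda>x. complex_of_real (r x) * u x) u) = 0"
proof -
  have "cnj (ip a b (\<lambda>x. complex_of_real (r x) * u x) u) = ip a b (\<lambda>x. complex_of_real (r x) * u x) u"
    unfolding ip_cnj unfolding ip_def by (simp add: mult_ac)
  then show ?thesis by (metis Reals_cnj_iff complex_is_Real_iff)
qed

lemma frac_form_self_Im: "Im (frac_form a b \<alpha> u u) = 0"
  using frac_form_cnj[of a b \<alpha> u u] by (metis Reals_cnj_iff complex_is_Real_iff)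

lemma cplx_dt: "cplx (dt \<tau> \<Phi> n) = dt \<tau> (\<lambda>n. cplx (\<Phi> n)) n"
  by (simp add: cplx_def dt_def fun_eq_iff scaleR_conv_of_real)

lemma cplx_mid: "cplx (mid \<Phi> n) = mid (\<lambda>n. cplx (\<Phi> n)) n"
  by (simp add: cplx_def mid_def fun_eq_iff scaleR_conv_of_real)

text \<open>
  The first integral is the coupling term of the Schroedinger equation tested with \<open>\<delta>\<^sub>t U\<close>, the second
  that of the Klein-Gordon equation tested with \<open>\<delta>\<^sub>t \<Phi>\<close>; primes and \<open>Q\<close> refer to the later time. The
  weights are those with which the two equations enter the energy balance. The proof is the pointwise
  identity \<open>(A' - A)(Q + P) + (A' + A)(Q - P) = 2(A'Q - AP)\<close>.
\<close>

lemma discrete_product_rule: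
  fixes A A' P Q :: "real \<Rightarrow> real"
  assumes hce: "has_continuous_extension a b A" "has_continuous_extension a b A'"
    "has_continuous_extension a b P" "has_continuous_extension a b Q" and \<tau>: "\<tau> \<noteq> 0"
  shows "4 * \<tau> * (LINT x:{a<..<b}|lebesgue. (A' x - A x) / (2 * \<tau>) * ((Q x + P x) / 2)) +
      \<tau> * (LINT x:{a<..<b}|lebesgue. (A' x + A x) * ((Q x - P x) / \<tau>)) =
    2 * ((LINT x:{a<..<b}|lebesgue. A' x * Q x) - (LINT x:{a<..<b}|lebesgue. A x * P x))"
proof -
  note pair = has_continuous_extension_Pair
  have int: "set_integrable lebesgue {a<..<b} (\<lambda>x. F ((A x, A' x), (P x, Q x)))"
    if "continuous_on UNIV F" for F :: "(real \<times> real) \<times> (real \<times> real) \<Rightarrow> real"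
    by (intro has_continuous_extension_Pair_integrable[OF pair pair, of a b A A' P Q F] hce that)
  have i1: "set_integrable lebesgue {a<..<b} (\<lambda>x. 4 * \<tau> * ((A' x - A x) / (2 * \<tau>) * ((Q x + P x) / 2)))"
    using int[of "\<lambda>z. 4 * \<tau> * ((snd (fst z) - fst (fst z)) / (2 * \<tau>) * ((snd (snd z) + fst (snd z)) / 2))"] \<tau>
    by (simp add: continuous_intros)
  have i2: "set_integrable lebesgue {a<..<b} (\<lambda>x. \<tau> * ((A' x + A x) * ((Q x - P x) / \<tau>)))"
    using int[of "\<lambda>z. \<tau> * ((snd (fst z) + fst (fst z)) * ((snd (snd z) - fst (snd z)) / \<tau>))"] \<tau>
    by (simp add: continuous_intros)
  have i3: "set_integrable lebesgue {a<..<b} (\<lambda>x. A' x * Q x)"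
    using int[of "\<lambda>z. snd (fst z) * snd (snd z)"] by (simp add: continuous_intros)
  have i4: "set_integrable lebesgue {a<..<b} (\<lambda>x. A x * P x)"
    using int[of "\<lambda>z. fst (fst z) * fst (snd z)"] by (simp add: continuous_intros)
  have eq: "4 * \<tau> * ((A' x - A x) / (2 * \<tau>) * ((Q x + P x) / 2)) + \<tau> * ((A' x + A x) * ((Q x - P x) / \<tau>)) =
      2 * (A' x * Q x - A x * P x)" for x
    using \<tau> by (simp add: field_simps)
  have "4 * \<tau> * (LINT x:{a<..<b}|lebesgue. (A' x - A x) / (2 * \<tau>) * ((Q x + P x) / 2)) +
      \<tau> * (LINT x:{a<..<b}|lebesgue. (A' x + A x) * ((Q x - P x) / \<tau>)) =
     (LINT x:{a<..<b}|lebesgue. 4 * \<tau> * ((A' x - A x) / (2 * \<tau>) * ((Q x + P x) / 2)) + \<tau> * ((A' x + A x) * ((Q x - P x) / \<tau>)))"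
    by (simp only: set_integral_add(2)[OF i1 i2] set_integral_mult_right)
  also have "\<dots> = 2 * ((LINT x:{a<..<b}|lebesgue. A' x * Q x) - (LINT x:{a<..<b}|lebesgue. A x * P x))"
    unfolding eq by (simp only: set_integral_mult_right set_integral_diff(2)[OF i3 i4])
  finally show ?thesis .
qed

section \<open>Conservation of mass and energy\<close>

text \<open>
  The imaginary part of the first equation tested with the average of \<open>U\<close>.
\<close>

lemma mass_step:
  assumes \<alpha>: "\<alpha> < 2" and \<tau>: "\<tau> > 0"
    and U: "U n \<in> XN0 a b \<alpha> N" "U (Suc n) \<in> XN0 a b \<alpha> N"
    and schroedinger: "\<And>w. w \<in> XN0 a b \<alpha> N \<Longrightarrow>
         \<i> * ip a b (dt \<tau> U n) w
           - complex_of_real (lam / 2) * frac_form a b \<alpha> (mid U n) w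
           + complex_of_real \<kappa>\<^sub>1 * ip a b (\<lambda>x. mid U n x * cplx (mid \<Phi> n) x) w
           + complex_of_real \<kappa>\<^sub>2 * ip a b (\<lambda>x.
               complex_of_real ((cmod (U (Suc n) x))\<^sup>2 + (cmod (U n x))\<^sup>2)
                 * mid U n x * cplx (mid \<Phi> n) x) w = 0"
  shows "discrete_mass a b U (Suc n) = discrete_mass a b U n"
proof -
  let ?w = "mid U n"
  have w: "?w \<in> XN0 a b \<alpha> N" unfolding mid_linear by (intro XN0_linear U)
  have hce: "has_continuous_extension a b (U n)" "has_continuous_extension a b (U (Suc n))"
    using U by (auto simp: XN0_def intro: poly_space_has_continuous_extension)
  have 1: "Im (ip a b (\<lambda>x. ?w x * cplx (mid \<Phi> n) x) ?w) = 0"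
    using ip_real_multiple_Im[of a b "mid \<Phi> n" ?w] by (simp add: cplx_def mult.commute)
  have 2: "Im (ip a b (\<lambda>x. complex_of_real ((cmod (U (Suc n) x))\<^sup>2 + (cmod (U n x))\<^sup>2)
                 * ?w x * cplx (mid \<Phi> n) x) ?w) = 0"
    using ip_real_multiple_Im[of a b "\<lambda>x. ((cmod (U (Suc n) x))\<^sup>2 + (cmod (U n x))\<^sup>2) * mid \<Phi> n x" ?w]
    by (simp add: cplx_def mult_ac)
  have "Re (ip a b (dt \<tau> U n) ?w) = 0"
    using arg_cong[OF schroedinger[OF w], of Im] 1 2 by (simp add: frac_form_self_Im)
  then show ?thesis
    using \<tau> by (simp add: Re_ip_dt_mid[OF hce] discrete_mass_def)
qed

text \<open>
  \<open>S\<close> is the real part of the first equation tested with \<open>\<delta>\<^sub>t U\<close>, where the time derivative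
  contributes \<open>i \<parallel>\<delta>\<^sub>t U\<parallel>\<^sup>2\<close> and drops out. \<open>V\<close> is the second equation tested with \<open>\<delta>\<^sub>t \<Psi>\<close> and
  identifies the leading term of the third equation tested with \<open>\<delta>\<^sub>t \<Phi>\<close>, which is \<open>KG\<close>. The
  coupling terms \<open>X k\<close> and \<open>Y k\<close> then add up to the change of the potential \<open>Z k\<close>.
\<close>

lemma energy_step:
  assumes ab: "a < b" and \<alpha>: "1 < \<alpha>" "\<alpha> < 2" and \<tau>: "\<tau> > 0"
    and U: "U n \<in> XN0 a b \<alpha> N" "U (Suc n) \<in> XN0 a b \<alpha> N"
    and \<Phi>: "cplx (\<Phi> n) \<in> XN0 a b \<alpha> N" "cplx (\<Phi> (Suc n)) \<in> XN0 a b \<alpha> N"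
    and \<Psi>: "cplx (\<Psi> n) \<in> XN0 a b \<alpha> N" "cplx (\<Psi> (Suc n)) \<in> XN0 a b \<alpha> N"
    and schroedinger: "\<And>w. w \<in> XN0 a b \<alpha> N \<Longrightarrow>
         \<i> * ip a b (dt \<tau> U n) w
           - complex_of_real (lam / 2) * frac_form a b \<alpha> (mid U n) w
           + complex_of_real \<kappa>\<^sub>1 * ip a b (\<lambda>x. mid U n x * cplx (mid \<Phi> n) x) w
           + complex_of_real \<kappa>\<^sub>2 * ip a b (\<lambda>x.
               complex_of_real ((cmod (U (Suc n) x))\<^sup>2 + (cmod (U n x))\<^sup>2)
                 * mid U n x * cplx (mid \<Phi> n) x) w = 0"
    and velocity: "\<And>w. w \<in> XN0 a b \<alpha> N \<Longrightarrow> ip a b (cplx (dt \<tau> \<Phi> n)) w = ip a b (cplx (mid \<Psi> n)) w"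
    and klein_gordon: "\<And>w. w \<in> XN0 a b \<alpha> N \<Longrightarrow> ip a b (cplx (dt \<tau> \<Psi> n)) w
           + complex_of_real \<gamma> * frac_form a b \<alpha> (cplx (mid \<Phi> n)) w
           + complex_of_real (\<eta>\<^sup>2) * ip a b (cplx (mid \<Phi> n)) w
           - complex_of_real (\<kappa>\<^sub>1 / 2) * ip a b (\<lambda>x.
               complex_of_real ((cmod (U (Suc n) x))\<^sup>2 + (cmod (U n x))\<^sup>2)) w
           - complex_of_real (\<kappa>\<^sub>2 / 2) * ip a b (\<lambda>x.
               complex_of_real ((cmod (U (Suc n) x))^4 + (cmod (U n x))^4)) w = 0"
  shows "discrete_energy a b \<alpha> lam \<kappa>\<^sub>1 \<kappa>\<^sub>2 \<gamma> \<eta> U \<Phi> \<Psi> (Suc n) = discrete_energy a b \<alpha> lam \<kappa>\<^sub>1 \<kappa>\<^sub>2 \<gamma> \<eta> U \<Phi> \<Psi> n"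
proof -
  let ?I = "\<lambda>f. LINT x:{a<..<b}|lebesgue. f x :: real"
  let ?B = "frac_form a b \<alpha>"
  let ?V = "U (Suc n)" and ?U = "U n" and ?P = "\<Phi> n" and ?Q = "\<Phi> (Suc n)"
  let ?\<Phi> = "\<lambda>n. cplx (\<Phi> n)" and ?\<Psi> = "\<lambda>n. cplx (\<Psi> n)"
  have X_hce: "has_continuous_extension a b u" if "u \<in> XN0 a b \<alpha> N" for u
    using that by (auto simp: XN0_def intro: poly_space_has_continuous_extension)
  have X_poly: "u \<in> poly_space a b N" if "u \<in> XN0 a b \<alpha> N" for u
    using that by (simp add: XN0_def)
  have real_hce: "has_continuous_extension a b f" if "has_continuous_extension a b (cplx f)" for f
    using has_continuous_extension_compose[OF that, of Re] by (simp add: cplx_def continuous_intros)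
  have pow_hce: "has_continuous_extension a b (\<lambda>x. (cmod (u x)) ^ k)" if "has_continuous_extension a b u" for u and k :: nat
    by (intro has_continuous_extension_compose[OF that, of "\<lambda>z. (cmod z) ^ k"] continuous_intros)
  note hU = X_hce[OF U(1)] X_hce[OF U(2)]
  note h\<Phi> = X_hce[OF \<Phi>(1)] X_hce[OF \<Phi>(2)]
  note h\<Psi> = X_hce[OF \<Psi>(1)] X_hce[OF \<Psi>(2)]
  note hPQ = real_hce[OF h\<Phi>(1)] real_hce[OF h\<Phi>(2)]
  have hmidQ: "has_continuous_extension a b (mid \<Phi> n)"
    by (rule has_continuous_extension_dt_mid) (rule hPQ)+
  have mid\<Phi>: "mid \<Phi> n x = (?Q x + ?P x) / 2" and dt\<Phi>: "dt \<tau> \<Phi> n x = (?Q x - ?P x) / \<tau>" for x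
    unfolding mid_def dt_def real_scaleR_def divide_inverse by (rule mult.commute)+
  define X where "X k = ?I (\<lambda>x. ((cmod (?V x)) ^ k - (cmod (?U x)) ^ k) / (2 * \<tau>) * ((?Q x + ?P x) / 2))" for k
  define Y where "Y k = ?I (\<lambda>x. ((cmod (?V x)) ^ k + (cmod (?U x)) ^ k) * ((?Q x - ?P x) / \<tau>))" for k
  define Z where "Z k m = ?I (\<lambda>x. (cmod (U m x)) ^ k * \<Phi> m x)" for k m
  have product_rule: "4 * \<tau> * X k + \<tau> * Y k = 2 * (Z k (Suc n) - Z k n)" for k
    unfolding X_def Y_def Z_def
    by (rule discrete_product_rule) (use \<tau> hPQ in \<open>auto intro: pow_hce hU\<close>)

  have S: "- (lam / 2) * ((Re (?B ?V ?V) - Re (?B ?U ?U)) / (2 * \<tau>)) + \<kappa>\<^sub>1 * X 2 + \<kappa>\<^sub>2 * X 4 = 0"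
  proof -
    let ?w = "dt \<tau> U n"
    have w: "?w \<in> XN0 a b \<alpha> N" unfolding dt_linear by (intro XN0_linear U)
    note hw = has_continuous_extension_dt_mid[OF hU]
    have re: "Re (mid U n x * cnj (?w x)) = ((cmod (?V x))\<^sup>2 - (cmod (?U x))\<^sup>2) / (2 * \<tau>)" for x
      unfolding Re_dt_mult_mid[symmetric] by simp
    have 1: "Re (ip a b (\<lambda>x. mid U n x * cplx (mid \<Phi> n) x) ?w) = X 2"
    proof -
      have "has_continuous_extension a b (\<lambda>x. mid U n x * cplx (mid \<Phi> n) x)"
        using has_continuous_extension_compose[OF has_continuous_extension_Pair[OF hw(2) hmidQ],
            of "\<lambda>z. fst z * complex_of_real (snd z)"] by (simp add: cplx_def continuous_intros)
      then have "Re (ip a b (\<lambda>x. mid U n x * cplx (mid \<Phi> n) x) ?w) =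
          ?I (\<lambda>x. Re (mid U n x * cplx (mid \<Phi> n) x * cnj (?w x)))"
        using hw(1) by (rule Re_ip)
      also have "(\<lambda>x. Re (mid U n x * cplx (mid \<Phi> n) x * cnj (?w x))) =
          (\<lambda>x. Re (mid U n x * cnj (?w x)) * mid \<Phi> n x)"
        by (simp add: fun_eq_iff cplx_def algebra_simps)
      finally show ?thesis unfolding X_def re mid\<Phi> .
    qed
    have 2: "Re (ip a b (\<lambda>x. complex_of_real ((cmod (?V x))\<^sup>2 + (cmod (?U x))\<^sup>2)
                 * mid U n x * cplx (mid \<Phi> n) x) ?w) = X 4"
    proof -
      have h: "has_continuous_extension a b (\<lambda>x. complex_of_real ((cmod (?V x))\<^sup>2 + (cmod (?U x))\<^sup>2)
                 * mid U n x * cplx (mid \<Phi> n) x)"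
        using has_continuous_extension_compose[OF has_continuous_extension_Pair[OF
              has_continuous_extension_Pair[OF hU] has_continuous_extension_Pair[OF hw(2) hmidQ]],
            of "\<lambda>z. complex_of_real ((cmod (snd (fst z)))\<^sup>2 + (cmod (fst (fst z)))\<^sup>2) * fst (snd z) * complex_of_real (snd (snd z))"]
        by (simp add: cplx_def continuous_intros)
      have "Re (ip a b (\<lambda>x. complex_of_real ((cmod (?V x))\<^sup>2 + (cmod (?U x))\<^sup>2)
                 * mid U n x * cplx (mid \<Phi> n) x) ?w) =
          ?I (\<lambda>x. Re (complex_of_real ((cmod (?V x))\<^sup>2 + (cmod (?U x))\<^sup>2) * mid U n x * cplx (mid \<Phi> n) x * cnj (?w x)))"
        by (rule Re_ip[OF h hw(1)])
      also have "(\<lambda>x. Re (complex_of_real ((cmod (?V x))\<^sup>2 + (cmod (?U x))\<^sup>2) * mid U n x * cplx (mid \<Phi> n) x * cnj (?w x))) =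
          (\<lambda>x. ((cmod (?V x))\<^sup>2 + (cmod (?U x))\<^sup>2) * Re (mid U n x * cnj (?w x)) * mid \<Phi> n x)"
      proof
        fix x
        have "complex_of_real ((cmod (?V x))\<^sup>2 + (cmod (?U x))\<^sup>2) * mid U n x * cplx (mid \<Phi> n) x * cnj (?w x) =
          (((cmod (?V x))\<^sup>2 + (cmod (?U x))\<^sup>2) * mid \<Phi> n x) *\<^sub>R (mid U n x * cnj (?w x))"
          by (simp add: cplx_def scaleR_conv_of_real mult_ac)
        then show "Re (complex_of_real ((cmod (?V x))\<^sup>2 + (cmod (?U x))\<^sup>2) * mid U n x * cplx (mid \<Phi> n) x * cnj (?w x)) =
          ((cmod (?V x))\<^sup>2 + (cmod (?U x))\<^sup>2) * Re (mid U n x * cnj (?w x)) * mid \<Phi> n x"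
          by (simp only: scaleR_complex.simps) (simp only: mult_ac)
      qed
      also have "\<dots> = (\<lambda>x. ((cmod (?V x)) ^ 4 - (cmod (?U x)) ^ 4) / (2 * \<tau>) * ((?Q x + ?P x) / 2))"
      proof
        fix x
        \<comment> \<open>In the first equation the factor \<open>|V|\<^sup>2 + |U|\<^sup>2\<close> completes the difference of squares to a
          difference of fourth powers.\<close>
        have quartic: "v ^ 4 - u ^ 4 = (v\<^sup>2 + u\<^sup>2) * (v\<^sup>2 - u\<^sup>2)" for u v :: real
          by (simp add: algebra_simps flip: power_add)
        show "((cmod (?V x))\<^sup>2 + (cmod (?U x))\<^sup>2) * Re (mid U n x * cnj (?w x)) * mid \<Phi> n x =
            ((cmod (?V x)) ^ 4 - (cmod (?U x)) ^ 4) / (2 * \<tau>) * ((?Q x + ?P x) / 2)"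
          unfolding re mid\<Phi> quartic by simp
      qed
      finally show ?thesis unfolding X_def .
    qed
    have 3: "Im (ip a b ?w ?w) = 0"
      using ip_real_multiple_Im[of a b "\<lambda>_. 1" ?w] by simp
    show ?thesis
      using arg_cong[OF schroedinger[OF w], of Re] 1 2 3
        Re_frac_form_mid_dt[OF X_poly[OF U(1)] X_poly[OF U(2)] \<alpha>(2), of \<tau>]
      by simp
  qed

  have V: "Re (ip a b (cplx (dt \<tau> \<Psi> n)) (cplx (dt \<tau> \<Phi> n))) =
      ((L2_nrm a b (cplx (\<Psi> (Suc n))))\<^sup>2 - (L2_nrm a b (cplx (\<Psi> n)))\<^sup>2) / (2 * \<tau>)"
  proof -
    have "cplx (dt \<tau> \<Psi> n) \<in> XN0 a b \<alpha> N"
      unfolding cplx_dt unfolding dt_linear by (intro XN0_linear \<Psi>)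
    from velocity[OF this]
    have "cnj (ip a b (cplx (dt \<tau> \<Phi> n)) (cplx (dt \<tau> \<Psi> n))) = cnj (ip a b (cplx (mid \<Psi> n)) (cplx (dt \<tau> \<Psi> n)))"
      by simp
    then show ?thesis
      using Re_ip_dt_mid(1)[of a b ?\<Psi> n \<tau>, OF h\<Psi>] by (simp add: ip_cnj cplx_dt cplx_mid)
  qed

  have KG: "((L2_nrm a b (cplx (\<Psi> (Suc n))))\<^sup>2 - (L2_nrm a b (cplx (\<Psi> n)))\<^sup>2) / (2 * \<tau>)
      + \<gamma> * ((Re (?B (cplx ?Q) (cplx ?Q)) - Re (?B (cplx ?P) (cplx ?P))) / (2 * \<tau>))
      + \<eta>\<^sup>2 * (((L2_nrm a b (cplx ?Q))\<^sup>2 - (L2_nrm a b (cplx ?P))\<^sup>2) / (2 * \<tau>))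
      - \<kappa>\<^sub>1 / 2 * Y 2 - \<kappa>\<^sub>2 / 2 * Y 4 = 0"
  proof -
    let ?w = "cplx (dt \<tau> \<Phi> n)"
    have w: "?w \<in> XN0 a b \<alpha> N" unfolding cplx_dt unfolding dt_linear by (intro XN0_linear \<Phi>)
    have y: "Re (ip a b (\<lambda>x. complex_of_real ((cmod (?V x)) ^ k + (cmod (?U x)) ^ k)) ?w) = Y k" for k
    proof -
      have "has_continuous_extension a b (\<lambda>x. complex_of_real ((cmod (?V x)) ^ k + (cmod (?U x)) ^ k))"
        using has_continuous_extension_compose[OF has_continuous_extension_Pair[OF hU],
            of "\<lambda>z. complex_of_real ((cmod (snd z)) ^ k + (cmod (fst z)) ^ k)"]
        by (simp add: continuous_intros)
      then have "Re (ip a b (\<lambda>x. complex_of_real ((cmod (?V x)) ^ k + (cmod (?U x)) ^ k)) ?w) =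
          ?I (\<lambda>x. Re (complex_of_real ((cmod (?V x)) ^ k + (cmod (?U x)) ^ k) * cnj (?w x)))"
        using X_hce[OF w] by (rule Re_ip)
      also have "(\<lambda>x. Re (complex_of_real ((cmod (?V x)) ^ k + (cmod (?U x)) ^ k) * cnj (?w x))) =
          (\<lambda>x. ((cmod (?V x)) ^ k + (cmod (?U x)) ^ k) * ((?Q x - ?P x) / \<tau>))"
        unfolding cplx_def dt\<Phi> complex_cnj_complex_of_real of_real_mult[symmetric] Re_complex_of_real ..
      finally show ?thesis unfolding Y_def .
    qed
    have "Re (?B (cplx (mid \<Phi> n)) ?w) = (Re (?B (cplx ?Q) (cplx ?Q)) - Re (?B (cplx ?P) (cplx ?P))) / (2 * \<tau>)"
      unfolding cplx_dt cplx_mid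
      by (rule Re_frac_form_mid_dt[of ?\<Phi> n a b N \<alpha> \<tau>, OF X_poly[OF \<Phi>(1)] X_poly[OF \<Phi>(2)] \<alpha>(2)])
    moreover have "Re (ip a b (cplx (mid \<Phi> n)) ?w) = ((L2_nrm a b (cplx ?Q))\<^sup>2 - (L2_nrm a b (cplx ?P))\<^sup>2) / (2 * \<tau>)"
      unfolding cplx_dt cplx_mid by (rule Re_ip_dt_mid(2)[of a b ?\<Phi> n \<tau>, OF h\<Phi>])
    ultimately show ?thesis
      using arg_cong[OF klein_gordon[OF w], of Re] V y[of 2] y[of 4] by simp
  qed

  have coupling: "?I (\<lambda>x. (\<kappa>\<^sub>1 * (cmod (U m x))\<^sup>2 + \<kappa>\<^sub>2 * (cmod (U m x)) ^ 4) * \<Phi> m x) = \<kappa>\<^sub>1 * Z 2 m + \<kappa>\<^sub>2 * Z 4 m"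
    if h: "has_continuous_extension a b (U m)" "has_continuous_extension a b (\<Phi> m)" for m
  proof -
    have int: "set_integrable lebesgue {a<..<b} (\<lambda>x. \<kappa> * ((cmod (U m x)) ^ k * \<Phi> m x))" for k \<kappa>
      using has_continuous_extension_Pair_integrable[OF h, of "\<lambda>z. \<kappa> * ((cmod (fst z)) ^ k * snd z)"]
      by (simp add: continuous_intros)
    have "?I (\<lambda>x. (\<kappa>\<^sub>1 * (cmod (U m x))\<^sup>2 + \<kappa>\<^sub>2 * (cmod (U m x)) ^ 4) * \<Phi> m x) =
        ?I (\<lambda>x. \<kappa>\<^sub>1 * ((cmod (U m x))\<^sup>2 * \<Phi> m x) + \<kappa>\<^sub>2 * ((cmod (U m x)) ^ 4 * \<Phi> m x))"
      by (simp only: distrib_right mult.assoc)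
    then show ?thesis unfolding Z_def by (simp only: set_integral_add(2)[OF int int] set_integral_mult_right)
  qed
  have E: "discrete_energy a b \<alpha> lam \<kappa>\<^sub>1 \<kappa>\<^sub>2 \<gamma> \<eta> U \<Phi> \<Psi> m =
      (L2_nrm a b (cplx (\<Psi> m)))\<^sup>2 + \<gamma> * Re (?B (cplx (\<Phi> m)) (cplx (\<Phi> m)))
      + \<eta>\<^sup>2 * (L2_nrm a b (cplx (\<Phi> m)))\<^sup>2 + lam * Re (?B (U m) (U m)) - 2 * (\<kappa>\<^sub>1 * Z 2 m + \<kappa>\<^sub>2 * Z 4 m)"
    if m: "U m \<in> XN0 a b \<alpha> N" "cplx (\<Phi> m) \<in> XN0 a b \<alpha> N" for m
    unfolding discrete_energy_def coupling[OF X_hce[OF m(1)] real_hce[OF X_hce[OF m(2)]]]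
      XN0_frac_seminorm_sq[OF ab \<alpha> m(1)] XN0_frac_seminorm_sq[OF ab \<alpha> m(2)] ..

  have S': "lam * (Re (?B ?V ?V) - Re (?B ?U ?U)) = \<kappa>\<^sub>1 * (4 * \<tau> * X 2) + \<kappa>\<^sub>2 * (4 * \<tau> * X 4)"
    using S \<tau> by (simp add: field_simps)
  have KG': "((L2_nrm a b (cplx (\<Psi> (Suc n))))\<^sup>2 - (L2_nrm a b (cplx (\<Psi> n)))\<^sup>2)
      + \<gamma> * (Re (?B (cplx ?Q) (cplx ?Q)) - Re (?B (cplx ?P) (cplx ?P)))
      + \<eta>\<^sup>2 * ((L2_nrm a b (cplx ?Q))\<^sup>2 - (L2_nrm a b (cplx ?P))\<^sup>2) = \<kappa>\<^sub>1 * (\<tau> * Y 2) + \<kappa>\<^sub>2 * (\<tau> * Y 4)"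
  proof -
    have "d1 + \<gamma> * d2 + \<eta>\<^sup>2 * d3 - \<kappa>\<^sub>1 * (\<tau> * y1) - \<kappa>\<^sub>2 * (\<tau> * y2) =
        2 * \<tau> * (d1 / (2 * \<tau>) + \<gamma> * (d2 / (2 * \<tau>)) + \<eta>\<^sup>2 * (d3 / (2 * \<tau>)) - \<kappa>\<^sub>1 / 2 * y1 - \<kappa>\<^sub>2 / 2 * y2)"
      for d1 d2 d3 y1 y2
      using \<tau> by (simp add: distrib_left right_diff_distrib)
    from this[of "(L2_nrm a b (cplx (\<Psi> (Suc n))))\<^sup>2 - (L2_nrm a b (cplx (\<Psi> n)))\<^sup>2"
        "Re (?B (cplx ?Q) (cplx ?Q)) - Re (?B (cplx ?P) (cplx ?P))"
        "(L2_nrm a b (cplx ?Q))\<^sup>2 - (L2_nrm a b (cplx ?P))\<^sup>2" "Y 2" "Y 4"]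
    show ?thesis unfolding KG by simp
  qed
  have "\<kappa>\<^sub>1 * (4 * \<tau> * X 2) + \<kappa>\<^sub>2 * (4 * \<tau> * X 4) + (\<kappa>\<^sub>1 * (\<tau> * Y 2) + \<kappa>\<^sub>2 * (\<tau> * Y 4)) =
      \<kappa>\<^sub>1 * (2 * (Z 2 (Suc n) - Z 2 n)) + \<kappa>\<^sub>2 * (2 * (Z 4 (Suc n) - Z 4 n))"
    unfolding product_rule[symmetric] by (simp add: algebra_simps)
  with S' KG' show ?thesis
    unfolding E[OF U(1) \<Phi>(1)] E[OF U(2) \<Phi>(2)] by (simp add: algebra_simps)
qed

theorem theorem3p1:
  fixes a b \<alpha> T lam \<kappa>\<^sub>1 \<kappa>\<^sub>2 \<gamma> \<eta> :: real
    and N Nt :: nat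
    and u\<^sub>0 :: "real \<Rightarrow> complex" and \<phi>\<^sub>0 \<phi>\<^sub>1 :: "real \<Rightarrow> real"
    and U :: "nat \<Rightarrow> real \<Rightarrow> complex" and \<Phi> \<Psi> :: "nat \<Rightarrow> real \<Rightarrow> real"
  assumes "a < b" and "1 < \<alpha>" and "\<alpha> < 2" and "T > 0" and "Nt \<ge> 1"
    and "lam \<ge> 0" and "\<kappa>\<^sub>1 \<ge> 0" and "\<kappa>\<^sub>2 \<ge> 0" and "\<gamma> \<ge> 0"
    and "smooth_on {a<..<b} u\<^sub>0" and "u\<^sub>0 \<in> Hs0 a b (\<alpha> / 2)"
    and "smooth_on {a<..<b} \<phi>\<^sub>0" and "cplx \<phi>\<^sub>0 \<in> Hs0 a b (\<alpha> / 2)"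
    and "smooth_on {a<..<b} \<phi>\<^sub>1" and "cplx \<phi>\<^sub>1 \<in> Hs0 a b (\<alpha> / 2)"
    and "CN_SGM_solution a b \<alpha> lam \<kappa>\<^sub>1 \<kappa>\<^sub>2 \<gamma> \<eta> T N Nt u\<^sub>0 \<phi>\<^sub>0 \<phi>\<^sub>1 U \<Phi> \<Psi>"
  shows "\<forall>n\<in>{1..Nt}. discrete_mass a b U n = discrete_mass a b U 0 \<and>
           discrete_energy a b \<alpha> lam \<kappa>\<^sub>1 \<kappa>\<^sub>2 \<gamma> \<eta> U \<Phi> \<Psi> n =
           discrete_energy a b \<alpha> lam \<kappa>\<^sub>1 \<kappa>\<^sub>2 \<gamma> \<eta> U \<Phi> \<Psi> 0"
proof -
  define \<tau> where "\<tau> = T / real Nt"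
  have \<tau>: "\<tau> > 0" using assms(4,5) by (simp add: \<tau>_def)
  note sol = assms(16)[unfolded CN_SGM_solution_def Let_def, folded \<tau>_def]
  have step: "discrete_mass a b U (Suc n) = discrete_mass a b U n \<and>
      discrete_energy a b \<alpha> lam \<kappa>\<^sub>1 \<kappa>\<^sub>2 \<gamma> \<eta> U \<Phi> \<Psi> (Suc n) =
      discrete_energy a b \<alpha> lam \<kappa>\<^sub>1 \<kappa>\<^sub>2 \<gamma> \<eta> U \<Phi> \<Psi> n" if n: "n < Nt" for n
  proof -
    have X: "U n \<in> XN0 a b \<alpha> N" "U (Suc n) \<in> XN0 a b \<alpha> N"
      "cplx (\<Phi> n) \<in> XN0 a b \<alpha> N" "cplx (\<Phi> (Suc n)) \<in> XN0 a b \<alpha> N"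
      "cplx (\<Psi> n) \<in> XN0 a b \<alpha> N" "cplx (\<Psi> (Suc n)) \<in> XN0 a b \<alpha> N"
      using sol n by auto
    note eqs = sol[THEN conjunct2, THEN conjunct2, THEN conjunct2, THEN conjunct2, rule_format, OF n]
    show ?thesis
      by (intro conjI mass_step[OF assms(3) \<tau> X(1,2), where \<Phi> = \<Phi>] energy_step[OF assms(1-3) \<tau> X])
        (use eqs in blast)+
  qed
  have conserved: "n \<le> Nt \<Longrightarrow> discrete_mass a b U n = discrete_mass a b U 0 \<and>
      discrete_energy a b \<alpha> lam \<kappa>\<^sub>1 \<kappa>\<^sub>2 \<gamma> \<eta> U \<Phi> \<Psi> n =
      discrete_energy a b \<alpha> lam \<kappa>\<^sub>1 \<kappa>\<^sub>2 \<gamma> \<eta> U \<Phi> \<Psi> 0" for n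
    by (induction n) (use step in auto)
  show ?thesis
  proof (rule ballI)
    fix n assume "n \<in> {1..Nt}"
    then have "n \<le> Nt" by simp
    then show "discrete_mass a b U n = discrete_mass a b U 0 \<and>
        discrete_energy a b \<alpha> lam \<kappa>\<^sub>1 \<kappa>\<^sub>2 \<gamma> \<eta> U \<Phi> \<Psi> n =
        discrete_energy a b \<alpha> lam \<kappa>\<^sub>1 \<kappa>\<^sub>2 \<gamma> \<eta> U \<Phi> \<Psi> 0" by (rule conserved)
  qed
qed

end
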